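(* Let $K$ be a field and let $n,d$ be integers with $n\geq 5$ and $n+1\leq d\leq 2n-4$. Then there exists a finite connected graph $G$ on $n$ vertices with $\operatorname{depth}(S/J_G)=4$ and $\dim(S/J_G)=d$, where $S=K[x_1,\ldots,x_n,y_1,\ldots,y_n]$ and $J_G\subset S$ is the binomial edge ideal of $G$.
   Context: Every graph is finite, with no loops and no multiple edges (and no isolated vertices, which is automatic for connected graphs on at least two vertices). For a graph $G$ on the vertex set $[n]=\{1,\ldots,n\}$ with edge set $E(G)$, let $S=K[x_1,\ldots,x_n,y_1,\ldots,y_n]$ be the polynomial ring in $2n$ variables over a field $K$. The binomial edge ideal $J_G$ of $G$ is the ideal of $S$ generated by the binomials $x_iy_j-x_jy_i$ with $i<j$ and $\{i,j\}\in E(G)$. Here $\dim(S/J_G)$ is the Krull dimension and $\operatorname{depth}(S/J_G)$ is the depth of $S/J_G$ as a finitely generated graded $S$-module (with respect to the graded maximal ideal of $S$). *)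

theory Defs
  imports
    "HOL-Algebra.QuotRing"
    "HOL-Algebra.Module"
    "HOL-Library.Poly_Mapping"
    "HOL-Library.Extended_Nat"
begin

section \<open>Finite simple graphs\<close>

definition simple_graph :: "'v set \<Rightarrow> 'v set set \<Rightarrow> bool" where
  "simple_graph V E \<longleftrightarrow> finite V \<and> (\<forall>e\<in>E. e \<subseteq> V \<and> card e = 2)"

definition connected_graph :: "'v set \<Rightarrow> 'v set set \<Rightarrow> bool" where
  "connected_graph V E \<longleftrightarrow>
     simple_graph V E \<and> V \<noteq> {} \<and> (\<forall>u\<in>V. \<forall>v\<in>V. (u, v) \<in> {(a, b). {a, b} \<in> E}\<^sup>*)"


section \<open>Krull dimension\<close>

text \<open>
  The supremum of all \<open>k\<close> for which there is a strictly ascending chain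
  \<open>P 0 \<subset> P 1 \<subset> \<dots> \<subset> P k\<close> of prime ideals. The zero ring has no prime ideals and
  gets the value \<open>0\<close> here, \<open>enat\<close> having no negative infinity.
\<close>

definition krull_dim :: "('a, 'b) ring_scheme \<Rightarrow> enat" where
  "krull_dim R =
     Sup {enat k | k. \<exists>P. (\<forall>i\<le>k. primeideal (P i) R) \<and> (\<forall>i<k. P i \<subset> P (Suc i))}"


section \<open>Depth of a module\<close>

text \<open>The submodule \<open>(f\<^sub>1, \<dots>, f\<^sub>r) M = f\<^sub>1 M + \<dots> + f\<^sub>r M\<close>.\<close>

fun seq_smult :: "('a, 'b, 'c) module_scheme \<Rightarrow> 'a list \<Rightarrow> 'b set" where
  "seq_smult M [] = {\<zero>\<^bsub>M\<^esub>}"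
| "seq_smult M (f # fs) = {f \<odot>\<^bsub>M\<^esub> u \<oplus>\<^bsub>M\<^esub> v | u v. u \<in> carrier M \<and> v \<in> seq_smult M fs}"

text \<open>
  The second conjunct says that \<open>f\<^sub>i\<^sub>+\<^sub>1\<close> is a nonzerodivisor on
  \<open>M / (f\<^sub>1, \<dots>, f\<^sub>i) M\<close>, written with representatives in \<open>M\<close>.
\<close>

definition regular_seq :: "('a, 'b, 'c) module_scheme \<Rightarrow> 'a list \<Rightarrow> bool" where
  "regular_seq M fs \<longleftrightarrow>
     seq_smult M fs \<noteq> carrier M \<and>
     (\<forall>i<length fs. \<forall>u\<in>carrier M.
        fs ! i \<odot>\<^bsub>M\<^esub> u \<in> seq_smult M (take i fs) \<longrightarrow> u \<in> seq_smult M (take i fs))"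

text \<open>Depth with respect to an ideal \<open>I\<close> of the base ring.\<close>

definition depth :: "'a set \<Rightarrow> ('a, 'b, 'c) module_scheme \<Rightarrow> enat" where
  "depth I M = Sup {enat (length fs) | fs. set fs \<subseteq> I \<and> regular_seq M fs}"


section \<open>The quotient \<open>R/J\<close> as an \<open>R\<close>-module\<close>

definition quot_module :: "('a, 'b) ring_scheme \<Rightarrow> 'a set \<Rightarrow> ('a, 'a set) module" where
  "quot_module R J = ring.extend (R Quot J)
     \<lparr>smult = (\<lambda>r X. (J +>\<^bsub>R\<^esub> r) \<otimes>\<^bsub>R Quot J\<^esub> X)\<rparr>"

lemma quot_module_simps [simp]:
  "carrier (quot_module R J) = carrier (R Quot J)"
  "mult (quot_module R J) = mult (R Quot J)"
  "one (quot_module R J) = one (R Quot J)"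
  "zero (quot_module R J) = zero (R Quot J)"
  "add (quot_module R J) = add (R Quot J)"
  "smult (quot_module R J) r X = (J +>\<^bsub>R\<^esub> r) \<otimes>\<^bsub>R Quot J\<^esub> X"
  by (simp_all add: quot_module_def ring.defs)

lemma module_quot_module:
  assumes "cring R" "ideal J R"
  shows "Module.module R (quot_module R J)"
proof -
  interpret cring R by fact
  interpret J: ideal J R by fact
  interpret Q: cring "R Quot J"
    by (rule J.quotient_is_cring) (rule assms(1))
  interpret h: ring_hom_ring R "R Quot J" "(+>\<^bsub>R\<^esub>) J"
    by (rule J.rcos_ring_hom_ring)
  have ag: "abelian_group (quot_module R J)"
  proof (rule abelian_groupI)
    fix x assume "x \<in> carrier (quot_module R J)"
    then show "\<exists>y\<in>carrier (quot_module R J).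
        y \<oplus>\<^bsub>quot_module R J\<^esub> x = \<zero>\<^bsub>quot_module R J\<^esub>"
      using Q.l_neg Q.a_inv_closed by (metis quot_module_simps(1,4,5))
  qed (simp_all add: Q.a_ac)
  show ?thesis
    by (rule Module.moduleI)
       (simp_all add: assms(1) ag h.hom_closed[simplified] Q.l_distr Q.r_distr Q.m_assoc
          h.hom_add h.hom_mult h.hom_one)
qed


section \<open>Polynomial rings\<close>

text \<open>
  Monomials are finitely supported exponent functions, and multiplication of finitely
  supported functions on monomials is convolution. The carrier consists of the polynomials
  that only involve variables from \<open>V\<close>.
\<close>

type_synonym ('v, 'k) mpoly = "('v \<Rightarrow>\<^sub>0 nat) \<Rightarrow>\<^sub>0 'k"

definition poly_ring :: "'v set \<Rightarrow> ('v, 'k::comm_ring_1) mpoly ring" where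
  "poly_ring V =
     \<lparr>carrier = {p. \<forall>m\<in>Poly_Mapping.keys p. Poly_Mapping.keys m \<subseteq> V},
      mult = (*), one = 1, zero = 0, add = (+)\<rparr>"

definition pvar :: "'v \<Rightarrow> ('v, 'k::comm_ring_1) mpoly" where
  "pvar v = Poly_Mapping.single (Poly_Mapping.single v 1) 1"

lemma poly_ring_simps [simp]:
  "mult (poly_ring V) = (*)" "one (poly_ring V) = 1"
  "zero (poly_ring V) = 0" "add (poly_ring V) = (+)"
  by (simp_all add: poly_ring_def)

lemma in_carrier_poly_ring:
  "p \<in> carrier (poly_ring V) \<longleftrightarrow>
     (\<forall>m\<in>Poly_Mapping.keys p. Poly_Mapping.keys m \<subseteq> V)"
  by (simp add: poly_ring_def)

lemma pvar_in_carrier: "v \<in> V \<Longrightarrow> pvar v \<in> carrier (poly_ring V)"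
  by (simp add: in_carrier_poly_ring pvar_def)

lemma add_in_poly_ring:
  assumes "p \<in> carrier (poly_ring V)" "q \<in> carrier (poly_ring V)"
  shows "p + q \<in> carrier (poly_ring V)"
  using assms Poly_Mapping.keys_add[of p q] by (fastforce simp: in_carrier_poly_ring)

lemma mult_in_poly_ring:
  assumes "p \<in> carrier (poly_ring V)" "q \<in> carrier (poly_ring V)"
  shows "p * q \<in> carrier (poly_ring V)"
  unfolding in_carrier_poly_ring
proof
  fix m assume "m \<in> Poly_Mapping.keys (p * q)"
  then obtain a b where "m = a + b" "a \<in> Poly_Mapping.keys p" "b \<in> Poly_Mapping.keys q"
    using Poly_Mapping.keys_mult[of p q] by blast
  then show "Poly_Mapping.keys m \<subseteq> V"
    using assms Poly_Mapping.keys_add[of a b] unfolding in_carrier_poly_ring by blast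
qed

lemma uminus_in_poly_ring:
  "p \<in> carrier (poly_ring V) \<Longrightarrow> - p \<in> carrier (poly_ring V)"
  by (auto simp: in_carrier_poly_ring in_keys_iff)

lemma cring_poly_ring: "cring (poly_ring V :: ('v, 'k::comm_ring_1) mpoly ring)"
proof (rule cringI)
  show "abelian_group (poly_ring V :: ('v, 'k) mpoly ring)"
  proof (rule abelian_groupI)
    fix p :: "('v, 'k) mpoly" assume "p \<in> carrier (poly_ring V)"
    then show "\<exists>q\<in>carrier (poly_ring V). q \<oplus>\<^bsub>poly_ring V\<^esub> p = \<zero>\<^bsub>poly_ring V\<^esub>"
      by (intro bexI[of _ "- p"]) (auto intro: uminus_in_poly_ring)
  qed (auto simp: add_in_poly_ring ac_simps in_carrier_poly_ring[of 0])
  show "Group.comm_monoid (poly_ring V :: ('v, 'k) mpoly ring)"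
    by (rule comm_monoidI) (auto simp: mult_in_poly_ring ac_simps in_carrier_poly_ring[of 1])
qed (simp add: distrib_right)


section \<open>Binomial edge ideals\<close>

datatype bvar = X nat | Y nat

definition bvars :: "nat \<Rightarrow> bvar set" where
  "bvars n = X ` {1..n} \<union> Y ` {1..n}"

text \<open>\<open>K[x\<^sub>1, \<dots>, x\<^sub>n, y\<^sub>1, \<dots>, y\<^sub>n]\<close>, the field \<open>K\<close> being the type \<open>'k\<close>.\<close>

abbreviation bring :: "nat \<Rightarrow> (bvar, 'k::field) mpoly ring" where
  "bring n \<equiv> poly_ring (bvars n)"

definition graded_max_ideal :: "nat \<Rightarrow> (bvar, 'k::field) mpoly set" where
  "graded_max_ideal n = Idl\<^bsub>bring n\<^esub> (pvar ` bvars n)"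

definition binomial_edge_ideal :: "nat \<Rightarrow> nat set set \<Rightarrow> (bvar, 'k::field) mpoly set" where
  "binomial_edge_ideal n E =
     Idl\<^bsub>bring n\<^esub> {pvar (X i) * pvar (Y j) - pvar (X j) * pvar (Y i) | i j. i < j \<and> {i, j} \<in> E}"

lemma ideal_binomial_edge_ideal:
  assumes "simple_graph {1..n} E"
  shows "ideal (binomial_edge_ideal n E :: (bvar, 'k::field) mpoly set) (bring n)"
proof -
  interpret cring "bring n :: (bvar, 'k) mpoly ring" by (rule cring_poly_ring)
  have "pvar (X i) * pvar (Y j) - pvar (X j) * pvar (Y i)
          \<in> carrier (bring n :: (bvar, 'k) mpoly ring)" if "{i, j} \<in> E" for i j
  proof -
    have "i \<in> {1..n}" "j \<in> {1..n}" using assms that by (auto simp: simple_graph_def)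
    then have "pvar (X i) * pvar (Y j) + (- (pvar (X j) * pvar (Y i)))
          \<in> carrier (bring n :: (bvar, 'k) mpoly ring)"
      by (intro add_in_poly_ring uminus_in_poly_ring mult_in_poly_ring pvar_in_carrier)
         (auto simp: bvars_def)
    then show ?thesis by simp
  qed
  then show ?thesis
    unfolding binomial_edge_ideal_def by (intro genideal_ideal) auto
qed

end

(*
Let G be the join of two isolated vertices 1, 2 with the disjoint union H of the points 3, ..., e
and a clique on e + 1, ..., n, where e = d - n + 3.  The three ingredients are the ideals
Q1 (all 2-minors), Q2 (columns 3, ..., n) and Q3 (columns 1, 2 and the minors of the clique).

Depth at least 4: J_G = Q2 \<inter> J' with J' = J_G + ([1 2]) = Q1 \<inter> Q3, so S/J_G is built by the
exact sequences 0 -> S/(I \<inter> J) -> S/I + S/J -> S/(I + J) -> 0, and a sequence of length four is regular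
on S/(I \<inter> J) as soon as it is regular on S/I and S/J and its first three terms are regular on
S/(I + J).  The four linear forms are chosen to be regular on all pieces simultaneously; on the
determinantal pieces one repeatedly uses that once x_1 = 0, the ideal of minors splits as
(all x_i) \<inter> (x_1, y_1, minors).

Depth at most 4: the class of [1 2] is annihilated by Q2, and S/Q2 has only four variables, so any five
elements are algebraically dependent modulo Q2.  A regular sequence inside the maximal ideal cannot
satisfy such a relation on a nonzero element: cancel powers of the first member, pass to
the next quotient and iterate.

Dimension: the same cancellation argument shows that a chain of primes of length k yields k elements
algebraically independent modulo its first member P.  If P contains J_G, it contains Q1, Q2 or Q3,
and each S/Q embeds into a polynomial ring in at most d variables; for Q3 there is a chain of length d.
*)
theory Submission
  imports Defs
begin

section \<open>Substitution homomorphisms\<close>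

text \<open>The constants come from the three quotients: \<open>S/Q1\<close>, \<open>S/Q2\<close>,
  \<open>S/Q3\<close> have dimensions n + 1, 4 and n + e - 3. The second caps the depth; the third
  is at least the first exactly when e >= 4, and 4 <= e <= n - 1 is the given range of d. All ideals
  are formed in the polynomial ring over all variables, where the type class operations apply, and
  are cut down to the given variables only at the end. The retraction killing the other variables
  makes this lossless. The delicate point in the upper bound for the depth is that the cancellation
  argument must carry a nonzero element from one quotient to the next, and [1 2] may become zero
  there. It is then divided by the current member of the sequence as often as possible. That this
  stops is a form of Krull's intersection theorem, which is local at the origin; polynomials with
  nonzero constant term are therefore turned into units by saturating the ideals. For chains of
  primes the element 1 can be carried along unchanged.\<close>

instantiation bvar :: linorder
begin

text \<open>A linear order on the variables induces one on the monomials, and leading terms then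
  make the polynomial ring a domain; \<open>rprime_kernel\<close> rests on this.\<close>

fun bvar_code :: "bvar \<Rightarrow> nat" where
  "bvar_code (X i) = 2 * i"
| "bvar_code (Y i) = 2 * i + 1"

definition "(v::bvar) \<le> w \<longleftrightarrow> bvar_code v \<le> bvar_code w"
definition "(v::bvar) < w \<longleftrightarrow> bvar_code v < bvar_code w"

lemma bvar_code_inject: "bvar_code v = bvar_code w \<Longrightarrow> v = w"
  by (cases v; cases w) (simp_all, presburger+)

instance
  by standard (auto simp: less_eq_bvar_def less_bvar_def intro: bvar_code_inject)

end

abbreviation "lookup \<equiv> Poly_Mapping.lookup"
abbreviation "single \<equiv> Poly_Mapping.single"
abbreviation "keys \<equiv> Poly_Mapping.keys"

type_synonym 'k bpoly = "(bvar, 'k) mpoly"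

abbreviation const :: "'k \<Rightarrow> ('v, 'k::comm_ring_1) mpoly" where
  "const c \<equiv> single 0 c"

lemma poly_mapping_sum_single:
  fixes p :: "'a \<Rightarrow>\<^sub>0 'b::comm_monoid_add"
  shows "p = (\<Sum>m\<in>keys p. single m (lookup p m))"
  by (rule poly_mapping_eqI)
     (auto simp: lookup_sum lookup_single when_def sum.delta' in_keys_iff)

lemma mpoly_induct_add [case_names zero single add]:
  fixes p :: "'a \<Rightarrow>\<^sub>0 'b::comm_monoid_add"
  assumes "P 0" "\<And>m c. P (single m c)" "\<And>p q. P p \<Longrightarrow> P q \<Longrightarrow> P (p + q)"
  shows "P p"
proof -
  have "P (\<Sum>m\<in>A. single m (lookup p m))" if "finite A" for A
    using that by (induction A) (auto intro: assms)
  then show ?thesis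
    by (subst poly_mapping_sum_single) simp
qed

lemma pvar_power: "pvar v ^ k = single (single v k) 1"
proof (induction k)
  case 0 show ?case by (metis power_0 single_one single_zero)
next
  case (Suc k) then show ?case unfolding power_Suc by (simp add: pvar_def mult_single flip: single_add)
qed

lemma const_mult: "const (c * c') = const c * const c'"
  by (simp add: mult_single)

lemma mpoly_induct [case_names const pvar add mult]:
  fixes p :: "('v, 'k::comm_ring_1) mpoly"
  assumes const: "\<And>c. P (const c)" and pvar: "\<And>v. P (pvar v)"
    and add: "\<And>p q. P p \<Longrightarrow> P q \<Longrightarrow> P (p + q)" and mult: "\<And>p q. P p \<Longrightarrow> P q \<Longrightarrow> P (p * q)"
  shows "P p"
proof (induction p rule: mpoly_induct_add)
  case zero show ?case using const[of 0] by simp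
next
  case (single m c)
  have "P (single m c)" for c
  proof (induction m arbitrary: c rule: mpoly_induct_add)
    case (single v k)
    have "P (pvar v ^ k)"
      by (induction k) (auto intro: pvar mult const[of 1, simplified])
    with const[of c] have "P (single 0 c * pvar v ^ k)" by (rule mult)
    then show ?case by (simp add: pvar_power mult_single)
  next
    case (add m m')
    have "P (single m c * single m' 1)"
      by (intro mult add)
    then show ?case by (simp add: mult_single)
  qed (use const in simp)
  then show ?case .
qed (rule add)

definition monom_eval :: "('v \<Rightarrow> 'b::comm_monoid_mult) \<Rightarrow> ('v \<Rightarrow>\<^sub>0 nat) \<Rightarrow> 'b" where
  "monom_eval \<sigma> m = (\<Prod>v\<in>keys m. \<sigma> v ^ lookup m v)"

definition psub :: "('v \<Rightarrow> ('w, 'k::comm_ring_1) mpoly) \<Rightarrow> ('v, 'k) mpoly \<Rightarrow> ('w, 'k) mpoly" where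
  "psub \<sigma> p = (\<Sum>m\<in>keys p. const (lookup p m) * monom_eval \<sigma> m)"

lemma monom_eval_superset:
  assumes "finite A" "keys m \<subseteq> A"
  shows "monom_eval \<sigma> m = (\<Prod>v\<in>A. \<sigma> v ^ lookup m v)"
  unfolding monom_eval_def
  by (rule prod.mono_neutral_left) (use assms in \<open>auto simp: in_keys_iff\<close>)

lemma monom_eval_add: "monom_eval \<sigma> (m + m') = monom_eval \<sigma> m * monom_eval \<sigma> m'"
proof -
  let ?A = "keys m \<union> keys m'"
  have "monom_eval \<sigma> (m + m') = (\<Prod>v\<in>?A. \<sigma> v ^ lookup (m + m') v)"
    using Poly_Mapping.keys_add[of m m'] by (intro monom_eval_superset) auto
  then show ?thesis
    by (simp add: lookup_add power_add prod.distrib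
        monom_eval_superset[of ?A m] monom_eval_superset[of ?A m'])
qed

lemma monom_eval_0 [simp]: "monom_eval \<sigma> 0 = 1"
  by (simp add: monom_eval_def)

lemma monom_eval_single [simp]: "monom_eval \<sigma> (single v k) = \<sigma> v ^ k"
  by (cases "k = 0") (simp_all add: monom_eval_def)

lemma psub_superset:
  assumes "finite A" "keys p \<subseteq> A"
  shows "psub \<sigma> p = (\<Sum>m\<in>A. const (lookup p m) * monom_eval \<sigma> m)"
  unfolding psub_def
  by (rule sum.mono_neutral_left) (use assms in \<open>auto simp: in_keys_iff\<close>)

lemma psub_single [simp]: "psub \<sigma> (single m c) = const c * monom_eval \<sigma> m"
  by (cases "c = 0") (simp_all add: psub_def)

lemma psub_0 [simp]: "psub \<sigma> 0 = 0"
  by (simp add: psub_def)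

lemma psub_add [simp]: "psub \<sigma> (p + q) = psub \<sigma> p + psub \<sigma> q"
proof -
  let ?A = "keys p \<union> keys q"
  have "psub \<sigma> (p + q) = (\<Sum>m\<in>?A. const (lookup (p + q) m) * monom_eval \<sigma> m)"
    using Poly_Mapping.keys_add[of p q] by (intro psub_superset) auto
  then show ?thesis
    by (simp add: lookup_add single_add distrib_right sum.distrib
        psub_superset[of ?A p] psub_superset[of ?A q])
qed

lemma psub_mult [simp]: "psub \<sigma> (p * q) = psub \<sigma> p * psub \<sigma> q"
proof (induction p rule: mpoly_induct_add)
  case (single m c)
  show ?case
  proof (induction q rule: mpoly_induct_add)
    case (single m' c')
    have "psub \<sigma> (single m c * single m' c')
        = const (c * c') * monom_eval \<sigma> (m + m')"
      by (simp add: mult_single)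
    also have "\<dots> = psub \<sigma> (single m c) * psub \<sigma> (single m' c')"
      unfolding const_mult monom_eval_add by (simp only: psub_single mult_ac)
    finally show ?case .
  qed (simp_all add: distrib_left)
qed (simp_all add: distrib_right)

lemma psub_const: "psub \<sigma> (const c) = const c"
  by simp

lemma psub_1 [simp]: "psub \<sigma> 1 = 1"
  by (metis psub_const single_one)

lemma psub_pvar [simp]: "psub \<sigma> (pvar v) = \<sigma> v"
  by (simp add: pvar_def)

lemma psub_uminus [simp]: "psub \<sigma> (- p) = - psub \<sigma> p"
  by (metis add.inverse_unique add.right_inverse psub_0 psub_add)

lemma psub_diff [simp]: "psub \<sigma> (p - q) = psub \<sigma> p - psub \<sigma> q"
  by (metis diff_conv_add_uminus psub_add psub_uminus)

lemma psub_sum: "psub \<sigma> (sum f A) = (\<Sum>x\<in>A. psub \<sigma> (f x))"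
  by (induction A rule: infinite_finite_induct) simp_all

lemma psub_cong_carrier:
  assumes "p \<in> carrier (poly_ring V)" "\<And>v. v \<in> V \<Longrightarrow> \<sigma> v = \<tau> v"
  shows "psub \<sigma> p = psub \<tau> p"
  unfolding psub_def monom_eval_def
  by (intro sum.cong prod.cong refl arg_cong2[where f = "(*)"])
     (metis assms in_carrier_poly_ring subsetD)

lemma psub_pvars [simp]: "psub pvar p = p"
  by (induction p rule: mpoly_induct) simp_all

lemma psub_psub: "psub \<sigma> (psub \<tau> p) = psub (\<lambda>v. psub \<sigma> (\<tau> v)) p"
  by (induction p rule: mpoly_induct) simp_all

lemma const_in_poly_ring: "const c \<in> carrier (poly_ring V)"
  by (simp add: in_carrier_poly_ring)

lemma zero_in_poly_ring: "0 \<in> carrier (poly_ring V)"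
  by (simp add: in_carrier_poly_ring)

lemma one_in_poly_ring: "1 \<in> carrier (poly_ring V)"
  by (simp add: in_carrier_poly_ring)

lemma diff_in_poly_ring:
  "p \<in> carrier (poly_ring V) \<Longrightarrow> q \<in> carrier (poly_ring V) \<Longrightarrow> p - q \<in> carrier (poly_ring V)"
  using add_in_poly_ring[OF _ uminus_in_poly_ring, of p V q] by simp

lemma sum_in_poly_ring:
  "(\<And>x. x \<in> A \<Longrightarrow> f x \<in> carrier (poly_ring V)) \<Longrightarrow> sum f A \<in> carrier (poly_ring V)"
  by (induction A rule: infinite_finite_induct) (auto intro: add_in_poly_ring zero_in_poly_ring)

lemma power_in_poly_ring: "p \<in> carrier (poly_ring V) \<Longrightarrow> p ^ k \<in> carrier (poly_ring V)"
  by (induction k) (auto intro: mult_in_poly_ring one_in_poly_ring)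

lemma prod_in_poly_ring:
  "(\<And>x. x \<in> A \<Longrightarrow> f x \<in> carrier (poly_ring V)) \<Longrightarrow> prod f A \<in> carrier (poly_ring V)"
  by (induction A rule: infinite_finite_induct) (auto intro: mult_in_poly_ring one_in_poly_ring)

lemma psub_in_poly_ring:
  assumes "\<And>v. v \<in> V \<Longrightarrow> \<sigma> v \<in> carrier (poly_ring W)" "p \<in> carrier (poly_ring V)"
  shows "psub \<sigma> p \<in> carrier (poly_ring W)"
  unfolding psub_def monom_eval_def
  by (intro sum_in_poly_ring mult_in_poly_ring const_in_poly_ring prod_in_poly_ring
      power_in_poly_ring assms(1)) (metis assms(2) in_carrier_poly_ring subsetD)

lemmas poly_ring_closed = const_in_poly_ring zero_in_poly_ring one_in_poly_ring add_in_poly_ring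
  uminus_in_poly_ring diff_in_poly_ring mult_in_poly_ring power_in_poly_ring pvar_in_carrier

text \<open>The retraction onto the ring in the variables V. It is the bridge between ideals formed
  in all variables and ideals of \<open>poly_ring V\<close>.\<close>

definition restrict_vars :: "'v set \<Rightarrow> ('v, 'k::comm_ring_1) mpoly \<Rightarrow> ('v, 'k) mpoly" where
  "restrict_vars V = psub (\<lambda>v. if v \<in> V then pvar v else 0)"

lemma restrict_vars_simps [simp]:
  "restrict_vars V 0 = 0" "restrict_vars V 1 = 1" "restrict_vars V (p + q) = restrict_vars V p + restrict_vars V q"
  "restrict_vars V (p - q) = restrict_vars V p - restrict_vars V q" "restrict_vars V (- p) = - restrict_vars V p"
  "restrict_vars V (p * q) = restrict_vars V p * restrict_vars V q" "restrict_vars V (const c) = const c"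
  "restrict_vars V (pvar v) = (if v \<in> V then pvar v else 0)"
  by (simp_all add: restrict_vars_def)

lemma restrict_vars_id: "p \<in> carrier (poly_ring V) \<Longrightarrow> restrict_vars V p = p"
  unfolding restrict_vars_def
  by (subst psub_cong_carrier[where \<tau> = pvar and V = V]) simp_all

lemma restrict_vars_in: "restrict_vars V p \<in> carrier (poly_ring V)"
  unfolding restrict_vars_def
  by (rule psub_in_poly_ring[where V = UNIV]) (auto simp: in_carrier_poly_ring[of _ UNIV] poly_ring_closed)

section \<open>Ideals and weakly regular sequences\<close>

text \<open>The ring as a module over itself: \<open>rng.subspace\<close> means ideal, and
  \<open>rng.span\<close> is the ideal generated by a set.\<close>

interpretation rng: module "(*) :: 'a::comm_ring_1 \<Rightarrow> 'a \<Rightarrow> 'a"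
  by standard (simp_all add: algebra_simps)

declare rng.scale_scale [simp del]

definition rprime :: "'a::comm_ring_1 set \<Rightarrow> bool" where
  "rprime P \<longleftrightarrow> rng.subspace P \<and> 1 \<notin> P \<and> (\<forall>a b. a * b \<in> P \<longrightarrow> a \<in> P \<or> b \<in> P)"

definition nzd :: "'a::comm_ring_1 set \<Rightarrow> 'a \<Rightarrow> bool" where
  "nzd I f \<longleftrightarrow> (\<forall>u. f * u \<in> I \<longrightarrow> u \<in> I)"

lemma nzdD: "nzd I f \<Longrightarrow> f * u \<in> I \<Longrightarrow> u \<in> I"
  by (simp add: nzd_def)

text \<open>Properness is left out on purpose: the condition can then be passed between ideals,
  their sums and their intersections without checking each time that 1 stays outside.\<close>

fun wreg :: "'a::comm_ring_1 set \<Rightarrow> 'a list \<Rightarrow> bool" where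
  "wreg I [] \<longleftrightarrow> True"
| "wreg I (f # fs) \<longleftrightarrow> nzd I f \<and> wreg (rng.span (insert f I)) fs"

lemma rprime_nzd: "rprime P \<Longrightarrow> f \<notin> P \<Longrightarrow> nzd P f"
  by (auto simp: rprime_def nzd_def)

lemma span_multL: "x \<in> rng.span A \<Longrightarrow> r * x \<in> rng.span A"
  by (rule rng.span_scale)

lemma span_multR: "x \<in> rng.span A \<Longrightarrow> x * r \<in> rng.span A"
  using span_multL[of x A r] by (simp add: mult.commute)

lemma span_eqI: "A \<subseteq> rng.span B \<Longrightarrow> B \<subseteq> rng.span A \<Longrightarrow> rng.span A = rng.span B"
  by (meson rng.span_minimal rng.subspace_span subset_antisym)

lemma span_insert_span: "rng.span (insert f (rng.span A)) = rng.span (insert f A)"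
  by (intro span_eqI) (auto intro: rng.span_base rng.span_mono[THEN subsetD, rotated])

lemma wreg_span_Cons [simp]:
  "wreg (rng.span A) (f # fs) \<longleftrightarrow> nzd (rng.span A) f \<and> wreg (rng.span (insert f A)) fs"
  by (simp add: span_insert_span)

declare wreg.simps(2) [simp del]

lemma span_insert_subspace:
  assumes "rng.subspace I"
  shows "rng.span (insert f I) = {x + f * r | x r. x \<in> I}"
proof -
  have sI: "rng.span I = I" using assms by simp
  show ?thesis
  proof
    show "rng.span (insert f I) \<subseteq> {x + f * r | x r. x \<in> I}"
    proof
      fix x assume "x \<in> rng.span (insert f I)"
      then obtain k where "x - k * f \<in> I" by (auto simp: rng.span_breakdown_eq sI)
      moreover have "x = (x - k * f) + f * k" by (simp add: mult.commute)
      ultimately show "x \<in> {x + f * r | x r. x \<in> I}" by blast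
    qed
    show "{x + f * r | x r. x \<in> I} \<subseteq> rng.span (insert f I)"
    proof safe
      fix x r assume "x \<in> I"
      then show "x + f * r \<in> rng.span (insert f I)"
        by (metis rng.span_add span_multR rng.span_base insertI1 insertI2)
    qed
  qed
qed

lemma wreg_Cons: "rng.subspace I \<Longrightarrow>
    wreg I (f # fs) \<longleftrightarrow> nzd I f \<and> wreg {x + f * r | x r. x \<in> I} fs"
  unfolding wreg.simps by (subst span_insert_subspace) auto

lemma subspace_add_principal:
  "rng.subspace I \<Longrightarrow> rng.subspace {x + f * r | x r. x \<in> I}"
  using rng.subspace_span[of "insert f I"] by (subst (asm) span_insert_subspace)

lemma subspace_sum:
  assumes "rng.subspace I" "rng.subspace J"
  shows "rng.subspace {x + y | x y. x \<in> I \<and> y \<in> J}"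
proof -
  have "rng.span I = I" "rng.span J = J" using assms by simp_all
  then show ?thesis using rng.subspace_span[of "I \<union> J"] by (simp only: rng.span_Un)
qed

text \<open>In 0 -> R/(I \<inter> J) -> R/I + R/J -> R/(I + J) -> 0, reduction modulo f keeps
  exactness when f is regular on the last term; concretely, (I \<inter> J) + (f) = (I + (f))
  \<inter> (J + (f)), and the induction proceeds. The last member g only has to be regular on the
  submodule R/(I \<inter> J) of R/I + R/J, which is why \<open>fs\<close> alone is required on the
  sum.\<close>

lemma wreg_Int:
  assumes "rng.subspace I" "rng.subspace J"
    and "wreg I (fs @ [g])" "wreg J (fs @ [g])" "wreg {x + y | x y. x \<in> I \<and> y \<in> J} fs"
  shows "wreg (I \<inter> J) (fs @ [g])"
  using assms
proof (induction fs arbitrary: I J)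
  case Nil
  then show ?case by (auto simp: wreg_Cons rng.subspace_inter nzd_def)
next
  case (Cons f fs)
  note I = Cons.prems(1) and J = Cons.prems(2)
  let ?If = "{x + f * r | x r. x \<in> I}" and ?Jf = "{x + f * r | x r. x \<in> J}"
  let ?S = "{x + y | x y. x \<in> I \<and> y \<in> J}"
  have S: "rng.subspace ?S"
    by (rule subspace_sum[OF I J])
  from Cons.prems(5) S have nS: "nzd ?S f" and wS: "wreg {x + f * r | x r. x \<in> ?S} fs"
    by (simp_all add: wreg_Cons)
  have "{x + y | x y. x \<in> ?If \<and> y \<in> ?Jf} = {x + f * r | x r. x \<in> ?S}" (is "?L = ?R")
  proof
    show "?L \<subseteq> ?R"
    proof
      fix z assume "z \<in> ?L"
      then obtain a r b s where "a \<in> I" "b \<in> J" "z = (a + f * r) + (b + f * s)" by auto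
      then have "z = (a + b) + f * (r + s)" "a + b \<in> ?S" by (auto simp: algebra_simps)
      then show "z \<in> ?R" by blast
    qed
    show "?R \<subseteq> ?L"
    proof
      fix z assume "z \<in> ?R"
      then obtain a b r where "a \<in> I" "b \<in> J" "z = (a + b) + f * r" by auto
      then have "z = (a + f * r) + (b + f * 0)" by (simp add: algebra_simps)
      with \<open>a \<in> I\<close> \<open>b \<in> J\<close> show "z \<in> ?L" by blast
    qed
  qed
  with wS have wS': "wreg {x + y | x y. x \<in> ?If \<and> y \<in> ?Jf} fs" by simp
  have "wreg (?If \<inter> ?Jf) (fs @ [g])"
    using Cons.prems(3,4) I J by (intro Cons.IH wS' subspace_add_principal) (simp_all add: wreg_Cons)
  moreover have "{x + f * r | x r. x \<in> I \<inter> J} = ?If \<inter> ?Jf"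
  proof
    show "?If \<inter> ?Jf \<subseteq> {x + f * r | x r. x \<in> I \<inter> J}"
    proof
      fix z assume "z \<in> ?If \<inter> ?Jf"
      then obtain a r b s where ab: "a \<in> I" "b \<in> J" "z = a + f * r" "z = b + f * s"
        by (elim IntE CollectE exE conjE) blast
      \<comment> \<open>Regularity of f modulo I + J puts the difference of the two cofactors into I
        + J. Moving f times its I-part between the summands yields z = c + f * (r + a') with c in
        both ideals.\<close>
      then have "f * (s - r) = a + (- b)" by (simp add: algebra_simps)
      moreover have "a + (- b) \<in> ?S" using ab J rng.subspace_neg by blast
      ultimately have "f * (s - r) \<in> ?S" by metis
      then have "s - r \<in> ?S" by (rule nzdD[OF nS])
      then obtain a' b' where a': "a' \<in> I" "b' \<in> J" "s - r = a' + b'" by blast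
      have "z = (a - f * a') + f * (r + a')" using ab by (simp add: algebra_simps)
      moreover have "a - f * a' = b + f * b'"
      proof -
        have "a = b + f * (s - r)" using ab by (simp add: algebra_simps)
        then show ?thesis using a' by (simp add: algebra_simps)
      qed
      moreover have "a - f * a' \<in> I" using I ab a' by (intro rng.subspace_diff rng.subspace_scale)
      moreover have "b + f * b' \<in> J" using J ab a' by (intro rng.subspace_add rng.subspace_scale)
      ultimately have "z = (a - f * a') + f * (r + a') \<and> a - f * a' \<in> I \<inter> J" by auto
      then show "z \<in> {x + f * r | x r. x \<in> I \<inter> J}" by blast
    qed
  qed auto
  moreover have "nzd (I \<inter> J) f"
    using Cons.prems(3,4) I J by (auto simp: wreg_Cons nzd_def)
  ultimately show ?case
    using I J by (simp add: wreg_Cons rng.subspace_inter)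
qed

text \<open>If a + k * w with a in (A) lies in (B), then so does w * k, hence k, and then w * k
  falls back into (A). This serves both for splitting off the columns 3, ..., n from the ideal of
  the graph and for the determinantal pieces.\<close>

lemma span_split:
  assumes "A \<subseteq> rng.span B" "nzd (rng.span B) w" "\<And>b. b \<in> B \<Longrightarrow> w * b \<in> rng.span A"
  shows "rng.span A = rng.span B \<inter> rng.span (insert w A)"
proof
  have "rng.span A \<subseteq> rng.span B" using assms(1) by (simp add: rng.span_minimal)
  then show "rng.span A \<subseteq> rng.span B \<inter> rng.span (insert w A)"
    using rng.span_mono[of A "insert w A"] by blast
  show "rng.span B \<inter> rng.span (insert w A) \<subseteq> rng.span A"
  proof
    fix p assume p: "p \<in> rng.span B \<inter> rng.span (insert w A)"
    then obtain k where k: "p - k * w \<in> rng.span A" using rng.span_breakdown_eq[of p w A] by auto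
    then have "p - (p - k * w) \<in> rng.span B"
      using p \<open>rng.span A \<subseteq> rng.span B\<close> by (blast intro: rng.span_diff)
    then have "w * k \<in> rng.span B" by (simp add: mult.commute)
    then have "k \<in> rng.span B" by (rule nzdD[OF assms(2)])
    then have "w * k \<in> rng.span A"
    proof (induction k rule: rng.span_induct_alt)
      case (step c x y)
      then have "c * (w * x) + w * y \<in> rng.span A"
        by (metis rng.span_add span_multL assms(3))
      then show ?case by (simp add: algebra_simps)
    qed (simp add: rng.span_zero)
    then have "(p - k * w) + w * k \<in> rng.span A" using k by (blast intro: rng.span_add)
    then show "p \<in> rng.span A" by (simp add: algebra_simps)
  qed
qed

text \<open>\<open>wreg_Int\<close> for the decomposition of \<open>span_split\<close>: the sum of
  the two components is the ideal generated by w and B.\<close>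

lemma wreg_split:
  assumes "A \<subseteq> rng.span B" "nzd (rng.span B) w" "\<And>b. b \<in> B \<Longrightarrow> w * b \<in> rng.span A"
    and "wreg (rng.span B) (fs @ [g])" "wreg (rng.span (insert w A)) (fs @ [g])"
      "wreg (rng.span (insert w B)) fs"
  shows "wreg (rng.span A) (fs @ [g])"
proof -
  have "rng.span (insert w B) = rng.span (B \<union> insert w A)"
    using assms(1) rng.span_mono[of B "insert w B"]
    by (intro span_eqI) (auto intro: rng.span_base)
  also have "\<dots> = {x + y | x y. x \<in> rng.span B \<and> y \<in> rng.span (insert w A)}"
    by (rule rng.span_Un)
  finally show ?thesis
    using wreg_Int[OF rng.subspace_span rng.subspace_span assms(4,5)] assms(6)
      span_split[OF assms(1-3)] by simp
qed

text \<open>Regular sequences cannot be permuted freely, but exchanging two neighbours loses only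
  the regularity of f modulo I, which is assumed here. The point is to test each form at a moment
  when the ideal is prime or the form has a fresh variable.\<close>

lemma wreg_swap:
  assumes "rng.subspace I" "wreg I (g # f # fs)" "nzd I f"
  shows "wreg I (f # g # fs)"
proof -
  have sI: "rng.span I = I" using assms(1) by simp
  have gf: "nzd (rng.span I) g" "nzd (rng.span (insert g I)) f" "wreg (rng.span (insert f (insert g I))) fs"
    using assms(2) by (simp_all add: wreg.simps sI span_insert_span)
  have "nzd (rng.span (insert f I)) g"
    unfolding nzd_def
  proof safe
    fix u assume "g * u \<in> rng.span (insert f I)"
    then obtain v where v: "g * u - v * f \<in> I" by (auto simp: rng.span_breakdown_eq sI)
    then have "- (g * u - v * f) \<in> I" using assms(1) by (blast intro: rng.subspace_neg)
    then have "f * v - u * g \<in> rng.span I" by (simp add: sI algebra_simps)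
    then have "f * v \<in> rng.span (insert g I)" by (auto simp: rng.span_breakdown_eq)
    then have "v \<in> rng.span (insert g I)" by (rule nzdD[OF gf(2)])
    then obtain w where w: "v - w * g \<in> I" by (auto simp: rng.span_breakdown_eq sI)
    have "(g * u - v * f) + f * (v - w * g) \<in> I"
      using v w assms(1) by (intro rng.subspace_add rng.subspace_scale)
    moreover have "(g * u - v * f) + f * (v - w * g) = g * (u - w * f)"
      by (simp add: algebra_simps)
    ultimately have "g * (u - w * f) \<in> rng.span I" by (simp only: sI)
    then have "u - w * f \<in> rng.span I" by (rule nzdD[OF gf(1)])
    then show "u \<in> rng.span (insert f I)" by (auto simp: rng.span_breakdown_eq)
  qed
  then show ?thesis
    using assms(3) gf(3) by (simp add: wreg.simps span_insert_span insert_commute)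
qed

subsection \<open>A linear form in a fresh variable\<close>

text \<open>Division by v that discards the monomials not divisible by v: a left inverse of
  multiplication by v, linear over the polynomials free of v.\<close>

definition shift_down :: "'v \<Rightarrow> ('v, 'k::comm_ring_1) mpoly \<Rightarrow> ('v, 'k) mpoly" where
  "shift_down v = Poly_Mapping.map_key (\<lambda>m. m + single v 1)"

lemma lookup_shift_down:
  "lookup (shift_down v p) m = lookup p (m + single v 1)"
  unfolding shift_down_def by (subst map_key.rep_eq) (auto simp: inj_def)

lemma shift_down_add: "shift_down v (p + q) = shift_down v p + shift_down v q"
  by (rule poly_mapping_eqI) (simp add: lookup_shift_down lookup_add)

lemma shift_down_0 [simp]: "shift_down v 0 = 0"
  by (rule poly_mapping_eqI) (simp add: lookup_shift_down)

lemma shift_down_single: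
  "shift_down v (single m c) =
     (if lookup m v = 0 then 0
      else single (m - single v 1) c)"
proof (rule poly_mapping_eqI)
  fix m'
  have "m = m' + single v 1 \<longleftrightarrow>
      lookup m v \<noteq> 0 \<and> m' = m - single v 1"
    by (auto simp: poly_mapping_eq_iff fun_eq_iff lookup_add lookup_minus lookup_single when_def)
  then show "lookup (shift_down v (single m c)) m' =
    lookup (if lookup m v = 0 then 0
      else single (m - single v 1) c) m'"
    by (auto simp: lookup_shift_down lookup_single when_def)
qed

lemma shift_down_pvar_mult: "shift_down v (pvar v * p) = p"
proof (induction p rule: mpoly_induct_add)
  case (single m c)
  then show ?case
    by (auto simp: pvar_def mult_single shift_down_single lookup_add)
qed (simp_all add: distrib_left shift_down_add)

lemma shift_down_mult:
  assumes "q \<in> carrier (poly_ring (- {v}))"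
  shows "shift_down v (p * q) = shift_down v p * q"
proof -
  have "shift_down v (p * single m c) = shift_down v p * single m c"
    if "lookup m v = 0" for m c
  proof (induction p rule: mpoly_induct_add)
    case (single m' c')
    have "m' + m - single v 1 = m' - single v 1 + m"
      if "lookup m' v \<noteq> 0"
      using that by (auto simp: poly_mapping_eq_iff fun_eq_iff lookup_add lookup_minus lookup_single when_def)
    then show ?case using that by (simp add: mult_single shift_down_single lookup_add)
  qed (simp_all add: distrib_right shift_down_add)
  moreover have "lookup m v = 0" if "m \<in> keys q" for m
    using assms that by (auto simp: in_carrier_poly_ring in_keys_iff)
  ultimately have "shift_down v (p * single m (lookup q m))
      = shift_down v p * single m (lookup q m)"
    if "m \<in> keys q" for m
    using that by blast
  moreover have "shift_down v (sum f M) = (\<Sum>m\<in>M. shift_down v (f m))"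
    for f :: "_ \<Rightarrow> ('a, 'b) mpoly" and M :: "('a \<Rightarrow>\<^sub>0 nat) set"
    by (induction M rule: infinite_finite_induct) (simp_all add: shift_down_add)
  ultimately show ?thesis
    by (subst (1 2) poly_mapping_sum_single[of q])
       (simp add: sum_distrib_left cong: sum.cong)
qed

text \<open>The automorphism v \<mapsto> v - g, with g = f - v free of v, fixes A pointwise and
  carries f to v. Multiplication by v is undone by \<open>shift_down\<close>, which maps the ideal
  of A to itself by linearity.\<close>

lemma nzd_fresh:
  assumes A: "A \<subseteq> carrier (poly_ring (- {v}))" and g: "f - pvar v \<in> carrier (poly_ring (- {v}))"
  shows "nzd (rng.span A) f"
  unfolding nzd_def
proof safe
  fix u assume u: "f * u \<in> rng.span A"
  define g where "g = f - pvar v"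
  define \<sigma> where "\<sigma> = psub (\<lambda>w. if w = v then pvar v - g else pvar w)"
  define \<tau> where "\<tau> = psub (\<lambda>w. if w = v then pvar v + g else pvar w)"
  have fix': "\<sigma> q = q" "\<tau> q = q" if "q \<in> carrier (poly_ring (- {v}))" for q
  proof -
    have "psub (\<lambda>w. if w = v then h else pvar w) q = psub pvar q" for h
      by (rule psub_cong_carrier[OF that]) auto
    then show "\<sigma> q = q" "\<tau> q = q" by (simp_all add: \<sigma>_def \<tau>_def)
  qed
  have inv: "\<tau> (\<sigma> q) = q" for q
  proof (induction q rule: mpoly_induct)
    case (pvar w)
    then show ?case using fix'[OF g[folded g_def]] by (auto simp: \<sigma>_def \<tau>_def)
  qed (auto simp: \<sigma>_def \<tau>_def)
  have hom: "\<sigma> (p + q) = \<sigma> p + \<sigma> q" "\<sigma> (p * q) = \<sigma> p * \<sigma> q"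
    "\<tau> (p + q) = \<tau> p + \<tau> q" "\<tau> (p * q) = \<tau> p * \<tau> q" "\<sigma> 0 = 0" "\<tau> 0 = 0" for p q
    by (simp_all add: \<sigma>_def \<tau>_def)
  have pres: "\<sigma> q \<in> rng.span A \<and> \<tau> q \<in> rng.span A" if "q \<in> rng.span A" for q
    using that
  proof (induction q rule: rng.span_induct_alt)
    case (step c x y)
    then show ?case
      using A fix'[of x] by (simp add: hom subset_iff rng.span_add span_multL rng.span_base)
  qed (simp add: hom rng.span_zero)
  have down: "shift_down v q \<in> rng.span A" if "q \<in> rng.span A" for q
    using that
  proof (induction q rule: rng.span_induct_alt)
    case (step c x y)
    then show ?case
      using A shift_down_mult[of x v c]
      by (simp add: shift_down_add subset_iff rng.span_add span_multL rng.span_base)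
  qed (simp add: rng.span_zero)
  have "\<sigma> f = pvar v"
  proof -
    have "f = g + pvar v" by (simp add: g_def)
    then show ?thesis using fix'(1)[OF g[folded g_def]] by (simp add: \<sigma>_def)
  qed
  then have "pvar v * \<sigma> u \<in> rng.span A" using pres[OF u] by (simp add: hom)
  from down[OF this] have "\<sigma> u \<in> rng.span A" by (simp add: shift_down_pvar_mult)
  from pres[OF this] show "u \<in> rng.span A" by (simp add: inv)
qed

subsection \<open>Prime ideals as kernels\<close>

lemma rprime_vimage: "rprime I \<Longrightarrow> rprime {p. psub \<tau> p \<in> I}"
  by (auto simp: rprime_def rng.subspace_def)

lemma rprime_kernel:
  fixes \<tau> :: "'v \<Rightarrow> ('w::linorder, 'k::field) mpoly"
  shows "rprime {p. psub \<tau> p = 0}"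
  by (auto simp: rprime_def rng.subspace_def)

text \<open>Every p is congruent to its image under \<tau> modulo the larger ideal, so membership
  can be tested after the substitution. Linear relations L are eliminated this way, and primality is
  pulled back from A.\<close>

lemma span_vimage:
  assumes "\<And>a. a \<in> A \<Longrightarrow> psub \<tau> a \<in> rng.span A" "\<And>l. l \<in> L \<Longrightarrow> psub \<tau> l \<in> rng.span A"
    and "\<And>v. pvar v - \<tau> v \<in> rng.span (A \<union> L)"
  shows "rng.span (A \<union> L) = {p. psub \<tau> p \<in> rng.span A}"
proof
  have sub: "rng.subspace {p. psub \<tau> p \<in> rng.span A}"
    by (auto simp: rng.subspace_def intro: rng.span_zero rng.span_add span_multL)
  show "rng.span (A \<union> L) \<subseteq> {p. psub \<tau> p \<in> rng.span A}"
    using assms(1,2) by (intro rng.span_minimal sub) auto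
  have diff: "p - psub \<tau> p \<in> rng.span (A \<union> L)" for p
  proof (induction p rule: mpoly_induct)
    case (mult p q)
    have "p * q - psub \<tau> (p * q) = p * (q - psub \<tau> q) + psub \<tau> q * (p - psub \<tau> p)"
      by (simp add: algebra_simps)
    then show ?case using mult by (auto intro!: rng.span_add span_multL)
  next
    case (add p q)
    have "p + q - psub \<tau> (p + q) = (p - psub \<tau> p) + (q - psub \<tau> q)" by simp
    then show ?case using add by (metis rng.span_add)
  qed (use assms(3) in \<open>auto simp: rng.span_zero\<close>)
  show "{p. psub \<tau> p \<in> rng.span A} \<subseteq> rng.span (A \<union> L)"
  proof safe
    fix p assume "psub \<tau> p \<in> rng.span A"
    then have "(p - psub \<tau> p) + psub \<tau> p \<in> rng.span (A \<union> L)"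
      by (intro rng.span_add diff) (meson Un_upper1 rng.span_mono subsetD)
    then show "p \<in> rng.span (A \<union> L)" by simp
  qed
qed

section \<open>Ideals of 2-minors\<close>

definition det2 :: "nat \<Rightarrow> nat \<Rightarrow> ('k::field) bpoly" where
  "det2 i j = pvar (X i) * pvar (Y j) - pvar (X j) * pvar (Y i)"

definition minors :: "nat set \<Rightarrow> ('k::field) bpoly set" where
  "minors C = {det2 i j | i j. i \<in> C \<and> j \<in> C}"

text \<open>
  The map \<open>x\<^sub>i \<mapsto> s\<^sub>i\<close>, \<open>y\<^sub>i \<mapsto> s\<^sub>i t\<close> for \<open>i \<in> C\<close> parametrises matrices of rank at most one, with
  \<open>X i\<close> in the role of \<open>s\<^sub>i\<close> and \<open>Y 0\<close> in the role of \<open>t\<close>. The remaining \<open>y\<^sub>i\<close> are shifted to make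
  room for \<open>Y 0\<close>.
\<close>

fun segre :: "nat set \<Rightarrow> bvar \<Rightarrow> ('k::field) bpoly" where
  "segre C (X i) = pvar (X i)"
| "segre C (Y i) = (if i \<in> C then pvar (X i) * pvar (Y 0) else pvar (Y (Suc i)))"

text \<open>\<open>segre C\<close> sends variables to monomials; this is the exponent vector of
  \<open>segre C v ^ k\<close>. Working with exponents makes the computation of the kernel
  combinatorial.\<close>

fun segre_exp :: "nat set \<Rightarrow> bvar \<Rightarrow> nat \<Rightarrow> (bvar \<Rightarrow>\<^sub>0 nat)" where
  "segre_exp C (X i) k = single (X i) k"
| "segre_exp C (Y i) k = (if i \<in> C then single (X i) k + single (Y 0) k
     else single (Y (Suc i)) k)"

definition segre_monom :: "nat set \<Rightarrow> (bvar \<Rightarrow>\<^sub>0 nat) \<Rightarrow> (bvar \<Rightarrow>\<^sub>0 nat)" where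
  "segre_monom C m = (\<Sum>v\<in>keys m. segre_exp C v (lookup m v))"

lemma segre_exp_add: "segre_exp C v (k + l) = segre_exp C v k + segre_exp C v l"
  by (cases v) (simp_all add: single_add ac_simps)

lemma segre_exp_0 [simp]: "segre_exp C v 0 = 0"
  by (cases v) simp_all

lemma segre_monom_superset:
  assumes "finite A" "keys m \<subseteq> A"
  shows "segre_monom C m = (\<Sum>v\<in>A. segre_exp C v (lookup m v))"
  unfolding segre_monom_def
  by (rule sum.mono_neutral_left) (use assms in \<open>auto simp: in_keys_iff\<close>)

lemma segre_monom_add: "segre_monom C (m + m') = segre_monom C m + segre_monom C m'"
proof -
  let ?A = "keys m \<union> keys m'"
  have "segre_monom C (m + m') = (\<Sum>v\<in>?A. segre_exp C v (lookup (m + m') v))"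
    using Poly_Mapping.keys_add[of m m'] by (intro segre_monom_superset) auto
  then show ?thesis
    by (simp add: lookup_add segre_exp_add sum.distrib
        segre_monom_superset[of ?A m] segre_monom_superset[of ?A m'])
qed

lemma segre_monom_0 [simp]: "segre_monom C 0 = 0"
  by (simp add: segre_monom_def)

lemma segre_monom_single [simp]: "segre_monom C (single v k) = segre_exp C v k"
  by (cases "k = 0") (simp_all add: segre_monom_def)

lemma monom_eval_segre: "monom_eval (segre C) m = single (segre_monom C m) 1"
proof (induction m rule: mpoly_induct_add)
  case (single v k)
  then show ?case
    by (cases v) (auto simp: pvar_power mult_single power_mult_distrib)
next
  case (add p q)
  then show ?case by (simp add: monom_eval_add segre_monom_add mult_single)
qed simp

text \<open>This lemma and the next two list what the image of a monomial remembers: the degree in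
  each column of C, the total y-degree in C, and the exponents outside C.\<close>

lemma lookup_segre_monom_X:
  "lookup (segre_monom C m) (X i) =
     lookup m (X i) + (if i \<in> C then lookup m (Y i) else 0)"
proof (induction m rule: mpoly_induct_add)
  case (single v k)
  then show ?case
    by (cases v) (auto simp: lookup_add lookup_single when_def)
qed (auto simp: lookup_add segre_monom_add)

lemma lookup_segre_monom_Y:
  "lookup (segre_monom C m) (Y (Suc i)) =
     (if i \<in> C then 0 else lookup m (Y i))"
proof (induction m rule: mpoly_induct_add)
  case (single v k)
  then show ?case
    by (cases v) (auto simp: lookup_add lookup_single when_def)
qed (auto simp: lookup_add segre_monom_add)

lemma lookup_segre_monom_Y0:
  assumes "finite C"
  shows "lookup (segre_monom C m) (Y 0) = (\<Sum>i\<in>C. lookup m (Y i))"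
proof (induction m rule: mpoly_induct_add)
  case (single v k)
  then show ?case
    using assms by (cases v) (auto simp: lookup_add lookup_single when_def)
qed (auto simp: lookup_add segre_monom_add sum.distrib)

abbreviation mon :: "('v \<Rightarrow>\<^sub>0 nat) \<Rightarrow> ('v, 'k::field) mpoly" where
  "mon m \<equiv> single m 1"

text \<open>
  The binomials \<open>x\<^sub>i y\<^sub>j - x\<^sub>j y\<^sub>i\<close> allow moving one \<open>y\<close> from a column with too many to a column with
  too few.
\<close>

lemma segre_monom_congruent:
  assumes C: "finite C" and "segre_monom C m = segre_monom C m'"
  shows "(mon m - mon m' :: ('k::field) bpoly) \<in> rng.span (minors C)"
  using assms(2)
\<comment> \<open>The subtraction is truncated, so the measure counts only the surplus of y's in m;
  the exchange below lowers it at i and leaves it at 0 in column j.\<close>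
proof (induction "\<Sum>i\<in>C. lookup m (Y i) - lookup m' (Y i)"
    arbitrary: m rule: less_induct)
  case less
  note eqX = lookup_segre_monom_X[of C] and eqY = lookup_segre_monom_Y[of C]
    and eqY0 = lookup_segre_monom_Y0[OF C]
  have X: "lookup m (X i) + (if i \<in> C then lookup m (Y i) else 0)
    = lookup m' (X i) + (if i \<in> C then lookup m' (Y i) else 0)" for i
    using eqX[of m i] eqX[of m' i] less.prems by simp
  have Y: "lookup m (Y i) = lookup m' (Y i)" if "i \<notin> C" for i
    using eqY[of m i] eqY[of m' i] less.prems that by simp
  have S: "(\<Sum>i\<in>C. lookup m (Y i)) = (\<Sum>i\<in>C. lookup m' (Y i))"
    using eqY0[of m] eqY0[of m'] less.prems by simp
  show ?case
  proof (cases "\<exists>i\<in>C. lookup m' (Y i) < lookup m (Y i)")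
    case False
    then have "lookup m (Y i) = lookup m' (Y i)" if "i \<in> C" for i
      using sum_strict_mono_ex1[OF C, of "\<lambda>i. lookup m (Y i)" "\<lambda>i. lookup m' (Y i)"]
        S that by (metis leI le_neq_implies_less less_irrefl)
    then have "lookup m v = lookup m' v" for v
      using X Y by (cases v; cases "case v of X i \<Rightarrow> i \<in> C | Y i \<Rightarrow> i \<in> C") (simp_all, metis add_right_cancel, metis add_right_cancel add_0_right)
    then have "m = m'" by (intro poly_mapping_eqI)
    then show ?thesis by (simp add: rng.span_zero)
  next
    case True
    then obtain i where i: "i \<in> C" "lookup m' (Y i) < lookup m (Y i)" by blast
    then obtain j where j: "j \<in> C" "lookup m (Y j) < lookup m' (Y j)"
      using sum_strict_mono_ex1[OF C, of "\<lambda>i. lookup m' (Y i)" "\<lambda>i. lookup m (Y i)"] S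
      by (metis leI less_irrefl)
    have "i \<noteq> j" using i j by auto
    \<comment> \<open>Column j has the same degree in m and m' but fewer y's in m, so x_j divides
      m.\<close>
    have Xj: "lookup m (X j) > 0" using X[of j] j by simp
    define r where "r = m - single (Y i) 1 - single (X j) 1"
    have m: "m = r + (single (Y i) 1 + single (X j) 1)"
      using i Xj unfolding r_def
      by (intro poly_mapping_eqI) (auto simp: lookup_add lookup_minus lookup_single when_def)
    define m2 where "m2 = r + (single (Y j) 1 + single (X i) 1)"
    have "segre_monom C m2 = segre_monom C m'"
      unfolding less.prems[symmetric] m m2_def using i j by (simp add: segre_monom_add ac_simps)
    moreover have "(\<Sum>k\<in>C. lookup m2 (Y k) - lookup m' (Y k))
       < (\<Sum>k\<in>C. lookup m (Y k) - lookup m' (Y k))"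
    proof (rule sum_strict_mono_ex1[OF C])
      show "\<forall>k\<in>C. lookup m2 (Y k) - lookup m' (Y k)
         \<le> lookup m (Y k) - lookup m' (Y k)"
        using i j unfolding m2_def by (subst m) (auto simp: m[symmetric] lookup_add lookup_single when_def r_def lookup_minus)
      show "\<exists>k\<in>C. lookup m2 (Y k) - lookup m' (Y k)
         < lookup m (Y k) - lookup m' (Y k)"
        using i j \<open>i \<noteq> j\<close> unfolding m2_def
        by (intro bexI[of _ i]) (auto simp: lookup_add lookup_single when_def r_def lookup_minus)
    qed
    ultimately have "(mon m2 - mon m' :: 'k bpoly) \<in> rng.span (minors C)"
      by (intro less.hyps)
    moreover have "det2 j i \<in> (minors C :: 'k bpoly set)" using i j by (auto simp: minors_def)
    ultimately have "mon r * det2 j i + (mon m2 - mon m' :: 'k bpoly) \<in> rng.span (minors C)"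
      by (metis rng.span_add span_multL rng.span_base)
    moreover have "(mon m :: 'k bpoly) = mon r * det2 j i + mon m2"
      unfolding det2_def m m2_def pvar_def
      by (simp add: mult_single algebra_simps)
    ultimately show ?thesis by (simp add: algebra_simps)
  qed
qed

lemma single_sum: "single z (sum g A) = (\<Sum>m\<in>A. single z (g m))"
  by (induction A rule: infinite_finite_induct) (simp_all add: single_add)

lemma segre_det2: "i \<in> C \<Longrightarrow> j \<in> C \<Longrightarrow> psub (segre C) (det2 i j) = 0"
  by (simp add: det2_def)

text \<open>A map taking monomials to monomials has a kernel spanned by differences of monomials
  with the same image. With \<eta> picking one monomial per fibre, the coefficients of p sum to 0 on
  each fibre, so p is the combination of the differences m - \<eta>(m), which lie in the ideal by
  \<open>segre_monom_congruent\<close>.\<close>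

lemma span_minors_kernel:
  assumes C: "finite C"
  shows "rng.span (minors C) = {p :: ('k::field) bpoly. psub (segre C) p = 0}"
proof
  have "rng.subspace {p :: 'k bpoly. psub (segre C) p = 0}"
    by (auto simp: rng.subspace_def)
  then show "rng.span (minors C) \<subseteq> {p :: 'k bpoly. psub (segre C) p = 0}"
    by (intro rng.span_minimal) (auto simp: minors_def segre_det2)
  show "{p :: 'k bpoly. psub (segre C) p = 0} \<subseteq> rng.span (minors C)"
  proof safe
    fix p :: "'k bpoly" assume p: "psub (segre C) p = 0"
    let ?K = "keys p" and ?\<mu> = "segre_monom C" and ?c = "lookup p"
    define \<eta> where "\<eta> z = (SOME m. ?\<mu> m = z)" for z
    have \<eta>: "?\<mu> (\<eta> (?\<mu> m)) = ?\<mu> m" for m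
      unfolding \<eta>_def by (rule someI[of _ m]) simp
    have "(\<Sum>m | m \<in> ?K \<and> ?\<mu> m = z. ?c m) = lookup (psub (segre C) p) z" for z
      unfolding psub_def monom_eval_segre
      by (simp add: mult_single lookup_sum lookup_single when_def sum.If_cases Int_def)
    then have z: "(\<Sum>m | m \<in> ?K \<and> ?\<mu> m = z. ?c m) = 0" for z
      by (simp add: p)
    have "(\<Sum>m\<in>?K. single (\<eta> (?\<mu> m)) (?c m))
        = (\<Sum>z\<in>?\<mu> ` ?K. \<Sum>m | m \<in> ?K \<and> ?\<mu> m = z. single (\<eta> (?\<mu> m)) (?c m))"
      by (rule sum.image_gen) simp
    also have "\<dots> = (\<Sum>z\<in>?\<mu> ` ?K. single (\<eta> z) (\<Sum>m | m \<in> ?K \<and> ?\<mu> m = z. ?c m))"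
    proof (rule sum.cong[OF refl])
      fix z
      show "(\<Sum>m | m \<in> ?K \<and> ?\<mu> m = z. single (\<eta> (?\<mu> m)) (?c m))
        = single (\<eta> z) (\<Sum>m | m \<in> ?K \<and> ?\<mu> m = z. ?c m)"
        by (auto simp: single_sum intro: sum.cong)
    qed
    also have "\<dots> = 0" by (simp add: z)
    finally have "p = (\<Sum>m\<in>?K. single m (?c m)) - (\<Sum>m\<in>?K. single (\<eta> (?\<mu> m)) (?c m))"
      using poly_mapping_sum_single[of p] by simp
    also have "\<dots> = (\<Sum>m\<in>?K. const (?c m) * (mon m - mon (\<eta> (?\<mu> m))))"
      by (simp add: sum_subtractf algebra_simps mult_single)
    also have "\<dots> \<in> rng.span (minors C)"
      by (intro rng.span_sum span_multL segre_monom_congruent[OF C]) (simp add: \<eta>)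
    finally show "p \<in> rng.span (minors C)" .
  qed
qed

lemma rprime_span_minors:
  "finite C \<Longrightarrow> rprime (rng.span (minors C :: ('k::field) bpoly set))"
  unfolding span_minors_kernel by (rule rprime_kernel)

text \<open>Replaces column i by \<epsilon> i times column \<kappa> i. The value 0 deletes the
  column, and -1 expresses that two columns sum to zero.\<close>

fun colsub :: "(nat \<Rightarrow> nat) \<Rightarrow> (nat \<Rightarrow> 'k) \<Rightarrow> bvar \<Rightarrow> ('k::field) bpoly" where
  "colsub \<kappa> \<epsilon> (X i) = const (\<epsilon> i) * pvar (X (\<kappa> i))"
| "colsub \<kappa> \<epsilon> (Y i) = const (\<epsilon> i) * pvar (Y (\<kappa> i))"

definition colrel :: "(nat \<Rightarrow> nat) \<Rightarrow> (nat \<Rightarrow> 'k) \<Rightarrow> ('k::field) bpoly set" where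
  "colrel \<kappa> \<epsilon> = range (\<lambda>v. pvar v - colsub \<kappa> \<epsilon> v)"

text \<open>The assumptions make \<open>colsub\<close> idempotent, hence a retraction onto the
  surviving columns, to which \<open>span_vimage\<close> applies.\<close>

lemma span_colrel:
  fixes \<epsilon> :: "nat \<Rightarrow> 'k::field"
  assumes idem: "\<And>i. \<epsilon> i \<noteq> 0 \<Longrightarrow> \<kappa> (\<kappa> i) = \<kappa> i \<and> \<epsilon> (\<kappa> i) = 1"
    and C: "\<And>i. i \<in> C \<Longrightarrow> \<epsilon> i \<noteq> 0 \<Longrightarrow> \<kappa> i \<in> C"
  shows "rng.span (minors C \<union> colrel \<kappa> \<epsilon>) = {p. psub (colsub \<kappa> \<epsilon>) p \<in> rng.span (minors C)}"
proof (rule span_vimage)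
  fix a :: "'k bpoly" assume "a \<in> minors C"
  then obtain i j where a: "i \<in> C" "j \<in> C" "a = det2 i j" by (auto simp: minors_def)
  have "psub (colsub \<kappa> \<epsilon>) a = const (\<epsilon> i * \<epsilon> j) * det2 (\<kappa> i) (\<kappa> j)"
    by (simp add: a det2_def const_mult algebra_simps)
  also have "\<dots> \<in> rng.span (minors C)"
  proof (cases "\<epsilon> i = 0 \<or> \<epsilon> j = 0")
    case False
    then have "det2 (\<kappa> i) (\<kappa> j) \<in> (minors C :: 'k bpoly set)"
      using C a by (auto simp: minors_def)
    then show ?thesis by (intro span_multL rng.span_base)
  qed (auto simp: rng.span_zero)
  finally show "psub (colsub \<kappa> \<epsilon>) a \<in> rng.span (minors C)" .
next
  fix l :: "'k bpoly" assume "l \<in> colrel \<kappa> \<epsilon>"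
  then obtain v where l: "l = pvar v - colsub \<kappa> \<epsilon> v" by (auto simp: colrel_def)
  have "psub (colsub \<kappa> \<epsilon>) (colsub \<kappa> \<epsilon> v) = colsub \<kappa> \<epsilon> v"
    by (cases v; cases "\<epsilon> (case v of X i \<Rightarrow> i | Y i \<Rightarrow> i) = 0") (use idem in auto)
  then show "psub (colsub \<kappa> \<epsilon>) l \<in> rng.span (minors C)"
    by (simp add: l rng.span_zero)
next
  fix v show "pvar v - colsub \<kappa> \<epsilon> v \<in> rng.span (minors C \<union> colrel \<kappa> \<epsilon>)"
    by (intro rng.span_base) (auto simp: colrel_def)
qed

lemma rprime_span_colrel:
  fixes \<epsilon> :: "nat \<Rightarrow> 'k::field"
  assumes "\<And>i. \<epsilon> i \<noteq> 0 \<Longrightarrow> \<kappa> (\<kappa> i) = \<kappa> i \<and> \<epsilon> (\<kappa> i) = 1"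
    and "\<And>i. i \<in> C \<Longrightarrow> \<epsilon> i \<noteq> 0 \<Longrightarrow> \<kappa> i \<in> C" and "finite C"
  shows "rprime (rng.span (minors C \<union> colrel \<kappa> \<epsilon>))"
  using rprime_vimage[OF rprime_span_minors[OF assms(3)], of "colsub \<kappa> \<epsilon>"]
    span_colrel[of \<epsilon> \<kappa> C, OF assms(1,2)] by simp

section \<open>A weakly regular sequence of length four\<close>

abbreviation xv :: "nat \<Rightarrow> ('k::field) bpoly" where "xv i \<equiv> pvar (X i)"
abbreviation yv :: "nat \<Rightarrow> ('k::field) bpoly" where "yv i \<equiv> pvar (Y i)"

definition cols :: "nat set \<Rightarrow> ('k::field) bpoly set" where
  "cols A = xv ` A \<union> yv ` A"

lemma pvar_in_carrier_iff [simp]: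
  "(pvar v :: ('v, 'k::field) mpoly) \<in> carrier (poly_ring U) \<longleftrightarrow> v \<in> U"
  by (simp add: in_carrier_poly_ring pvar_def)

lemma cols_in_carrier [simp]:
  "(cols A :: ('k::field) bpoly set) \<subseteq> carrier (poly_ring U) \<longleftrightarrow> X ` A \<union> Y ` A \<subseteq> U"
  by (auto simp: cols_def)

lemma det2_self [simp]: "det2 i i = 0"
  by (simp add: det2_def)

lemma det2_in_carrier: "{X i, Y i, X j, Y j} \<subseteq> U \<Longrightarrow> det2 i j \<in> carrier (poly_ring U)"
  unfolding det2_def by (intro poly_ring_closed) auto

lemma minors_in_carrier: "X ` A \<union> Y ` A \<subseteq> U \<Longrightarrow> minors A \<subseteq> carrier (poly_ring U)"
  by (auto simp: minors_def intro!: det2_in_carrier)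

text \<open>The primality test for concrete generators: S generates the same ideal as the minors of
  C together with the column relations, and that ideal is a preimage of the prime ideal of
  minors.\<close>

lemma rprime_columns:
  fixes S :: "('k::field) bpoly set" and \<epsilon> :: "nat \<Rightarrow> 'k"
  assumes "finite C" "\<And>i. \<epsilon> i \<noteq> 0 \<Longrightarrow> \<kappa> (\<kappa> i) = \<kappa> i \<and> \<epsilon> (\<kappa> i) = 1"
    and "\<And>i. i \<in> C \<Longrightarrow> \<epsilon> i \<noteq> 0 \<Longrightarrow> \<kappa> i \<in> C"
    and "minors C \<subseteq> rng.span S"
    and "\<And>i. \<kappa> i = i \<and> \<epsilon> i = 1 \<or>
      xv i - const (\<epsilon> i) * xv (\<kappa> i) \<in> rng.span S \<and> yv i - const (\<epsilon> i) * yv (\<kappa> i) \<in> rng.span S"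
    and "\<And>s. s \<in> S \<Longrightarrow> s \<in> minors C \<or> psub (colsub \<kappa> \<epsilon>) s = 0"
  shows "rprime (rng.span S)"
proof -
  have "rng.span S = rng.span (minors C \<union> colrel \<kappa> \<epsilon>)"
  proof (rule span_eqI)
    show "S \<subseteq> rng.span (minors C \<union> colrel \<kappa> \<epsilon>)"
    proof
      fix s assume "s \<in> S"
      from assms(6)[OF this] show "s \<in> rng.span (minors C \<union> colrel \<kappa> \<epsilon>)"
      proof
        assume "psub (colsub \<kappa> \<epsilon>) s = 0"
        then show ?thesis
          using span_colrel[of \<epsilon> \<kappa> C, OF assms(2,3)] by (simp add: rng.span_zero)
      qed (simp add: rng.span_base)
    qed
    have "pvar v - colsub \<kappa> \<epsilon> v \<in> rng.span S" for v
      using assms(5)[of "case v of X i \<Rightarrow> i | Y i \<Rightarrow> i"] by (cases v) (auto simp: rng.span_zero)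
    then show "minors C \<union> colrel \<kappa> \<epsilon> \<subseteq> rng.span S"
      using assms(4) by (auto simp: colrel_def)
  qed
  then show ?thesis
    using rprime_span_colrel[of \<epsilon> \<kappa> C, OF assms(2,3,1)] by simp
qed

text \<open>The matrix with columns \<alpha> i * (s, t), a point where all 2-minors vanish.
  Evaluation there certifies that a form lies outside an ideal.\<close>

fun rank1_point :: "(nat \<Rightarrow> 'k) \<Rightarrow> 'k \<Rightarrow> 'k \<Rightarrow> bvar \<Rightarrow> ('k::field) bpoly" where
  "rank1_point \<alpha> s t (X i) = const (\<alpha> i * s)"
| "rank1_point \<alpha> s t (Y i) = const (\<alpha> i * t)"

lemma psub_rank1_det2 [simp]: "psub (rank1_point \<alpha> s t) (det2 i j) = 0"
  by (simp add: det2_def mult_single ac_simps)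

lemma notin_span_point:
  assumes "\<And>g. g \<in> S \<Longrightarrow> g \<in> minors C \<or> psub (rank1_point \<alpha> s t) g = 0"
    and "psub (rank1_point \<alpha> s t) f \<noteq> 0"
  shows "f \<notin> rng.span S"
proof
  assume "f \<in> rng.span S"
  then have "psub (rank1_point \<alpha> s t) f = 0"
  proof (induction f rule: rng.span_induct_alt)
    case (step c x y)
    then show ?case using assms(1)[of x] by (auto simp: minors_def)
  qed simp
  with assms(2) show False by simp
qed

text \<open>Once the upper entry of the column (\<open>x1\<close>, \<open>y1\<close>) is in the
  ideal, its minors put every y1 * x_j there, so \<open>wreg_split\<close> with w = y1 separates
  "all x_j vanish" from "the column vanishes". The entries may be sums of variables, which allows
  sums of columns.\<close>

lemma wreg_column_x:
  assumes "x1 \<in> rng.span A" "\<And>j. j \<in> V \<Longrightarrow> x1 * yv j - xv j * y1 \<in> rng.span A"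
    and "A \<subseteq> rng.span B" "B \<subseteq> xv ` V \<union> rng.span A"
    and "nzd (rng.span B) y1" "wreg (rng.span B) (fs @ [g])"
      "wreg (rng.span (insert y1 B)) fs" "wreg (rng.span (insert y1 A)) (fs @ [g])"
  shows "wreg (rng.span A) (fs @ [g])"
proof (rule wreg_split[OF assms(3,5) _ assms(6,8,7)])
  fix b assume "b \<in> B"
  then consider j where "j \<in> V" "b = xv j" | "b \<in> rng.span A" using assms(4) by auto
  then show "y1 * b \<in> rng.span A"
  proof cases
    case 1
    then have "yv j * x1 - (x1 * yv j - xv j * y1) \<in> rng.span A"
      by (intro rng.span_diff span_multL assms(1,2))
    then show ?thesis using 1 by (simp add: algebra_simps)
  qed (rule span_multL)
qed

lemma wreg_column_y:
  assumes "y1 \<in> rng.span A" "\<And>j. j \<in> V \<Longrightarrow> x1 * yv j - xv j * y1 \<in> rng.span A"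
    and "A \<subseteq> rng.span B" "B \<subseteq> yv ` V \<union> rng.span A"
    and "nzd (rng.span B) x1" "wreg (rng.span B) (fs @ [g])"
      "wreg (rng.span (insert x1 B)) fs" "wreg (rng.span (insert x1 A)) (fs @ [g])"
  shows "wreg (rng.span A) (fs @ [g])"
proof (rule wreg_split[OF assms(3,5) _ assms(6,8,7)])
  fix b assume "b \<in> B"
  then consider j where "j \<in> V" "b = yv j" | "b \<in> rng.span A" using assms(4) by auto
  then show "x1 * b \<in> rng.span A"
  proof cases
    case 1
    then have "(x1 * yv j - xv j * y1) + xv j * y1 \<in> rng.span A"
      by (intro rng.span_add span_multL assms(1,2))
    then show ?thesis using 1 by simp
  qed (rule span_multL)
qed

lemma nzd_freshI:
  assumes "f = pvar v + g" "A \<subseteq> carrier (poly_ring (- {v}))" "g \<in> carrier (poly_ring (- {v}))"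
  shows "nzd (rng.span A) f"
  using assms by (intro nzd_fresh[of A v]) simp_all

lemma minors_span_x: "minors V \<subseteq> rng.span (xv ` V \<union> A)"
  unfolding minors_def det2_def
  by (auto intro!: rng.span_diff span_multR intro: rng.span_base)

lemma minors_span_y: "minors V \<subseteq> rng.span (yv ` V \<union> A)"
  unfolding minors_def det2_def
  by (auto intro!: rng.span_diff span_multL intro: rng.span_base)

lemma det2_add_col:
  assumes "a \<in> V" "p \<in> V" "j \<in> V" "minors V \<subseteq> A"
  shows "(xv a + xv p) * yv j - xv j * (yv a + yv p) \<in> rng.span A"
proof -
  have "det2 a j + det2 p j \<in> rng.span A"
    using assms by (intro rng.span_add rng.span_base) (auto simp: minors_def)
  then show ?thesis by (simp add: det2_def algebra_simps)
qed


section \<open>The four linear forms\<close>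

lemma const_minus_1 [simp]: "const (- 1) = (- 1 :: ('v, 'k::comm_ring_1) mpoly)"
  by (simp add: single_uminus)

text \<open>Modulo columns 3, ..., n the forms become x_1, y_2, x_2 + y_1, x_2, which are
  coordinates for S/Q2. Modulo columns 1 and 2 they become x_3, y_4, x_n + y_n, x_4 + y_3, with
  columns 3 and 4 outside the clique and column n inside it.\<close>

definition rs1 :: "('k::field) bpoly" where "rs1 = xv 1 + xv 3"
definition rs2 :: "('k::field) bpoly" where "rs2 = yv 2 + yv 4"
definition rs3 :: "nat \<Rightarrow> ('k::field) bpoly" where "rs3 n = xv 2 + yv 1 + xv n + yv n"
definition rs4 :: "('k::field) bpoly" where "rs4 = xv 2 + xv 4 + yv 3"

lemmas rs_defs = rs1_def rs2_def rs3_def rs4_def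

lemma rs_in_carrier [simp]:
  "{X 1, X 3} \<subseteq> U \<Longrightarrow> rs1 \<in> carrier (poly_ring U)"
  "{Y 2, Y 4} \<subseteq> U \<Longrightarrow> rs2 \<in> carrier (poly_ring U)"
  "{X 2, Y 1, X n, Y n} \<subseteq> U \<Longrightarrow> rs3 n \<in> carrier (poly_ring U)"
  "{X 2, X 4, Y 3} \<subseteq> U \<Longrightarrow> rs4 \<in> carrier (poly_ring U)"
  unfolding rs_defs by (intro poly_ring_closed; simp)+

lemma nzd_rs1:
  assumes "A \<subseteq> carrier (poly_ring (- {v}))" "v = X 1 \<or> v = X 3"
  shows "nzd (rng.span A) rs1"
  using assms(2)
proof
  assume "v = X 1" then show ?thesis using assms(1)
    by (intro nzd_freshI[where v=v and g="xv 3"]) (simp_all add: rs_defs)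
next
  assume "v = X 3" then show ?thesis using assms(1)
    by (intro nzd_freshI[where v=v and g="xv 1"]) (simp_all add: rs_defs)
qed

lemma nzd_rs2:
  assumes "A \<subseteq> carrier (poly_ring (- {v}))" "v = Y 2 \<or> v = Y 4"
  shows "nzd (rng.span A) rs2"
  using assms(2)
proof
  assume "v = Y 2" then show ?thesis using assms(1)
    by (intro nzd_freshI[where v=v and g="yv 4"]) (simp_all add: rs_defs)
next
  assume "v = Y 4" then show ?thesis using assms(1)
    by (intro nzd_freshI[where v=v and g="yv 2"]) (simp_all add: rs_defs)
qed

lemma nzd_rs3:
  assumes "A \<subseteq> carrier (poly_ring (- {v}))" "v \<in> {X 2, Y 1, X n, Y n}" "n \<ge> 5"
  shows "nzd (rng.span A) (rs3 n)"
proof -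
  have "rs3 n - pvar v \<in> {yv 1 + xv n + yv n, xv 2 + xv n + yv n, xv 2 + yv 1 + yv n, xv 2 + yv 1 + xv n}"
    using assms(2) unfolding rs_defs by (auto simp: algebra_simps)
  then have "rs3 n - pvar v \<in> carrier (poly_ring (- {v}))"
    using assms(2,3) by (elim insertE) (auto simp: rs_defs intro!: poly_ring_closed)
  then show ?thesis by (rule nzd_fresh[OF assms(1)])
qed

lemma nzd_rs4:
  assumes "A \<subseteq> carrier (poly_ring (- {v}))" "v \<in> {X 2, X 4, Y 3}"
  shows "nzd (rng.span A) rs4"
proof -
  have "rs4 - pvar v \<in> {xv 4 + yv 3, xv 2 + yv 3, xv 2 + xv 4}"
    using assms(2) unfolding rs_defs by (auto simp: algebra_simps)
  then have "rs4 - pvar v \<in> carrier (poly_ring (- {v}))"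
    using assms(2) by (elim insertE) (auto simp: rs_defs intro!: poly_ring_closed)
  then show ?thesis by (rule nzd_fresh[OF assms(1)])
qed

lemma nzd_pvar: "A \<subseteq> carrier (poly_ring (- {v})) \<Longrightarrow> nzd (rng.span A) (pvar v)"
  using nzd_fresh[of A v "pvar v"] by (simp add: zero_in_poly_ring)

section \<open>Regularity on the pieces Q2, Q3, Q2 + J', Q1 + Q3 and Q1\<close>

lemma wreg_Q2:
  assumes "n \<ge> 5"
  shows "wreg (rng.span (cols {3..n} :: ('k::field) bpoly set)) [rs1, rs2, rs3 n, rs4]"
proof -
  let ?A = "insert rs2 (insert rs1 (cols {3..n})) :: 'k bpoly set"
  \<comment> \<open>After \<open>rs3 n\<close> no variable of \<open>rs4\<close> is fresh: X 2
    occurs in both, and X 4, Y 3 are generators. In the opposite order X 2 and then Y 1 are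
    fresh.\<close>
  have "wreg (rng.span ?A) [rs3 n, rs4]"
  proof (rule wreg_swap)
    have "nzd (rng.span ?A) rs4" by (rule nzd_rs4[where v = "X 2"]) auto
    moreover have "nzd (rng.span (insert rs4 ?A)) (rs3 n)"
      using assms by (intro nzd_rs3[where v = "Y 1"]) auto
    ultimately show "wreg (rng.span ?A) [rs4, rs3 n]" by simp
    show "nzd (rng.span ?A) (rs3 n)"
      using assms by (intro nzd_rs3[where v = "Y 1"]) auto
  qed simp
  moreover have "nzd (rng.span (cols {3..n})) rs1" by (rule nzd_rs1[where v = "X 1"]) auto
  moreover have "nzd (rng.span (insert rs1 (cols {3..n}))) rs2" by (rule nzd_rs2[where v = "Y 2"]) auto
  ultimately show ?thesis by simp
qed

text \<open>Only \<open>rs3 n\<close> has no fresh variable, since column n is in the clique. It is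
  tested first, while the ideal is prime, and moved to third place by two exchanges; the other forms
  use the variables X 3, Y 4, X 4 of isolated vertices.\<close>

lemma wreg_Q3:
  assumes "4 \<le> e" "e < n"
  shows "wreg (rng.span (minors {Suc e..n} \<union> cols {1, 2} :: ('k::field) bpoly set)) [rs1, rs2, rs3 n, rs4]"
proof -
  let ?A = "minors {Suc e..n} \<union> cols {1, 2} :: 'k bpoly set"
  have c: "minors {Suc e..n} \<subseteq> carrier (poly_ring (- {v}))" if "v \<in> {X 3, Y 4, X 4}" for v
    using that assms by (intro minors_in_carrier) auto
  have "rprime (rng.span ?A)"
    by (rule rprime_columns[of "{Suc e..n}" "\<lambda>i. if i \<in> {1, 2} then 0 else 1" "\<lambda>i. i"])
      (use assms in \<open>auto simp: cols_def intro: rng.span_base\<close>)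
  moreover have "rs3 n \<notin> rng.span ?A"
    by (rule notin_span_point[of _ "{Suc e..n}" "\<lambda>i. if i = n then 1 else 0" 1 0])
      (use assms in \<open>auto simp: cols_def rs_defs\<close>)
  ultimately have 1: "nzd (rng.span ?A) (rs3 n)" by (rule rprime_nzd)
  have c': "minors {Suc e..n} \<union> cols {1, 2} \<subseteq> carrier (poly_ring (- {v}))"
    if "v \<in> {X 3, Y 4, X 4}" for v
    using c[OF that] that by auto
  have 2: "nzd (rng.span (insert (rs3 n) ?A)) rs1" "nzd (rng.span ?A) rs1"
    using assms c'[of "X 3"] by (intro nzd_rs1[where v = "X 3"]; simp)+
  have 3: "nzd (rng.span (insert rs1 (insert (rs3 n) ?A))) rs2" "nzd (rng.span (insert rs1 ?A)) rs2"
    using assms c'[of "Y 4"] by (intro nzd_rs2[where v = "Y 4"]; simp)+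
  have 4: "nzd (rng.span (insert rs2 (insert rs1 (insert (rs3 n) ?A)))) rs4"
    using assms c'[of "X 4"] by (intro nzd_rs4[where v = "X 4"]; simp)+
  from 1 2 3 4 have "wreg (rng.span ?A) [rs3 n, rs1, rs2, rs4]" by simp
  then have "wreg (rng.span ?A) [rs1, rs3 n, rs2, rs4]"
    using 2(2) by (rule wreg_swap[OF rng.subspace_span])
  then have "wreg (rng.span (insert rs1 ?A)) [rs3 n, rs2, rs4]" by simp
  then have "wreg (rng.span (insert rs1 ?A)) [rs2, rs3 n, rs4]"
    using 3(2) by (rule wreg_swap[OF rng.subspace_span])
  then show ?thesis using 2 by simp
qed

text \<open>This ideal is Q2 + J'. Modulo \<open>rs1\<close> it contains x_1, so its minor becomes
  x_2 * y_1 up to sign, and the ideal splits into x_1 = x_2 = 0 and column 1 = 0. On each branch two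
  variables of columns 1 and 2 are left for \<open>rs2\<close> and \<open>rs3 n\<close>.\<close>

lemma wreg_Q2_det:
  assumes "n \<ge> 5"
  shows "wreg (rng.span (minors {1, 2} \<union> cols {3..n} :: ('k::field) bpoly set)) [rs1, rs2, rs3 n]"
proof -
  let ?H = "cols {3..n} :: 'k bpoly set" and ?M = "minors {1, 2} :: 'k bpoly set"
  let ?A = "insert rs1 (?M \<union> ?H)"
  have "rprime (rng.span (?M \<union> ?H))"
    by (rule rprime_columns[of "{1, 2}" "\<lambda>i. if i \<in> {3..n} then 0 else 1" "\<lambda>i. i"])
      (use assms in \<open>auto simp: cols_def intro: rng.span_base\<close>)
  moreover have "rs1 \<notin> rng.span (?M \<union> ?H)"
    by (rule notin_span_point[of _ "{1, 2}" "\<lambda>i. if i = 1 then 1 else 0" 1 0])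
      (use assms in \<open>auto simp: cols_def rs_defs\<close>)
  ultimately have 1: "nzd (rng.span (?M \<union> ?H)) rs1" by (rule rprime_nzd)
  have x3: "xv 3 \<in> rng.span ?A" "xv 3 \<in> cols {3..n}"
    using assms by (auto simp: cols_def intro: rng.span_base)
  have "rs1 - xv 3 \<in> rng.span ?A"
    by (intro rng.span_diff x3 rng.span_base) auto
  then have x1: "xv 1 \<in> rng.span ?A" by (simp add: rs1_def)
  let ?B = "xv ` {1, 2} \<union> ?H"
  have "wreg (rng.span ?A) ([rs2] @ [rs3 n])"
  proof (rule wreg_column_x[OF x1, where V = "{1, 2}" and ?y1.0 = "yv 1" and B = ?B])
    show "xv 1 * yv j - xv j * yv 1 \<in> rng.span ?A" if "j \<in> {1, 2}" for j
      using that by (intro rng.span_base) (auto simp: minors_def det2_def)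
    have "rs1 \<in> rng.span ?B" unfolding rs1_def
      using x3 by (intro rng.span_add rng.span_base) auto
    then show "?A \<subseteq> rng.span ?B"
      using minors_span_x[of "{1, 2}" ?H] by (auto intro: rng.span_base)
    show "?B \<subseteq> xv ` {1, 2} \<union> rng.span ?A" by (auto intro: rng.span_base)
    show "nzd (rng.span ?B) (yv 1)" by (rule nzd_pvar) auto
    have "nzd (rng.span ?B) rs2" by (rule nzd_rs2[where v = "Y 2"]) auto
    moreover have "nzd (rng.span (insert rs2 ?B)) (rs3 n)"
      using assms by (intro nzd_rs3[where v = "Y 1"]) auto
    ultimately show "wreg (rng.span ?B) ([rs2] @ [rs3 n])" by simp
    have "nzd (rng.span (insert (yv 1) ?B)) rs2" by (rule nzd_rs2[where v = "Y 2"]) auto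
    then show "wreg (rng.span (insert (yv 1) ?B)) [rs2]" by simp
    have "rng.span (insert (yv 1) ?A) = rng.span (insert (yv 1) (insert (xv 1) ?H))"
    proof (rule span_eqI)
      show "insert (yv 1) (insert (xv 1) ?H) \<subseteq> rng.span (insert (yv 1) ?A)"
        using x1 rng.span_mono[of ?A "insert (yv 1) ?A"] by (auto intro: rng.span_base)
      have "rs1 \<in> rng.span (insert (yv 1) (insert (xv 1) ?H))" unfolding rs1_def
        using x3 by (intro rng.span_add rng.span_base) auto
      moreover have "?M \<subseteq> rng.span (insert (yv 1) (insert (xv 1) ?H))"
        by (auto simp: minors_def rng.span_zero)
           (auto simp: det2_def intro!: rng.span_diff intro: span_multL span_multR rng.span_base)
      ultimately show "insert (yv 1) ?A \<subseteq> rng.span (insert (yv 1) (insert (xv 1) ?H))"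
        by (auto intro: rng.span_base)
    qed
    moreover have "nzd (rng.span (insert (yv 1) (insert (xv 1) ?H))) rs2"
      by (rule nzd_rs2[where v = "Y 2"]) auto
    moreover have "nzd (rng.span (insert rs2 (insert (yv 1) (insert (xv 1) ?H)))) (rs3 n)"
      using assms by (intro nzd_rs3[where v = "X 2"]) auto
    ultimately show "wreg (rng.span (insert (yv 1) ?A)) ([rs2] @ [rs3 n])" by simp
  qed
  with 1 show ?thesis by simp
qed

text \<open>This ideal is Q1 + Q3. \<open>rs1\<close> puts x_3 into it, so either all x_j vanish or
  column 3 does; in the latter case \<open>rs2\<close> puts y_4 into it, and either all y_j vanish
  or column 4 does. The branches with all x_j or all y_j zero are linear and offer fresh variables;
  the others are prime.\<close>

lemma wreg_Q1_Q3:
  assumes "n \<ge> 5"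
  shows "wreg (rng.span (minors {3..n} \<union> cols {1, 2} :: ('k::field) bpoly set)) [rs1, rs2, rs3 n]"
proof -
  let ?M = "minors {3..n} :: 'k bpoly set" and ?K = "cols {1, 2} :: 'k bpoly set"
  let ?A0 = "?M \<union> ?K"
  let ?A1 = "insert rs1 ?A0"
  let ?A2 = "insert rs2 (insert (yv 3) ?A1)"
  have K: "xv 1 \<in> ?K" "yv 1 \<in> ?K" "xv 2 \<in> ?K" "yv 2 \<in> ?K" by (auto simp: cols_def)
  have "rs1 - xv 1 \<in> rng.span ?A1"
    using K by (intro rng.span_diff rng.span_base) auto
  then have x3: "xv 3 \<in> rng.span ?A1" by (simp add: rs1_def)
  have "rs2 - yv 2 \<in> rng.span ?A2"
    using K by (intro rng.span_diff rng.span_base) auto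
  then have y4: "yv 4 \<in> rng.span ?A2" by (simp add: rs2_def)
  have x3': "xv 3 \<in> rng.span (insert (yv 3) ?A1)" "xv 3 \<in> rng.span ?A2"
    using x3 rng.span_mono[of ?A1 "insert (yv 3) ?A1"] rng.span_mono[of ?A1 ?A2] by auto
  have MA: "?M \<subseteq> rng.span (minors {3..n} \<union> B)" for B
    by (auto intro: rng.span_base)
  have "rprime (rng.span ?A0)"
    by (rule rprime_columns[of "{3..n}" "\<lambda>i. if i \<in> {1, 2} then 0 else 1" "\<lambda>i. i"])
      (use assms in \<open>auto simp: cols_def intro: rng.span_base\<close>)
  moreover have "rs1 \<notin> rng.span ?A0"
    by (rule notin_span_point[of _ "{3..n}" "\<lambda>i. if i = 3 then 1 else 0" 1 0])
      (auto simp: cols_def rs_defs)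
  ultimately have n1: "nzd (rng.span ?A0) rs1" by (rule rprime_nzd)
  have "rprime (rng.span (insert (yv 3) ?A1))"
    by (rule rprime_columns[of "{3..n}" "\<lambda>i. if i \<in> {1, 2, 3} then 0 else 1" "\<lambda>i. i"])
      (use assms x3' in \<open>auto simp: cols_def rs_defs intro: rng.span_base\<close>)
  moreover have "rs2 \<notin> rng.span (insert (yv 3) ?A1)"
    by (rule notin_span_point[of _ "{3..n}" "\<lambda>i. if i = 4 then 1 else 0" 0 1])
      (auto simp: cols_def rs_defs)
  ultimately have n2: "nzd (rng.span (insert (yv 3) ?A1)) rs2" by (rule rprime_nzd)
  have mono: "rng.span ?A2 \<subseteq> rng.span (insert (xv 4) ?A2)" by (intro rng.span_mono) auto
  have "rprime (rng.span (insert (xv 4) ?A2))"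
    by (rule rprime_columns[of "{3..n}" "\<lambda>i. if i \<in> {1, 2, 3, 4} then 0 else 1" "\<lambda>i. i"])
      (use assms subsetD[OF mono x3'(2)] subsetD[OF mono y4] in \<open>auto simp: cols_def rs_defs intro: rng.span_base\<close>)
  moreover have "rs3 n \<notin> rng.span (insert (xv 4) ?A2)"
    by (rule notin_span_point[of _ "{3..n}" "\<lambda>i. if i = n then 1 else 0" 1 0])
      (use assms in \<open>auto simp: cols_def rs_defs\<close>)
  ultimately have n3: "nzd (rng.span (insert (xv 4) ?A2)) (rs3 n)" by (rule rprime_nzd)
  have rk: "xv i * yv j - xv j * yv i \<in> rng.span B" if "i \<in> {3..n}" "j \<in> {3..n}" "?M \<subseteq> B" for i j B
    using that by (intro rng.span_base) (auto simp: minors_def det2_def)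
  let ?B1 = "xv ` {3..n} \<union> ?K" and ?B2 = "yv ` {3..n} \<union> insert (xv 3) ?K"
  have "wreg (rng.span ?A2) ([] @ [rs3 n])"
  proof (rule wreg_column_y[OF y4, where V = "{3..n}" and ?x1.0 = "xv 4" and B = ?B2])
    show "xv 4 * yv j - xv j * yv 4 \<in> rng.span ?A2" if "j \<in> {3..n}" for j
      using assms that by (intro rk) auto
    have "rs1 \<in> rng.span ?B2" "rs2 \<in> rng.span ?B2"
      unfolding rs1_def rs2_def using assms K by (intro rng.span_add rng.span_base; simp)+
    then show "?A2 \<subseteq> rng.span ?B2"
      using assms minors_span_y[of "{3..n}" "insert (xv 3) ?K"] by (auto intro: rng.span_base)
    show "?B2 \<subseteq> yv ` {3..n} \<union> rng.span ?A2"
      using x3' by (auto intro: rng.span_base)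
    show "nzd (rng.span ?B2) (xv 4)" by (rule nzd_pvar) auto
    have "nzd (rng.span ?B2) (rs3 n)" using assms by (intro nzd_rs3[where v = "X n"]) auto
    then show "wreg (rng.span ?B2) ([] @ [rs3 n])" by simp
    show "wreg (rng.span (insert (xv 4) ?A2)) ([] @ [rs3 n])" using n3 by simp
  qed simp
  with n2 have w2: "wreg (rng.span (insert (yv 3) ?A1)) ([rs2] @ [rs3 n])" by simp
  have "wreg (rng.span ?A1) ([rs2] @ [rs3 n])"
  proof (rule wreg_column_x[OF x3, where V = "{3..n}" and ?y1.0 = "yv 3" and B = ?B1, OF _ _ _ _ _ _ w2])
    show "xv 3 * yv j - xv j * yv 3 \<in> rng.span ?A1" if "j \<in> {3..n}" for j
      using assms that by (intro rk) auto
    have "rs1 \<in> rng.span ?B1"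
      unfolding rs1_def using assms K by (intro rng.span_add rng.span_base; simp)
    then show "?A1 \<subseteq> rng.span ?B1"
      using assms minors_span_x[of "{3..n}" ?K] by (auto intro: rng.span_base)
    show "?B1 \<subseteq> xv ` {3..n} \<union> rng.span ?A1"
      by (auto intro: rng.span_base)
    show "nzd (rng.span ?B1) (yv 3)" by (rule nzd_pvar) auto
    have "nzd (rng.span ?B1) rs2" by (rule nzd_rs2[where v = "Y 4"]) auto
    moreover have "nzd (rng.span (insert rs2 ?B1)) (rs3 n)"
      using assms by (intro nzd_rs3[where v = "Y n"]) auto
    ultimately show "wreg (rng.span ?B1) ([rs2] @ [rs3 n])" by simp
    have "nzd (rng.span (insert (yv 3) ?B1)) rs2" by (rule nzd_rs2[where v = "Y 4"]) auto
    then show "wreg (rng.span (insert (yv 3) ?B1)) [rs2]" by simp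
  qed
  with n1 show ?thesis by simp
qed

text \<open>The same splitting for sums of columns: \<open>rs1\<close> and \<open>rs2\<close> are
  entries of the columns 1 + 3 and 2 + 4. Off the linear branches column 1 becomes minus column 3
  and column 2 minus column 4. There \<open>rs4\<close> reduces to y_3, and one more splitting kills
  columns 1 and 3. Hence \<open>rs4\<close> is treated before \<open>rs3 n\<close>, and the two are
  exchanged afterwards.\<close>

lemma wreg_Q1:
  assumes "n \<ge> 5"
  shows "wreg (rng.span (minors {1..n} :: ('k::field) bpoly set)) [rs1, rs2, rs3 n, rs4]"
proof -
  let ?V = "{1..n}"
  let ?M = "minors ?V :: 'k bpoly set"
  let ?y1 = "yv 1 + yv 3 :: 'k bpoly" and ?x2 = "xv 2 + xv 4 :: 'k bpoly"
  let ?A1 = "insert rs1 ?M"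
  let ?A1' = "insert ?y1 ?A1"
  let ?A2 = "insert rs2 ?A1'"
  let ?A2' = "insert ?x2 ?A2"
  let ?A3 = "insert rs4 ?A2'"
  let ?A3' = "insert (xv 3) ?A3"
  let ?B1 = "xv ` ?V :: 'k bpoly set"
  let ?B2 = "yv ` ?V \<union> {rs1} :: 'k bpoly set"
  let ?B3 = "yv ` ?V \<union> {rs1, ?x2} :: 'k bpoly set"
  have V: "1 \<in> ?V" "2 \<in> ?V" "3 \<in> ?V" "4 \<in> ?V" "n \<in> ?V" using assms by auto
  have n1: "nzd (rng.span ?M) rs1"
  proof (rule rprime_nzd[OF rprime_span_minors])
    show "rs1 \<notin> rng.span ?M"
      by (rule notin_span_point[of _ ?V "\<lambda>i. if i = 1 then 1 else 0" 1 0]) (auto simp: rs_defs)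
  qed simp
  have n2: "nzd (rng.span ?A1') rs2"
  proof (rule rprime_nzd)
    show "rprime (rng.span ?A1')"
      by (rule rprime_columns[of ?V "\<lambda>i. if i = 1 then - 1 else 1" "\<lambda>i. if i = 1 then 3 else i"])
        (use assms in \<open>auto simp: rs_defs intro: rng.span_base\<close>)
    show "rs2 \<notin> rng.span ?A1'"
      by (rule notin_span_point[of _ ?V "\<lambda>i. if i = 2 then 1 else 0" 0 1]) (auto simp: rs_defs)
  qed
  have p2: "rprime (rng.span ?A2')"
    by (rule rprime_columns[of ?V "\<lambda>i. if i \<in> {1, 2} then - 1 else 1"
          "\<lambda>i. if i = 1 then 3 else if i = 2 then 4 else i"])
      (use assms in \<open>auto simp: rs_defs intro: rng.span_base\<close>)
  have n3: "nzd (rng.span ?A2') (rs3 n)"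
  proof (rule rprime_nzd[OF p2])
    show "rs3 n \<notin> rng.span ?A2'"
      by (rule notin_span_point[of _ ?V "\<lambda>i. if i = n then 1 else 0" 1 0])
        (use assms in \<open>auto simp: rs_defs\<close>)
  qed
  have n4: "nzd (rng.span ?A2') rs4"
  proof (rule rprime_nzd[OF p2])
    \<comment> \<open>Column 1 is minus column 3 on this locus, so a point with y_3 = 1 must have
      y_1 = -1.\<close>
    show "rs4 \<notin> rng.span ?A2'"
      by (rule notin_span_point[of _ ?V "\<lambda>i. if i = 3 then 1 else if i = 1 then - 1 else 0" 0 1])
        (auto simp: rs_defs simp flip: single_add)
  qed
  have "rs4 - ?x2 \<in> rng.span ?A3" by (intro rng.span_diff rng.span_base) auto
  then have y3: "yv 3 \<in> rng.span ?A3" by (simp add: rs4_def)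
  have mono: "rng.span ?A3 \<subseteq> rng.span ?A3'" by (intro rng.span_mono) auto
  then have y3': "yv 3 \<in> rng.span ?A3'" using y3 by auto
  have "rs1 - xv 3 \<in> rng.span ?A3'" "?y1 - yv 3 \<in> rng.span ?A3'"
    by (intro rng.span_diff y3' rng.span_base; simp)+
  then have c1: "xv 1 \<in> rng.span ?A3'" "yv 1 \<in> rng.span ?A3'" by (simp_all add: rs1_def)
  have n5: "nzd (rng.span ?A3') (rs3 n)"
  proof (rule rprime_nzd)
    show "rprime (rng.span ?A3')"
      by (rule rprime_columns[of ?V "\<lambda>i. if i \<in> {1, 3} then 0 else if i = 2 then - 1 else 1"
            "\<lambda>i. if i = 2 then 4 else i"])
        (use assms c1 y3' in \<open>auto simp: rs_defs intro: rng.span_base\<close>)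
    show "rs3 n \<notin> rng.span ?A3'"
      by (rule notin_span_point[of _ ?V "\<lambda>i. if i = n then 1 else 0" 1 0])
        (use assms in \<open>auto simp: rs_defs\<close>)
  qed
  have y_span: "yv i \<in> rng.span (yv ` ?V \<union> B)" if "i \<in> ?V" for i and B :: "'k bpoly set"
    using that by (intro rng.span_base) auto
  have y1_span: "?y1 \<in> rng.span (yv ` ?V \<union> B)" and rs2_span: "rs2 \<in> rng.span (yv ` ?V \<union> B)"
    for B :: "'k bpoly set"
    unfolding rs2_def by (intro rng.span_add y_span V)+
  have "wreg (rng.span ?A3) ([] @ [rs3 n])"
  proof (rule wreg_column_y[OF y3, where V = ?V and ?x1.0 = "xv 3" and B = ?B3])
    show "xv 3 * yv j - xv j * yv 3 \<in> rng.span ?A3" if "j \<in> ?V" for j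
    proof -
      have "det2 3 j \<in> ?M" unfolding minors_def using V(3) that by blast
      then show ?thesis by (intro rng.span_base) (simp add: det2_def)
    qed
    have "rs4 \<in> rng.span ?B3"
      unfolding rs4_def by (intro rng.span_add[of ?x2] y_span V) (auto intro: rng.span_base)
    then show "?A3 \<subseteq> rng.span ?B3"
      using minors_span_y[of ?V "{rs1, ?x2}"] y1_span[of "{rs1, ?x2}"] rs2_span[of "{rs1, ?x2}"]
      by (auto intro: rng.span_base)
    show "?B3 \<subseteq> yv ` ?V \<union> rng.span ?A3" by (auto intro: rng.span_base)
    let ?B = "yv ` ?V \<union> {?x2} :: 'k bpoly set"
    have x2c: "?x2 \<in> carrier (poly_ring (- {X 3}))" "?x2 \<in> carrier (poly_ring (- {X 1}))"
        "?x2 \<in> carrier (poly_ring (- {X n}))"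
      using assms by (intro poly_ring_closed; simp)+
    \<comment> \<open>X 3 also occurs in \<open>rs1\<close>, so x_3 is tested before
      \<open>rs1\<close> is added and the two are exchanged.\<close>
    have "nzd (rng.span ?B) (xv 3)" using x2c by (intro nzd_pvar) auto
    moreover have "nzd (rng.span (insert (xv 3) ?B)) rs1"
      using x2c by (intro nzd_rs1[where v = "X 1"]) auto
    moreover have r1: "nzd (rng.span ?B) rs1" using x2c by (intro nzd_rs1[where v = "X 1"]) auto
    ultimately have "wreg (rng.span ?B) [rs1, xv 3]"
      by (intro wreg_swap[OF rng.subspace_span _ r1]) simp
    moreover have "insert rs1 ?B = ?B3" by auto
    ultimately show "nzd (rng.span ?B3) (xv 3)" by simp
    have "nzd (rng.span ?B3) (rs3 n)" using assms x2c by (intro nzd_rs3[where v = "X n"]) auto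
    then show "wreg (rng.span ?B3) ([] @ [rs3 n])" by simp
    show "wreg (rng.span ?A3') ([] @ [rs3 n])" using n5 by simp
  qed simp
  with n4 have "wreg (rng.span ?A2') [rs4, rs3 n]" by simp
  then have "wreg (rng.span ?A2') [rs3 n, rs4]" by (rule wreg_swap[OF rng.subspace_span _ n3])
  then have w2: "wreg (rng.span ?A2') ([rs3 n] @ [rs4])" unfolding append.simps .
  have "wreg (rng.span ?A2) ([rs3 n] @ [rs4])"
  proof (rule wreg_column_y[OF _ _ _ _ _ _ _ w2, where V = ?V and ?y1.0 = "rs2" and B = ?B2])
    show "rs2 \<in> rng.span ?A2" by (intro rng.span_base) auto
    show "?x2 * yv j - xv j * rs2 \<in> rng.span ?A2" if "j \<in> ?V" for j
      unfolding rs2_def using V that by (intro det2_add_col[of _ ?V]) auto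
    show "?A2 \<subseteq> rng.span ?B2"
      using minors_span_y[of ?V "{rs1}"] y1_span[of "{rs1}"] rs2_span[of "{rs1}"]
      by (auto intro: rng.span_base)
    show "?B2 \<subseteq> yv ` ?V \<union> rng.span ?A2" by (auto intro: rng.span_base)
    show "nzd (rng.span ?B2) ?x2"
      by (rule nzd_freshI[where v = "X 2" and g = "xv 4"]) auto
    have "nzd (rng.span ?B2) (rs3 n)" using assms by (intro nzd_rs3[where v = "X n"]) auto
    moreover have "nzd (rng.span (insert (rs3 n) ?B2)) rs4"
      using assms by (intro nzd_rs4[where v = "X 4"]) auto
    ultimately show "wreg (rng.span ?B2) ([rs3 n] @ [rs4])" by simp
    have "?x2 \<in> carrier (poly_ring (- {X n}))" using assms by (intro poly_ring_closed) auto
    then have "nzd (rng.span (insert ?x2 ?B2)) (rs3 n)"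
      using assms by (intro nzd_rs3[where v = "X n"]) auto
    then show "wreg (rng.span (insert ?x2 ?B2)) [rs3 n]" by simp
  qed
  with n2 have w1: "wreg (rng.span ?A1') ([rs2, rs3 n] @ [rs4])" by simp
  have "wreg (rng.span ?A1) ([rs2, rs3 n] @ [rs4])"
  proof (rule wreg_column_x[OF _ _ _ _ _ _ _ w1, where V = ?V and ?x1.0 = "rs1" and B = ?B1])
    show "rs1 \<in> rng.span ?A1" by (intro rng.span_base) auto
    show "rs1 * yv j - xv j * ?y1 \<in> rng.span ?A1" if "j \<in> ?V" for j
      unfolding rs1_def using V that by (intro det2_add_col[of _ ?V]) auto
    have "rs1 \<in> rng.span ?B1"
      unfolding rs1_def using V by (intro rng.span_add rng.span_base; blast)
    then show "?A1 \<subseteq> rng.span ?B1" using minors_span_x[of ?V "{}"] by auto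
    show "?B1 \<subseteq> xv ` ?V \<union> rng.span ?A1" by auto
    show "nzd (rng.span ?B1) ?y1"
      by (rule nzd_freshI[where v = "Y 1" and g = "yv 3"]) auto
    have "nzd (rng.span ?B1) rs2" by (rule nzd_rs2[where v = "Y 2"]) auto
    moreover have "nzd (rng.span (insert rs2 ?B1)) (rs3 n)"
      using assms by (intro nzd_rs3[where v = "Y 1"]) auto
    moreover have "nzd (rng.span (insert (rs3 n) (insert rs2 ?B1))) rs4"
      using assms by (intro nzd_rs4[where v = "Y 3"]) auto
    ultimately show "wreg (rng.span ?B1) ([rs2, rs3 n] @ [rs4])" by simp
    have c: "?y1 \<in> carrier (poly_ring (- {Y 2}))" "?y1 \<in> carrier (poly_ring (- {Y n}))"
      using assms by (intro poly_ring_closed; simp)+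
    have "nzd (rng.span (insert ?y1 ?B1)) rs2" using c by (intro nzd_rs2[where v = "Y 2"]) auto
    moreover have "nzd (rng.span (insert rs2 (insert ?y1 ?B1))) (rs3 n)"
      using assms c by (intro nzd_rs3[where v = "Y n"]) auto
    ultimately show "wreg (rng.span (insert ?y1 ?B1)) [rs2, rs3 n]" by simp
  qed
  with n1 show ?thesis by simp
qed


section \<open>The graph and its binomial edge ideal\<close>

text \<open>
  Vertices \<open>1\<close> and \<open>2\<close> are joined to everything except each other. The remaining vertices carry
  isolated points \<open>3, \<dots>, e\<close> and a clique on \<open>e + 1, \<dots>, n\<close>.
\<close>

definition join_edges :: "nat \<Rightarrow> nat \<Rightarrow> nat set set" where
  "join_edges n e = {{i, j} | i j. i < j \<and> (i \<in> {1, 2} \<and> j \<in> {3..n} \<or> i \<in> {Suc e..n} \<and> j \<in> {Suc e..n})}"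

definition edge_minors :: "nat \<Rightarrow> nat \<Rightarrow> ('k::field) bpoly set" where
  "edge_minors n e = {det2 i j | i j. i < j \<and> (i \<in> {1, 2} \<and> j \<in> {3..n} \<or> i \<in> {Suc e..n} \<and> j \<in> {Suc e..n})}"

lemma minors_mono: "A \<subseteq> B \<Longrightarrow> minors A \<subseteq> minors B"
  unfolding minors_def by blast

lemma det2_swap: "det2 j i = - det2 i j"
  by (simp add: det2_def)

lemma span_det2_swap: "det2 i j \<in> rng.span A \<Longrightarrow> det2 j i \<in> rng.span A"
  using rng.span_neg[of "det2 i j" A] by (simp add: det2_swap[of j i])

lemma det2_edge_minors:
  assumes "i \<in> {1, 2} \<and> j \<in> {3..n} \<or> j \<in> {1, 2} \<and> i \<in> {3..n} \<or> i \<in> {Suc e..n} \<and> j \<in> {Suc e..n}"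
  shows "det2 i j \<in> rng.span (edge_minors n e)"
proof (cases i j rule: linorder_cases)
  case less
  then have "det2 i j \<in> edge_minors n e" using assms by (auto simp: edge_minors_def)
  then show ?thesis by (rule rng.span_base)
next
  case greater
  then have "det2 j i \<in> edge_minors n e" using assms by (auto simp: edge_minors_def)
  then show ?thesis by (intro span_det2_swap[of j i] rng.span_base)
qed (simp add: rng.span_zero)

lemma edge_minors_subset_minors: "2 \<le> n \<Longrightarrow> 2 \<le> e \<Longrightarrow> edge_minors n e \<subseteq> minors {1..n}"
  by (force simp: edge_minors_def minors_def)

lemma edge_minors_subset_Q2:
  "2 \<le> e \<Longrightarrow> edge_minors n e \<subseteq> (rng.span (cols {3..n}) :: ('k::field) bpoly set)"
proof
  fix p :: "'k bpoly" assume "2 \<le> e" "p \<in> edge_minors n e"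
  then obtain i j where p: "p = det2 i j" "j \<in> {3..n}" by (auto simp: edge_minors_def)
  then have "xv j \<in> rng.span (cols {3..n})" "yv j \<in> rng.span (cols {3..n})"
    by (auto simp: cols_def intro: rng.span_base)
  then show "p \<in> rng.span (cols {3..n})"
    unfolding p det2_def by (intro rng.span_diff span_multL span_multR[of "xv j"])
qed

lemma edge_minors_subset_Q3:
  "2 \<le> e \<Longrightarrow> insert (det2 1 2) (edge_minors n e) \<subseteq>
     (rng.span (minors {Suc e..n} \<union> cols {1, 2}) :: ('k::field) bpoly set)" (is "_ \<Longrightarrow> _ \<subseteq> rng.span ?Q")
proof
  fix p :: "'k bpoly" assume "2 \<le> e" "p \<in> insert (det2 1 2) (edge_minors n e)"
  then consider i j where "p = det2 i j" "i \<in> {1, 2}" | "p \<in> minors {Suc e..n}"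
    unfolding edge_minors_def minors_def by blast
  then show "p \<in> rng.span ?Q"
  proof cases
    case 1
    then have "xv i \<in> rng.span ?Q" "yv i \<in> rng.span ?Q"
      by (auto simp: cols_def intro: rng.span_base)
    then show ?thesis
      unfolding 1 det2_def by (intro rng.span_diff span_multL[of "yv i"] span_multR[of "xv i"])
  qed (simp add: rng.span_base)
qed

lemma nzd_det2: "nzd (rng.span (cols {3..n})) (det2 1 2 :: ('k::field) bpoly)"
proof (rule rprime_nzd)
  show "rprime (rng.span (cols {3..n} :: 'k bpoly set))"
    by (rule rprime_columns[of "{}" "\<lambda>i. if i \<in> {3..n} then 0 else 1" "\<lambda>i. i"])
      (auto simp: cols_def minors_def intro: rng.span_base)
  \<comment> \<open>Columns 1 and 2 are sent to the unit vectors: the minor is to be nonzero, so a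
    point of rank two is required and \<open>rank1_point\<close> does not apply.\<close>
  have "psub (\<lambda>v. if v \<in> {X 1, Y 2} then 1 else 0) p = 0"
    if "p \<in> rng.span (cols {3..n})" for p :: "'k bpoly"
    using that by (induction p rule: rng.span_induct_alt) (auto simp: cols_def)
  from this[of "det2 1 2"] show "det2 1 2 \<notin> (rng.span (cols {3..n}) :: 'k bpoly set)"
    by (auto simp: det2_def)
qed

text \<open>Each h >= 3 is adjacent to both 1 and 2, and [1 2] * x_h = x_2 * [1 h] - x_1 * [2 h],
  likewise for y_h. Thus [1 2] multiplies Q2 into the ideal of the graph, and
  \<open>span_split\<close> applies.\<close>

lemma span_edge_minors_split:
  fixes n e :: nat
  assumes "2 \<le> e"
  shows "rng.span (edge_minors n e) =
    rng.span (cols {3..n}) \<inter> (rng.span (insert (det2 1 2) (edge_minors n e)) :: ('k::field) bpoly set)"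
proof (rule span_split)
  show "edge_minors n e \<subseteq> rng.span (cols {3..n})" using assms by (rule edge_minors_subset_Q2)
  show "nzd (rng.span (cols {3..n})) (det2 1 2 :: 'k bpoly)" by (rule nzd_det2)
next
  fix b :: "'k bpoly" assume "b \<in> cols {3..n}"
  then obtain h where h: "h \<in> {3..n}" "b = xv h \<or> b = yv h" by (auto simp: cols_def)
  have d: "det2 1 h \<in> rng.span (edge_minors n e)" "det2 2 h \<in> rng.span (edge_minors n e)"
    using h by (auto intro!: det2_edge_minors)
  have "det2 1 2 * xv h = xv 2 * det2 1 h - xv 1 * det2 2 h"
    "det2 1 2 * yv h = yv 2 * det2 1 h - (yv 1 * det2 2 h :: 'k bpoly)"
    by (simp_all add: det2_def algebra_simps)
  then show "det2 1 2 * b \<in> rng.span (edge_minors n e)"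
    using h(2) d rng.span_diff[OF span_multL span_multL] by metis
qed

lemma diff_restrict_vars_in_span:
  fixes p :: "('v, 'k::field) mpoly"
  shows "p - restrict_vars U p \<in> rng.span (pvar ` (- U))"
proof (induction p rule: mpoly_induct)
  case (mult p q)
  have "p * q - restrict_vars U (p * q) = p * (q - restrict_vars U q) + restrict_vars U q * (p - restrict_vars U p)"
    by (simp add: algebra_simps)
  then show ?case using mult by (simp add: rng.span_add span_multL)
next
  case (add p q)
  have "p + q - restrict_vars U (p + q) = (p - restrict_vars U p) + (q - restrict_vars U q)" by simp
  then show ?case using add by (metis rng.span_add)
qed (auto intro: rng.span_base simp: rng.span_zero)

text \<open>Modulo J' the ideal Q1 is generated by the minors of columns 3, ..., n. An element r of
  that part which also lies in Q3 is congruent modulo J' to its restriction to the columns other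
  than 1 and 2, and restricting an element of Q3 leaves a combination of clique minors, which lies
  in J'.\<close>

lemma span_edge_minors_Int:
  fixes n e :: nat
  assumes e: "2 \<le> e" "e \<le> n"
  shows "(rng.span (insert (det2 1 2) (edge_minors n e)) :: ('k::field) bpoly set) =
    rng.span (minors {1..n}) \<inter> rng.span (minors {Suc e..n} \<union> cols {1, 2})" (is "rng.span ?J = rng.span ?Q1 \<inter> rng.span ?Q3")
proof
  have "det2 1 2 \<in> ?Q1" unfolding minors_def using e by force
  then have JQ1: "?J \<subseteq> ?Q1" using edge_minors_subset_minors[of n e] e by auto
  then have "rng.span ?J \<subseteq> rng.span ?Q1" by (rule rng.span_mono)
  moreover have JQ3: "rng.span ?J \<subseteq> rng.span ?Q3"
    using edge_minors_subset_Q3[OF e(1)] by (rule rng.span_minimal) simp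
  ultimately show "rng.span ?J \<subseteq> rng.span ?Q1 \<inter> rng.span ?Q3" by blast
  let ?H = "minors {3..n} :: 'k bpoly set"
  let ?U = "- {X 1, Y 1, X 2, Y 2}"
  have mono: "rng.span (edge_minors n e) \<subseteq> rng.span ?J" by (intro rng.span_mono) auto
  have Q1: "?Q1 \<subseteq> rng.span (?J \<union> ?H)"
  proof
    fix p assume "p \<in> ?Q1"
    then obtain i j where p: "p = det2 i j" "i \<in> {1..n}" "j \<in> {1..n}" by (auto simp: minors_def)
    have "det2 1 2 \<in> rng.span ?J" by (intro rng.span_base) auto
    moreover from this have "det2 2 1 \<in> rng.span ?J" by (rule span_det2_swap)
    moreover have "i = 1 \<or> i = 2 \<or> i \<in> {3..n}" "j = 1 \<or> j = 2 \<or> j \<in> {3..n}" using p by auto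
    ultimately have "p \<in> rng.span ?J \<or> p \<in> ?H"
      using subsetD[OF mono det2_edge_minors[of i j n e]] unfolding p
      by (auto simp: minors_def rng.span_zero)
    then show "p \<in> rng.span (?J \<union> ?H)"
      using rng.span_mono[of ?J "?J \<union> ?H"] by (auto intro: rng.span_base)
  qed
  \<comment> \<open>Deleting columns 1 and 2 from a coefficient changes it by a multiple of x_a or
    y_a with a in {1, 2}, and x_a * [i j] = x_i * [a j] - x_j * [a i] is in J'.\<close>
  have r: "r - restrict_vars ?U r \<in> rng.span ?J" if "r \<in> rng.span ?H" for r
    using that
  proof (induction r rule: rng.span_induct_alt)
    case (step c x y)
    then obtain i j where x: "x = det2 i j" "i \<in> {3..n}" "j \<in> {3..n}" by (auto simp: minors_def)
    then have "restrict_vars ?U x = x" by (auto simp: det2_def)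
    then have "c * x + y - restrict_vars ?U (c * x + y)
        = (c - restrict_vars ?U c) * x + (y - restrict_vars ?U y)" by (simp add: algebra_simps)
    moreover have "q * x \<in> rng.span ?J" if "q \<in> rng.span (pvar ` (- ?U))" for q
      using that
    proof (induction q rule: rng.span_induct_alt)
      case (step c' v z)
      then obtain a where a: "a \<in> {1, 2}" "v = xv a \<or> v = yv a" by auto
      have d: "det2 a i \<in> rng.span ?J" "det2 a j \<in> rng.span ?J"
        by (rule subsetD[OF mono], rule det2_edge_minors, use a x in blast)+
      have "xv a * x = xv i * det2 a j - xv j * det2 a i"
        "yv a * x = yv i * det2 a j - yv j * det2 a i"
        by (simp_all add: x det2_def algebra_simps)
      then have "v * x \<in> rng.span ?J"
        using a(2) d rng.span_diff[OF span_multL span_multL] by metis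
      then have "c' * (v * x) + z * x \<in> rng.span ?J"
        using step.IH by (metis rng.span_add span_multL)
      then show ?case by (simp add: algebra_simps)
    qed (simp add: rng.span_zero)
    ultimately show ?case
      using rng.span_add[OF _ step.IH] diff_restrict_vars_in_span[of c ?U] by metis
  qed (simp add: rng.span_zero)
  have Q3: "restrict_vars ?U q \<in> rng.span ?J" if "q \<in> rng.span ?Q3" for q
    using that
  proof (induction q rule: rng.span_induct_alt)
    case (step c x y)
    have "restrict_vars ?U x \<in> rng.span ?J"
    proof (cases "x \<in> minors {Suc e..n}")
      case True
      then obtain i j where x: "x = det2 i j" "i \<in> {Suc e..n}" "j \<in> {Suc e..n}"
        by (auto simp: minors_def)
      then have "restrict_vars ?U x = x" using e by (auto simp: det2_def)
      then show ?thesis using subsetD[OF mono det2_edge_minors[of i j n e]] x by simp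
    qed (use step in \<open>auto simp: cols_def rng.span_zero\<close>)
    then show ?case using step.IH by (simp add: rng.span_add span_multL)
  qed (simp add: rng.span_zero)
  show "rng.span ?Q1 \<inter> rng.span ?Q3 \<subseteq> rng.span ?J"
  proof
    fix p assume p: "p \<in> rng.span ?Q1 \<inter> rng.span ?Q3"
    then have "p \<in> rng.span (?J \<union> ?H)"
      using Q1 rng.span_minimal[OF _ rng.subspace_span] by blast
    then obtain q r where qr: "p = q + r" "q \<in> rng.span ?J" "r \<in> rng.span ?H"
      unfolding rng.span_Un by blast
    have "r \<in> rng.span ?Q3" using rng.span_diff[of p ?Q3 q] qr p JQ3 by auto
    then have "q + ((r - restrict_vars ?U r) + restrict_vars ?U r) \<in> rng.span ?J"
      by (intro rng.span_add qr(2) r Q3 qr(3))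
    then show "p \<in> rng.span ?J" by (simp add: qr(1))
  qed
qed

lemma wreg_edge_minors:
  assumes e: "4 \<le> e" "e < n"
  shows "wreg (rng.span (edge_minors n e :: ('k::field) bpoly set)) [rs1, rs2, rs3 n, rs4]"
proof -
  let ?J = "edge_minors n e :: 'k bpoly set"
  let ?J' = "insert (det2 1 2) ?J"
  let ?Q1 = "minors {1..n} :: 'k bpoly set" and ?Q2 = "cols {3..n} :: 'k bpoly set"
    and ?Q3 = "minors {Suc e..n} \<union> cols {1, 2} :: 'k bpoly set"
  have "rng.span (?Q1 \<union> ?Q3) = rng.span (minors {3..n} \<union> cols {1, 2})"
  proof (rule span_eqI)
    show "minors {3..n} \<union> cols {1, 2} \<subseteq> rng.span (?Q1 \<union> ?Q3)"
      using minors_mono[of "{3..n}" "{1..n}"] by (auto intro!: rng.span_base)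
    have "det2 i j \<in> rng.span (minors {3..n} \<union> cols {1, 2} :: 'k bpoly set)"
      if ij: "i \<in> {1..n}" "j \<in> {1..n}" for i j
    proof -
      consider "i \<in> {1, 2}" | "j \<in> {1, 2}" | "i \<in> {3..n}" "j \<in> {3..n}" using ij by force
      then show ?thesis
      proof cases
        case 1
        then have "xv i \<in> rng.span (minors {3..n} \<union> cols {1, 2} :: 'k bpoly set)"
          "yv i \<in> rng.span (minors {3..n} \<union> cols {1, 2} :: 'k bpoly set)"
          by (auto simp: cols_def intro: rng.span_base)
        then show ?thesis
          unfolding det2_def by (intro rng.span_diff span_multL[of "yv i"] span_multR[of "xv i"])
      next
        case 2
        then have "xv j \<in> rng.span (minors {3..n} \<union> cols {1, 2} :: 'k bpoly set)"
          "yv j \<in> rng.span (minors {3..n} \<union> cols {1, 2} :: 'k bpoly set)"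
          by (auto simp: cols_def intro: rng.span_base)
        then show ?thesis
          unfolding det2_def by (intro rng.span_diff span_multL[of "yv j"] span_multR[of "xv j"])
      next
        case 3
        then have "det2 i j \<in> minors {3..n}" unfolding minors_def by blast
        then show ?thesis by (intro rng.span_base) auto
      qed
    qed
    moreover have "minors {Suc e..n} \<subseteq> ?Q1" by (rule minors_mono) auto
    moreover have "p \<in> rng.span (minors {3..n} \<union> cols {1, 2})" if "p \<in> ?Q1" for p
      using that calculation(1) unfolding minors_def by blast
    ultimately have "?Q1 \<subseteq> rng.span (minors {3..n} \<union> cols {1, 2})"
      "minors {Suc e..n} \<subseteq> rng.span (minors {3..n} \<union> cols {1, 2} :: 'k bpoly set)"
      by blast+
    then show "?Q1 \<union> ?Q3 \<subseteq> rng.span (minors {3..n} \<union> cols {1, 2})"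
      by (auto intro: rng.span_base)
  qed
  then have "wreg {x + y | x y. x \<in> rng.span ?Q1 \<and> y \<in> rng.span ?Q3} [rs1, rs2, rs3 n]"
    using wreg_Q1_Q3[of n] e unfolding rng.span_Un[symmetric] by simp
  then have "wreg (rng.span ?Q1 \<inter> rng.span ?Q3) ([rs1, rs2, rs3 n] @ [rs4])"
    using e wreg_Q1[of n] wreg_Q3[of e n] by (intro wreg_Int) auto
  then have J': "wreg (rng.span ?J') ([rs1, rs2, rs3 n] @ [rs4])"
    using e by (subst span_edge_minors_Int) auto
  have "rng.span (?Q2 \<union> ?J') = rng.span (minors {1, 2} \<union> ?Q2)"
  proof (rule span_eqI)
    have "det2 1 2 \<in> rng.span (?Q2 \<union> ?J')" by (intro rng.span_base) auto
    moreover from this have "det2 2 1 \<in> rng.span (?Q2 \<union> ?J')" by (rule span_det2_swap)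
    ultimately show "minors {1, 2} \<union> ?Q2 \<subseteq> rng.span (?Q2 \<union> ?J')"
      by (auto simp: minors_def rng.span_zero intro: rng.span_base)
    have "det2 1 2 \<in> (minors {1, 2} :: 'k bpoly set)" unfolding minors_def by blast
    moreover have "?J \<subseteq> rng.span (minors {1, 2} \<union> ?Q2)"
      using edge_minors_subset_Q2[of e n] rng.span_mono[of ?Q2 "minors {1, 2} \<union> ?Q2"] e by auto
    ultimately show "?Q2 \<union> ?J' \<subseteq> rng.span (minors {1, 2} \<union> ?Q2)"
      by (auto intro: rng.span_base)
  qed
  then have "wreg {x + y | x y. x \<in> rng.span ?Q2 \<and> y \<in> rng.span ?J'} [rs1, rs2, rs3 n]"
    using wreg_Q2_det[of n] e unfolding rng.span_Un[symmetric] by simp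
  then have "wreg (rng.span ?Q2 \<inter> rng.span ?J') ([rs1, rs2, rs3 n] @ [rs4])"
    using e wreg_Q2[of n] J' by (intro wreg_Int) auto
  moreover have "rng.span ?J = rng.span ?Q2 \<inter> rng.span ?J'"
    using e by (intro span_edge_minors_split) auto
  ultimately show ?thesis by simp
qed

section \<open>Ideals of the polynomial ring in finitely many variables\<close>

lemma poly_ring_ideal_iff:
  fixes I :: "('v, 'k::field) mpoly set"
  shows "ideal I (poly_ring V) \<longleftrightarrow> I \<subseteq> carrier (poly_ring V) \<and> 0 \<in> I \<and>
    (\<forall>p\<in>I. \<forall>q\<in>I. p + q \<in> I) \<and> (\<forall>r\<in>carrier (poly_ring V). \<forall>p\<in>I. r * p \<in> I)"
proof -
  interpret cring "poly_ring V :: ('v, 'k) mpoly ring" by (rule cring_poly_ring)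
  show ?thesis
  proof (intro iffI conjI)
    assume I: "ideal I (poly_ring V)"
    then interpret I: ideal I "poly_ring V" .
    show "I \<subseteq> carrier (poly_ring V)" using I.Icarr by blast
    show "0 \<in> I" using I.zero_closed by simp
    show "\<forall>p\<in>I. \<forall>q\<in>I. p + q \<in> I" using I.a_closed by simp
    show "\<forall>r\<in>carrier (poly_ring V). \<forall>p\<in>I. r * p \<in> I" using I.I_l_closed by simp
  next
    assume I: "I \<subseteq> carrier (poly_ring V) \<and> 0 \<in> I \<and> (\<forall>p\<in>I. \<forall>q\<in>I. p + q \<in> I) \<and>
      (\<forall>r\<in>carrier (poly_ring V). \<forall>p\<in>I. r * p \<in> I)"
    have "subgroup I (add_monoid (poly_ring V))"
    proof (rule group.subgroupI)
      show "Group.group (add_monoid (poly_ring V :: ('v, 'k) mpoly ring))" by (rule a_group)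
      show "I \<noteq> {}" using I by blast
      fix p assume p: "p \<in> I"
      have "\<ominus>\<^bsub>poly_ring V\<^esub> p = - 1 * p"
        using p I minus_equality[of "- p" p] by (auto simp: uminus_in_poly_ring)
      also have "\<dots> \<in> I" using I p uminus_in_poly_ring[OF one_in_poly_ring] by blast
      finally show "inv\<^bsub>add_monoid (poly_ring V)\<^esub> p \<in> I" by (simp add: a_inv_def)
    qed (use I in auto)
    moreover have "p * r \<in> I" if "p \<in> I" "r \<in> carrier (poly_ring V)" for p r
      using I that by (simp add: mult.commute[of p])
    ultimately show "ideal I (poly_ring V)"
      using I by (intro idealI ring_axioms) simp_all
  qed
qed

lemma poly_ring_primeideal_iff:
  fixes P :: "('v, 'k::field) mpoly set"
  shows "primeideal P (poly_ring V) \<longleftrightarrow> ideal P (poly_ring V) \<and> 1 \<notin> P \<and>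
    (\<forall>p\<in>carrier (poly_ring V). \<forall>q\<in>carrier (poly_ring V). p * q \<in> P \<longrightarrow> p \<in> P \<or> q \<in> P)"
proof -
  interpret cring "poly_ring V :: ('v, 'k) mpoly ring" by (rule cring_poly_ring)
  show ?thesis
  proof
    assume "primeideal P (poly_ring V)"
    then interpret P: primeideal P "poly_ring V" .
    have "1 \<notin> P" using P.I_notcarr P.one_imp_carrier by auto
    then show "ideal P (poly_ring V) \<and> 1 \<notin> P \<and>
      (\<forall>p\<in>carrier (poly_ring V). \<forall>q\<in>carrier (poly_ring V). p * q \<in> P \<longrightarrow> p \<in> P \<or> q \<in> P)"
      using P.I_prime P.ideal_axioms by simp
  next
    assume P: "ideal P (poly_ring V) \<and> 1 \<notin> P \<and>
      (\<forall>p\<in>carrier (poly_ring V). \<forall>q\<in>carrier (poly_ring V). p * q \<in> P \<longrightarrow> p \<in> P \<or> q \<in> P)"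
    then show "primeideal P (poly_ring V)"
      by (intro primeidealI cring_poly_ring) (auto simp: one_in_poly_ring)
  qed
qed

lemma restrict_vars_span:
  assumes "A \<subseteq> carrier (poly_ring V)" "p \<in> rng.span A"
  shows "restrict_vars V p \<in> rng.span A"
  using assms(2)
proof (induction p rule: rng.span_induct_alt)
  case (step c x y)
  then have "restrict_vars V x = x" using assms(1) by (intro restrict_vars_id) auto
  then show ?case using step by (simp add: rng.span_add span_multL rng.span_base)
qed (simp add: rng.span_zero)

lemma ideal_span_Int: "ideal (rng.span A \<inter> carrier (poly_ring V)) (poly_ring V :: ('v, 'k::field) mpoly ring)"
  unfolding poly_ring_ideal_iff
  by (auto simp: zero_in_poly_ring add_in_poly_ring mult_in_poly_ring
      intro: rng.span_zero rng.span_add span_multL)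

text \<open>Extending an ideal to all variables and contracting it again gives it back, because
  \<open>restrict_vars V\<close> maps the extension into I and fixes the polynomials in V.\<close>

lemma ideal_span_closed:
  fixes I :: "('v, 'k::field) mpoly set"
  assumes "ideal I (poly_ring V)"
  shows "rng.span I \<inter> carrier (poly_ring V) = I"
proof
  have I: "I \<subseteq> carrier (poly_ring V)" "0 \<in> I" "\<And>p q. p \<in> I \<Longrightarrow> q \<in> I \<Longrightarrow> p + q \<in> I"
    "\<And>r p. r \<in> carrier (poly_ring V) \<Longrightarrow> p \<in> I \<Longrightarrow> r * p \<in> I"
    using assms unfolding poly_ring_ideal_iff by auto
  have "restrict_vars V p \<in> I" if "p \<in> rng.span I" for p
    using that
  proof (induction p rule: rng.span_induct_alt)
    case (step c x y)
    then have "restrict_vars V x = x" using I(1) by (intro restrict_vars_id) auto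
    then show ?case using step I by (simp add: restrict_vars_in)
  qed (simp add: I)
  then show "rng.span I \<inter> carrier (poly_ring V) \<subseteq> I"
    using restrict_vars_id by (metis IntE subsetI)
  show "I \<subseteq> rng.span I \<inter> carrier (poly_ring V)" using I(1) by (auto intro: rng.span_base)
qed

lemma genideal_poly_ring:
  fixes A :: "('v, 'k::field) mpoly set"
  assumes "A \<subseteq> carrier (poly_ring V)"
  shows "Idl\<^bsub>poly_ring V\<^esub> A = rng.span A \<inter> carrier (poly_ring V)"
proof
  interpret cring "poly_ring V :: ('v, 'k) mpoly ring" by (rule cring_poly_ring)
  show "Idl\<^bsub>poly_ring V\<^esub> A \<subseteq> rng.span A \<inter> carrier (poly_ring V)"
    using assms by (intro genideal_minimal ideal_span_Int) (auto intro: rng.span_base)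
  have "A \<subseteq> Idl\<^bsub>poly_ring V\<^esub> A" by (rule genideal_self[OF assms])
  then have "rng.span A \<subseteq> rng.span (Idl\<^bsub>poly_ring V\<^esub> A)" by (rule rng.span_mono)
  then show "rng.span A \<inter> carrier (poly_ring V) \<subseteq> Idl\<^bsub>poly_ring V\<^esub> A"
    using ideal_span_closed[OF genideal_ideal[OF assms]] by blast
qed

text \<open>The cofactor of f can be taken in \<open>poly_ring V\<close>: apply the retraction to an
  arbitrary one.\<close>

lemma span_insert_Int:
  fixes f :: "('v, 'k::field) mpoly"
  assumes "A \<subseteq> carrier (poly_ring V)" "f \<in> carrier (poly_ring V)"
  shows "rng.span (insert f A) \<inter> carrier (poly_ring V) =
    {f * u + v | u v. u \<in> carrier (poly_ring V) \<and> v \<in> rng.span A \<inter> carrier (poly_ring V)}"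
proof
  show "rng.span (insert f A) \<inter> carrier (poly_ring V) \<subseteq>
    {f * u + v | u v. u \<in> carrier (poly_ring V) \<and> v \<in> rng.span A \<inter> carrier (poly_ring V)}"
  proof
    fix p assume p: "p \<in> rng.span (insert f A) \<inter> carrier (poly_ring V)"
    then obtain k where "p - k * f \<in> rng.span A" by (auto simp: rng.span_breakdown_eq)
    from restrict_vars_span[OF assms(1) this]
    have "p - restrict_vars V k * f \<in> rng.span A"
      using p assms(2) by (simp add: restrict_vars_id)
    moreover have "p - restrict_vars V k * f \<in> carrier (poly_ring V)"
      using p assms by (intro diff_in_poly_ring mult_in_poly_ring restrict_vars_in) auto
    moreover have "p = f * restrict_vars V k + (p - restrict_vars V k * f)" by simp
    ultimately show "p \<in> {f * u + v | u v. u \<in> carrier (poly_ring V) \<and> v \<in> rng.span A \<inter> carrier (poly_ring V)}"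
      using restrict_vars_in by blast
  qed
  show "{f * u + v | u v. u \<in> carrier (poly_ring V) \<and> v \<in> rng.span A \<inter> carrier (poly_ring V)}
    \<subseteq> rng.span (insert f A) \<inter> carrier (poly_ring V)"
  proof safe
    fix u v :: "('v, 'k) mpoly"
    assume "u \<in> carrier (poly_ring V)" "v \<in> rng.span A" "v \<in> carrier (poly_ring V)"
    then show "f * u + v \<in> carrier (poly_ring V)" using assms by (intro add_in_poly_ring mult_in_poly_ring)
    have "v \<in> rng.span (insert f A)" using \<open>v \<in> rng.span A\<close> rng.span_mono[of A "insert f A"] by auto
    then show "f * u + v \<in> rng.span (insert f A)"
      by (simp add: rng.span_add span_multR rng.span_base)
  qed
qed

section \<open>Regular sequences on a quotient of the polynomial ring\<close>

lemma quot_eq_iff: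
  fixes J :: "('v, 'k::field) mpoly set"
  assumes "ideal J (poly_ring V)" "p \<in> carrier (poly_ring V)" "q \<in> carrier (poly_ring V)"
  shows "J +>\<^bsub>poly_ring V\<^esub> p = J +>\<^bsub>poly_ring V\<^esub> q \<longleftrightarrow> p - q \<in> J"
proof -
  interpret cring "poly_ring V :: ('v, 'k) mpoly ring" by (rule cring_poly_ring)
  interpret J: ideal J "poly_ring V" by fact
  have "p \<ominus>\<^bsub>poly_ring V\<^esub> q = p - q"
  proof -
    have "\<ominus>\<^bsub>poly_ring V\<^esub> q = - q"
      using assms(3) minus_equality[of "- q" q] by (simp add: uminus_in_poly_ring)
    then show ?thesis by (simp add: a_minus_def)
  qed
  then show ?thesis
    using quotient_eq_iff_same_a_r_cos[OF assms] by simp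
qed

lemma seq_smult_quot_module:
  fixes G :: "('v, 'k::field) mpoly set"
  assumes G: "G \<subseteq> carrier (poly_ring V)" and J: "J = rng.span G \<inter> carrier (poly_ring V)"
    and fs: "set fs \<subseteq> carrier (poly_ring V)"
  shows "seq_smult (quot_module (poly_ring V) J) fs =
    (\<lambda>r. J +>\<^bsub>poly_ring V\<^esub> r) ` (rng.span (set fs \<union> G) \<inter> carrier (poly_ring V))"
proof -
  interpret cring "poly_ring V :: ('v, 'k) mpoly ring" by (rule cring_poly_ring)
  have J_ideal: "ideal J (poly_ring V)" unfolding J by (rule ideal_span_Int)
  interpret J: ideal J "poly_ring V" by fact
  interpret h: ring_hom_ring "poly_ring V" "poly_ring V Quot J" "(+>\<^bsub>poly_ring V\<^esub>) J"
    by (rule J.rcos_ring_hom_ring)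
  let ?q = "(+>\<^bsub>poly_ring V\<^esub>) J"
  show ?thesis
    using fs
  proof (induction fs)
    case Nil
    have const: "?q r = ?q 0" if "r \<in> J" for r
      using that J.Icarr[OF that] quot_eq_iff[OF J_ideal, of r 0] by (simp add: zero_in_poly_ring)
    have "0 \<in> J" using J.zero_closed by simp
    have "?q ` J = (\<lambda>_. ?q 0) ` J" by (intro image_cong refl const)
    also have "\<dots> = {?q 0}" by (rule image_constant[OF \<open>0 \<in> J\<close>])
    finally have "?q ` J = {?q 0}" .
    moreover have "?q 0 = \<zero>\<^bsub>poly_ring V Quot J\<^esub>" using h.hom_zero by simp
    ultimately show ?case by (simp flip: J)
  next
    case (Cons f fs)
    have sub: "set fs \<union> G \<subseteq> carrier (poly_ring V)" and f: "f \<in> carrier (poly_ring V)"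
      using Cons.prems G by auto
    have IH: "seq_smult (quot_module (poly_ring V) J) fs = ?q ` (rng.span (set fs \<union> G) \<inter> carrier (poly_ring V))"
      using Cons by simp
    have hom: "?q f \<otimes>\<^bsub>poly_ring V Quot J\<^esub> ?q u \<oplus>\<^bsub>poly_ring V Quot J\<^esub> ?q v = ?q (f * u + v)"
      if "u \<in> carrier (poly_ring V)" "v \<in> carrier (poly_ring V)" for u v
      using f that h.hom_mult[of f u] h.hom_add[of "f * u" v] by (simp add: mult_in_poly_ring)
    have "carrier (poly_ring V Quot J) = ?q ` carrier (poly_ring V)"
      by (auto simp: FactRing_def A_RCOSETS_def')
    then have "seq_smult (quot_module (poly_ring V) J) (f # fs) =
      {?q f \<otimes>\<^bsub>poly_ring V Quot J\<^esub> ?q u \<oplus>\<^bsub>poly_ring V Quot J\<^esub> ?q v | u v.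
         u \<in> carrier (poly_ring V) \<and> v \<in> rng.span (set fs \<union> G) \<inter> carrier (poly_ring V)}"
      by (simp add: IH) blast
    also have "\<dots> = {?q (f * u + v) | u v.
         u \<in> carrier (poly_ring V) \<and> v \<in> rng.span (set fs \<union> G) \<inter> carrier (poly_ring V)}"
      using hom by (intro Collect_cong) (metis IntD2)
    also have "\<dots> = ?q ` (rng.span (set (f # fs) \<union> G) \<inter> carrier (poly_ring V))"
      using span_insert_Int[OF sub f] by auto
    finally show ?case .
  qed
qed

text \<open>Removes the cosets: regularity on the quotient module becomes ideal membership in the
  ring of all variables, where \<open>wreg\<close> is stated.\<close>

lemma regular_seq_quot_module:
  fixes G :: "('v, 'k::field) mpoly set"
  assumes G: "G \<subseteq> carrier (poly_ring V)" and J: "J = rng.span G \<inter> carrier (poly_ring V)"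
    and fs: "set fs \<subseteq> carrier (poly_ring V)"
  shows "regular_seq (quot_module (poly_ring V) J) fs \<longleftrightarrow>
    1 \<notin> rng.span (set fs \<union> G) \<and>
    (\<forall>i<length fs. \<forall>u\<in>carrier (poly_ring V).
       fs ! i * u \<in> rng.span (set (take i fs) \<union> G) \<longrightarrow> u \<in> rng.span (set (take i fs) \<union> G))"
proof -
  interpret cring "poly_ring V :: ('v, 'k) mpoly ring" by (rule cring_poly_ring)
  have J_ideal: "ideal J (poly_ring V)" unfolding J by (rule ideal_span_Int)
  interpret J: ideal J "poly_ring V" by fact
  interpret h: ring_hom_ring "poly_ring V" "poly_ring V Quot J" "(+>\<^bsub>poly_ring V\<^esub>) J"
    by (rule J.rcos_ring_hom_ring)
  let ?q = "(+>\<^bsub>poly_ring V\<^esub>) J"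
  have car: "carrier (poly_ring V Quot J) = ?q ` carrier (poly_ring V)"
    by (auto simp: FactRing_def A_RCOSETS_def')
  have mem: "?q r \<in> seq_smult (quot_module (poly_ring V) J) gs \<longleftrightarrow> r \<in> rng.span (set gs \<union> G)"
    if gs: "set gs \<subseteq> carrier (poly_ring V)" and r: "r \<in> carrier (poly_ring V)" for r gs
  proof -
    have "r \<in> rng.span (set gs \<union> G)"
      if "r' \<in> rng.span (set gs \<union> G)" "r' \<in> carrier (poly_ring V)" "?q r = ?q r'" for r'
    proof -
      have "r - r' \<in> rng.span G" using that r quot_eq_iff[OF J_ideal] by (auto simp: J)
      then have "r - r' \<in> rng.span (set gs \<union> G)" using rng.span_mono[of G "set gs \<union> G"] by auto
      then have "(r - r') + r' \<in> rng.span (set gs \<union> G)" using that(1) by (rule rng.span_add)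
      then show ?thesis by simp
    qed
    then show ?thesis using r by (auto simp: seq_smult_quot_module[OF G J gs])
  qed
  have "seq_smult (quot_module (poly_ring V) J) fs = carrier (poly_ring V Quot J)
    \<longleftrightarrow> 1 \<in> rng.span (set fs \<union> G)"
  proof
    assume "seq_smult (quot_module (poly_ring V) J) fs = carrier (poly_ring V Quot J)"
    then have "?q 1 \<in> seq_smult (quot_module (poly_ring V) J) fs" by (simp add: car one_in_poly_ring)
    then show "1 \<in> rng.span (set fs \<union> G)" using mem[OF fs one_in_poly_ring] by simp
  next
    assume "1 \<in> rng.span (set fs \<union> G)"
    then have "r \<in> rng.span (set fs \<union> G)" for r using span_multL[of 1 _ r] by simp
    then show "seq_smult (quot_module (poly_ring V) J) fs = carrier (poly_ring V Quot J)"
      by (auto simp: seq_smult_quot_module[OF G J fs] car)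
  qed
  moreover have "(\<forall>u\<in>carrier (quot_module (poly_ring V) J).
        fs ! i \<odot>\<^bsub>quot_module (poly_ring V) J\<^esub> u \<in> seq_smult (quot_module (poly_ring V) J) (take i fs)
          \<longrightarrow> u \<in> seq_smult (quot_module (poly_ring V) J) (take i fs)) \<longleftrightarrow>
     (\<forall>u\<in>carrier (poly_ring V).
       fs ! i * u \<in> rng.span (set (take i fs) \<union> G) \<longrightarrow> u \<in> rng.span (set (take i fs) \<union> G))"
    if "i < length fs" for i
  proof -
    have i: "set (take i fs) \<subseteq> carrier (poly_ring V)" "fs ! i \<in> carrier (poly_ring V)"
      using fs that by (auto dest: in_set_takeD)
    have "?q (fs ! i) \<otimes>\<^bsub>poly_ring V Quot J\<^esub> ?q u = ?q (fs ! i * u)" if "u \<in> carrier (poly_ring V)" for u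
      using that i(2) h.hom_mult[of "fs ! i" u] by simp
    then show ?thesis
      using i by (simp add: car mem mult_in_poly_ring)
  qed
  ultimately show ?thesis
    unfolding regular_seq_def by auto
qed

lemma wreg_nth:
  "wreg (rng.span G) fs \<Longrightarrow> i < length fs \<Longrightarrow> nzd (rng.span (set (take i fs) \<union> G)) (fs ! i)"
proof (induction fs arbitrary: G i)
  case (Cons f fs)
  show ?case
  proof (cases i)
    case (Suc j)
    then show ?thesis using Cons.IH[of "insert f G" j] Cons.prems by simp
  qed (use Cons.prems in simp)
qed simp

section \<open>Algebraic independence along chains of ideals\<close>

fun power_prod :: "'a::comm_monoid_mult list \<Rightarrow> nat list \<Rightarrow> 'a" where
  "power_prod [] as = 1"
| "power_prod (z # zs) as = z ^ hd as * power_prod zs (tl as)"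

lemma power_prod_in_poly_ring:
  "set zs \<subseteq> carrier (poly_ring V) \<Longrightarrow> power_prod zs as \<in> carrier (poly_ring V)"
  by (induction zs arbitrary: as) (auto intro!: poly_ring_closed)

text \<open>The cancellation argument in the form common to depth and dimension. Take out the least
  power of the first member z and cancel it; replace u by u', where a multiple of u is z^k * u'
  modulo I 0; pass to I 1, where only the terms with least exponent of z survive. This is a shorter
  relation on u'. The sets U i hold the elements allowed as u: the complement of I i for depth, {1}
  for chains of primes.\<close>

lemma chain_independent:
  fixes zs :: "('v, 'k::field) mpoly list" and I U :: "nat \<Rightarrow> ('v, 'k) mpoly set"
  assumes "\<And>i. i \<le> length zs \<Longrightarrow> ideal (I i) (poly_ring V)" "\<And>i. U i \<subseteq> carrier (poly_ring V)"
    and "set zs \<subseteq> carrier (poly_ring V)"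
    and "\<And>i u. i < length zs \<Longrightarrow> u \<in> carrier (poly_ring V) \<Longrightarrow> zs ! i * u \<in> I i \<Longrightarrow> u \<in> I i"
    and "\<And>i. i < length zs \<Longrightarrow> I i \<subseteq> I (Suc i) \<and> zs ! i \<in> I (Suc i)"
    and "\<And>i u. i < length zs \<Longrightarrow> u \<in> U i \<Longrightarrow> \<exists>k. \<exists>s\<in>carrier (poly_ring V).
      \<exists>u'\<in>U (Suc i). s * u - zs ! i ^ k * u' \<in> I i"
    and "\<And>u c. u \<in> U (length zs) \<Longrightarrow> c \<noteq> 0 \<Longrightarrow> const c * u \<notin> I (length zs)"
    and "finite A" "A \<noteq> {}" "\<And>as. as \<in> A \<Longrightarrow> length as = length zs \<and> c as \<noteq> 0" "u \<in> U 0"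
  shows "(\<Sum>as\<in>A. const (c as) * power_prod zs as) * u \<notin> I 0"
  using assms
proof (induction zs arbitrary: I U A c u)
  case Nil
  then have "A \<subseteq> {[]}" by auto
  with Nil.prems(9) have "A = {[]}" by blast
  then show ?case using Nil.prems(7)[of u "c []"] Nil.prems by simp
next
  case (Cons z zs)
  let ?S = "carrier (poly_ring V) :: ('v, 'k) mpoly set"
  have I0: "I 0 \<subseteq> ?S" "\<And>p q. p \<in> I 0 \<Longrightarrow> q \<in> I 0 \<Longrightarrow> p + q \<in> I 0"
      "\<And>r p. r \<in> ?S \<Longrightarrow> p \<in> I 0 \<Longrightarrow> r * p \<in> I 0"
    using Cons.prems(1)[of 0] unfolding poly_ring_ideal_iff by auto
  have I1: "0 \<in> I 1" "\<And>p q. p \<in> I 1 \<Longrightarrow> q \<in> I 1 \<Longrightarrow> p + q \<in> I 1"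
      "\<And>r p. r \<in> ?S \<Longrightarrow> p \<in> I 1 \<Longrightarrow> r * p \<in> I 1"
    using Cons.prems(1)[of 1] unfolding poly_ring_ideal_iff by auto
  have zs: "z \<in> ?S" "set zs \<subseteq> ?S" using Cons.prems(3) by auto
  have nzd: "u \<in> I 0" if "u \<in> ?S" "z ^ k * u \<in> I 0" for u k
    using that
  proof (induction k arbitrary: u)
    case (Suc k)
    then have "z ^ k * (z * u) \<in> I 0" by (simp add: algebra_simps)
    with Suc.IH[of "z * u"] Suc.prems zs have "z * u \<in> I 0" by (simp add: mult_in_poly_ring)
    then show ?case using Cons.prems(4)[of 0 u] Suc.prems by simp
  qed simp
  show ?case
  proof
    assume contr: "(\<Sum>as\<in>A. const (c as) * power_prod (z # zs) as) * u \<in> I 0"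
    from Cons.prems(6)[of 0 u] Cons.prems(11) obtain k r u' where u': "r \<in> ?S" "u' \<in> U 1" "r * u - z ^ k * u' \<in> I 0"
      by auto
    have u'S: "u' \<in> ?S" using u' Cons.prems(2)[of 1] by auto
    define t where "t = Min (hd ` A)"
    have t_le: "t \<le> hd as" if "as \<in> A" for as
      unfolding t_def using that Cons.prems(8) by (intro Min_le) auto
    have "t \<in> hd ` A" unfolding t_def using Cons.prems(8,9) by (intro Min_in) auto
    define A' where "A' = {as \<in> A. hd as = t}"
    have A': "A' \<noteq> {}" "finite A'" "A' \<subseteq> A" using \<open>t \<in> hd ` A\<close> Cons.prems(8) by (auto simp: A'_def)
    define s where "s = (\<Sum>as\<in>A. const (c as) * (z ^ (hd as - t) * power_prod zs (tl as)))"
    have "(\<Sum>as\<in>A. const (c as) * power_prod (z # zs) as) = z ^ t * s"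
      unfolding s_def sum_distrib_left
    proof (rule sum.cong[OF refl])
      fix as assume "as \<in> A"
      then have "z ^ hd as = z ^ t * z ^ (hd as - t)" using t_le by (simp flip: power_add)
      then show "const (c as) * power_prod (z # zs) as
        = z ^ t * (const (c as) * (z ^ (hd as - t) * power_prod zs (tl as)))"
        by (simp add: algebra_simps)
    qed
    then have contr': "z ^ t * s * u \<in> I 0" using contr by simp
    have sS: "s \<in> ?S"
      unfolding s_def using zs
      by (intro sum_in_poly_ring poly_ring_closed power_prod_in_poly_ring)
    \<comment> \<open>Added to r times the relation, this trades u for z^k * u'; the total power of
      z is then cancelled modulo I 0.\<close>
    have "(- 1) * (z ^ t * s) * (r * u - z ^ k * u') \<in> I 0"
      using zs sS u' by (intro I0(3) poly_ring_closed)
    from I0(2)[OF I0(3)[OF u'(1) contr'] this] have "z ^ (t + k) * (s * u') \<in> I 0"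
      by (simp add: algebra_simps power_add)
    then have "s * u' \<in> I 0" using sS u'S by (intro nzd[of "s * u'"] mult_in_poly_ring)
    then have s1: "s * u' \<in> I 1" using Cons.prems(5)[of 0] by auto
    have part: "(\<Sum>as\<in>A - A'. const (c as) * (z ^ (hd as - t) * power_prod zs (tl as))) * u' \<in> I 1"
    proof -
      \<comment> \<open>Outside A' the exponent of z exceeds t, so a factor z remains after the
        cancellation, and z lies in I 1.\<close>
      have each: "const (c as) * (z ^ (hd as - t) * power_prod zs (tl as)) * u' \<in> I 1" if "as \<in> A - A'" for as
      proof -
        have "hd as - t = Suc (hd as - t - 1)" using that t_le[of as] by (auto simp: A'_def)
        then have "const (c as) * (z ^ (hd as - t) * power_prod zs (tl as)) * u'
          = const (c as) * (z ^ (hd as - t - 1) * power_prod zs (tl as)) * u' * z"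
          by (metis (no_types, lifting) mult.assoc mult.commute power_Suc)
        also have "\<dots> \<in> I 1"
          using zs u'S Cons.prems(5)[of 0]
          by (intro I1(3) poly_ring_closed power_prod_in_poly_ring) auto
        finally show ?thesis .
      qed
      have total: "sum f B \<in> I 1" if "\<And>b. b \<in> B \<Longrightarrow> f b \<in> I 1" for f :: "nat list \<Rightarrow> _" and B
        using that by (induction B rule: infinite_finite_induct) (simp_all add: I1(1,2)[unfolded One_nat_def])
      show ?thesis unfolding sum_distrib_right by (rule total, rule each)
    qed
    have "s * u' = (\<Sum>as\<in>A'. const (c as) * power_prod zs (tl as)) * u'
      + (\<Sum>as\<in>A - A'. const (c as) * (z ^ (hd as - t) * power_prod zs (tl as))) * u'"
    proof -
      have "(\<Sum>as\<in>A'. const (c as) * power_prod zs (tl as))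
        = (\<Sum>as\<in>A'. const (c as) * (z ^ (hd as - t) * power_prod zs (tl as)))"
        by (intro sum.cong) (auto simp: A'_def)
      moreover have "s = (\<Sum>as\<in>A - A'. const (c as) * (z ^ (hd as - t) * power_prod zs (tl as)))
        + (\<Sum>as\<in>A'. const (c as) * (z ^ (hd as - t) * power_prod zs (tl as)))"
        unfolding s_def by (rule sum.subset_diff[OF A'(3) Cons.prems(8)])
      ultimately show ?thesis by (simp add: distrib_right add.commute)
    qed
    then have "(\<Sum>as\<in>A'. const (c as) * power_prod zs (tl as)) * u' = s * u'
      + (- 1) * ((\<Sum>as\<in>A - A'. const (c as) * (z ^ (hd as - t) * power_prod zs (tl as))) * u')"
      by simp
    also have "\<dots> \<in> I 1"
      by (rule I1(2)[OF s1 I1(3)[OF _ part]]) (intro poly_ring_closed)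
    finally have "(\<Sum>as\<in>A'. const (c as) * power_prod zs (tl as)) * u' \<in> I 1" .
    moreover have tl: "t # tl as = as" if "as \<in> A'" for as
      using that Cons.prems(10)[of as] A' by (cases as) (auto simp: A'_def)
    then have "inj_on tl A'" by (metis inj_onI)
    then have "(\<Sum>as\<in>tl ` A'. const (c (t # as)) * power_prod zs as)
      = (\<Sum>as\<in>A'. const (c as) * power_prod zs (tl as))"
      by (simp add: sum.reindex tl)
    ultimately have "(\<Sum>as\<in>tl ` A'. const (c (t # as)) * power_prod zs as) * u' \<in> I (Suc 0)"
      by simp
    moreover have "(\<Sum>as\<in>tl ` A'. const (c (t # as)) * power_prod zs as) * u' \<notin> I (Suc 0)"
    proof (rule Cons.IH[of "\<lambda>i. I (Suc i)" "\<lambda>i. U (Suc i)"])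
      show "length as = length zs \<and> c (t # as) \<noteq> 0" if "as \<in> tl ` A'" for as
        using that tl Cons.prems(10) A' by fastforce
      show "\<exists>k. \<exists>s\<in>?S. \<exists>u'\<in>U (Suc (Suc i)). s * u - zs ! i ^ k * u' \<in> I (Suc i)"
        if "i < length zs" "u \<in> U (Suc i)" for i u
        using Cons.prems(6)[of "Suc i" u] that by simp
      show "u \<in> I (Suc i)"
        if "i < length zs" "u \<in> ?S" "zs ! i * u \<in> I (Suc i)" for i u
        using Cons.prems(4)[of "Suc i" u] that by simp
      show "I (Suc i) \<subseteq> I (Suc (Suc i)) \<and> zs ! i \<in> I (Suc (Suc i))" if "i < length zs" for i
        using Cons.prems(5)[of "Suc i"] that by simp
      show "const c * u \<notin> I (Suc (length zs))" if "u \<in> U (Suc (length zs))" "c \<noteq> 0" for u c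
        using Cons.prems(7)[of u c] that by simp
    qed (use Cons.prems(1,2) zs A' u' in auto)
    ultimately show False by blast
  qed
qed

section \<open>Algebraic dependence\<close>

text \<open>Each exponent is bounded separately instead of the total degree, so that the monomials
  fill a box whose size is a power.\<close>

definition exps_le :: "nat \<Rightarrow> ('v, 'k::zero) mpoly \<Rightarrow> bool" where
  "exps_le M p \<longleftrightarrow> (\<forall>m\<in>keys p. \<forall>v. lookup m v \<le> M)"

lemma exps_le_mult:
  fixes p q :: "('v, 'k::comm_ring_1) mpoly"
  assumes "exps_le M p" "exps_le N q"
  shows "exps_le (M + N) (p * q)"
  unfolding exps_le_def
proof (intro ballI allI)
  fix m v assume "m \<in> keys (p * q)"
  then obtain a b where "m = a + b" "a \<in> keys p" "b \<in> keys q"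
    using Poly_Mapping.keys_mult[of p q] by blast
  then show "lookup m v \<le> M + N"
    using assms by (simp add: exps_le_def lookup_add add_mono)
qed

lemma exps_le_1: "exps_le M (1 :: ('v, 'k::comm_ring_1) mpoly)"
  by (auto simp: exps_le_def)

lemma exps_le_power:
  fixes p :: "('v, 'k::comm_ring_1) mpoly"
  assumes "exps_le M p"
  shows "exps_le (k * M) (p ^ k)"
  by (induction k) (use assms in \<open>auto simp: exps_le_1 intro: exps_le_mult\<close>)

lemma exps_le_mono: "exps_le M p \<Longrightarrow> M \<le> N \<Longrightarrow> exps_le N p"
  unfolding exps_le_def by (meson le_trans)

lemma exps_le_power_prod:
  fixes zs :: "('v, 'k::comm_ring_1) mpoly list"
  assumes "\<And>z. z \<in> set zs \<Longrightarrow> exps_le D z" "set as \<subseteq> {..N}" "length as = length zs"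
  shows "exps_le (length zs * (N * D)) (power_prod zs as)"
  using assms
proof (induction zs arbitrary: as)
  case (Cons z zs)
  then obtain a bs where as: "as = a # bs" "a \<le> N" by (cases as) auto
  have "exps_le (a * D) (z ^ a)" using Cons.prems by (intro exps_le_power) auto
  then have "exps_le (N * D) (z ^ a)" by (rule exps_le_mono) (use as in simp)
  moreover have "exps_le (length zs * (N * D)) (power_prod zs bs)"
    using Cons.prems as by (intro Cons.IH) auto
  ultimately show ?case using as by (simp add: exps_le_mult)
qed (simp add: exps_le_1)

lemma exps_le_exists:
  "finite Z \<Longrightarrow> \<exists>D. \<forall>z\<in>Z. exps_le D (z :: ('v, 'k::zero) mpoly)"
proof (induction Z rule: finite_induct)
  case (insert z Z)
  then obtain D where D: "\<forall>z\<in>Z. exps_le D z" by blast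
  let ?E = "\<Union>m\<in>keys z. lookup m ` (keys m) \<union> {0}"
  have fin: "finite (insert 0 ?E)" by auto
  have "lookup m v \<le> Max (insert 0 ?E)" if "m \<in> keys z" for m v
  proof (cases "v \<in> keys m")
    case True
    then have "lookup m v \<in> insert 0 ?E" using that by blast
    then show ?thesis using fin by (intro Max_ge)
  qed (simp add: in_keys_iff)
  then have "exps_le (Max (insert 0 ?E)) z" by (auto simp: exps_le_def)
  then have "\<forall>z'\<in>insert z Z. exps_le (max D (Max (insert 0 ?E))) z'"
    using D by (auto intro: exps_le_mono)
  then show ?case by blast
qed simp

definition monom_box :: "'v set \<Rightarrow> nat \<Rightarrow> ('v \<Rightarrow>\<^sub>0 nat) set" where
  "monom_box W M = {m. keys m \<subseteq> W \<and> (\<forall>v. lookup m v \<le> M)}"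

lemma card_monom_box:
  assumes "finite W"
  shows "finite (monom_box W M)" "card (monom_box W M) \<le> (M + 1) ^ card W"
proof -
  let ?r = "\<lambda>m. restrict (lookup m) W"
  have inj: "inj_on ?r (monom_box W M)"
  proof (rule inj_onI)
    fix m m' assume m: "m \<in> monom_box W M" "m' \<in> monom_box W M" "?r m = ?r m'"
    show "m = m'"
    proof (rule poly_mapping_eqI)
      fix v show "lookup m v = lookup m' v"
      proof (cases "v \<in> W")
        case True then show ?thesis using fun_cong[OF m(3), of v] by simp
      next
        case False
        then have "v \<notin> keys m" "v \<notin> keys m'"
          using m by (auto simp: monom_box_def)
        then show ?thesis by (simp add: in_keys_iff)
      qed
    qed
  qed
  have sub: "?r ` monom_box W M \<subseteq> PiE W (\<lambda>_. {..M})"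
    by (auto simp: monom_box_def)
  have fin: "finite (PiE W (\<lambda>_. {..M}))" using assms by (intro finite_PiE) auto
  show "finite (monom_box W M)" using inj_on_finite[OF inj sub fin] .
  show "card (monom_box W M) \<le> (M + 1) ^ card W"
    using card_inj_on_le[OF inj sub fin] assms by (simp add: card_PiE)
qed

text \<open>Counting: the products of the zs with exponents at most N number (N + 1)^l, while all of
  them lie in the span of a box of monomials that grows only like N^d with d = \<open>card W\<close>
  < l.\<close>

lemma algebraic_dependence:
  fixes zs :: "('v, 'k::field) mpoly list"
  assumes W: "finite W" "card W < length zs" and zs: "set zs \<subseteq> carrier (poly_ring W)"
  shows "\<exists>A c. finite A \<and> A \<noteq> {} \<and> (\<forall>as\<in>A. length as = length zs \<and> c as \<noteq> 0) \<and>
    (\<Sum>as\<in>A. const (c as) * power_prod zs as) = 0"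
proof -
  interpret kvs: vector_space "\<lambda>(c::'k) p. (const c :: ('v, 'k) mpoly) * p"
    by standard (simp_all add: algebra_simps single_add const_mult)
  obtain D where D: "\<And>z. z \<in> set zs \<Longrightarrow> exps_le D z" using exps_le_exists[of "set zs"] by auto
  let ?d = "card W" and ?l = "length zs"
  \<comment> \<open>Chosen so that (M + 1)^d <= ((l*D + 1) * (N + 1))^d = N * (N + 1)^d, which is
    below (N + 1)^(d + 1) <= (N + 1)^l.\<close>
  define N where "N = (?l * D + 1) ^ ?d"
  define M where "M = ?l * (N * D)"
  define L where "L = {as. set as \<subseteq> {..N} \<and> length as = ?l}"
  have L: "finite L" "card L = (N + 1) ^ ?l"
    using finite_lists_length_eq[of "{..N}" ?l] card_lists_length_eq[of "{..N}" ?l] by (simp_all add: L_def)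
  let ?box = "(\<lambda>m. single m 1) ` monom_box W M :: ('v, 'k) mpoly set"
  have "card ?box \<le> (M + 1) ^ ?d"
    using card_image_le[of "monom_box W M"] card_monom_box[OF W(1), of M] le_trans by blast
  also have "\<dots> \<le> ((?l * D + 1) * (N + 1)) ^ ?d"
    by (rule power_mono) (simp_all add: M_def algebra_simps)
  also have "\<dots> = N * (N + 1) ^ ?d" unfolding power_mult_distrib N_def ..
  also have "\<dots> < (N + 1) * (N + 1) ^ ?d" by simp
  also have "\<dots> \<le> (N + 1) ^ ?l"
    using power_increasing[of "Suc ?d" ?l "N + 1"] W(2) by simp
  finally have card: "card ?box < card L" by (simp add: L)
  have span: "power_prod zs as \<in> kvs.span ?box" if "as \<in> L" for as
  proof -
    let ?p = "power_prod zs as"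
    have "exps_le M ?p" using exps_le_power_prod[of zs D as N] D that by (simp add: M_def L_def)
    moreover have "?p \<in> carrier (poly_ring W)" using zs by (rule power_prod_in_poly_ring)
    ultimately have "single m 1 \<in> ?box" if "m \<in> keys ?p" for m
      using that by (auto simp: exps_le_def monom_box_def in_carrier_poly_ring)
    then have "(\<Sum>m\<in>keys ?p. const (lookup ?p m) * single m 1) \<in> kvs.span ?box"
      by (intro kvs.span_sum kvs.span_scale kvs.span_base)
    then show ?thesis by (subst poly_mapping_sum_single) (simp add: mult_single)
  qed
  show ?thesis
  \<comment> \<open>Linear dependence speaks of the set of products, so two equal products are
    treated apart: they give a relation with coefficients 1 and -1.\<close>
  proof (cases "inj_on (power_prod zs) L")
    case False
    then obtain a b where ab: "a \<in> L" "b \<in> L" "a \<noteq> b" "power_prod zs a = power_prod zs b"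
      by (auto simp: inj_on_def)
    then show ?thesis
      by (intro exI[of _ "{a, b}"] exI[of _ "\<lambda>as. if as = a then 1 else - 1"])
         (auto simp: L_def single_uminus)
  next
    case True
    have "kvs.dependent (power_prod zs ` L)"
    proof (rule ccontr)
      assume "\<not> kvs.dependent (power_prod zs ` L)"
      then have "card (power_prod zs ` L) \<le> card ?box"
        using kvs.independent_span_bound[of ?box "power_prod zs ` L"] card_monom_box[OF W(1)] span by auto
      then show False using card card_image[OF True] by simp
    qed
    then obtain u v where u: "(\<Sum>p\<in>power_prod zs ` L. const (u p) * p) = 0"
        "v \<in> power_prod zs ` L" "u v \<noteq> 0"
      using kvs.dependent_finite[of "power_prod zs ` L"] L(1) by auto
    define A where "A = {as \<in> L. u (power_prod zs as) \<noteq> 0}"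
    have "(\<Sum>as\<in>A. const (u (power_prod zs as)) * power_prod zs as)
        = (\<Sum>as\<in>L. const (u (power_prod zs as)) * power_prod zs as)"
      by (rule sum.mono_neutral_left) (use L in \<open>auto simp: A_def\<close>)
    also have "\<dots> = 0" using u(1) by (simp add: sum.reindex[OF True])
    finally have "(\<Sum>as\<in>A. const (u (power_prod zs as)) * power_prod zs as) = 0" .
    moreover have "finite A" using L(1) by (simp add: A_def)
    ultimately show ?thesis
      using u(2,3)
      by (intro exI[of _ A] exI[of _ "\<lambda>as. u (power_prod zs as)"]) (auto simp: A_def L_def)
  qed
qed

section \<open>Ascending chains of ideals\<close>

text \<open>Ideals relative to a subset of an ambient ring: the variables are adjoined one at a
  time, and the intermediate rings are subsets of one type.\<close>

definition ideal_on :: "'a::comm_ring_1 set \<Rightarrow> 'a set \<Rightarrow> bool" where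
  "ideal_on S I \<longleftrightarrow> I \<subseteq> S \<and> 0 \<in> I \<and> (\<forall>p\<in>I. \<forall>q\<in>I. p + q \<in> I) \<and> (\<forall>r\<in>S. \<forall>p\<in>I. r * p \<in> I)"

definition acc_on :: "'a::comm_ring_1 set \<Rightarrow> bool" where
  "acc_on S \<longleftrightarrow> (\<forall>F. (\<forall>i. ideal_on S (F i)) \<longrightarrow> (\<forall>i. F i \<subseteq> F (Suc i)) \<longrightarrow>
     (\<exists>N. \<forall>n\<ge>N. F n = F N))"

definition is_subring :: "'a::comm_ring_1 set \<Rightarrow> bool" where
  "is_subring S \<longleftrightarrow> 0 \<in> S \<and> 1 \<in> S \<and> (\<forall>p\<in>S. - p \<in> S) \<and>
     (\<forall>p\<in>S. \<forall>q\<in>S. p + q \<in> S \<and> p * q \<in> S)"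

lemma chain_mono: "(\<And>i. F i \<subseteq> F (Suc i)) \<Longrightarrow> i \<le> j \<Longrightarrow> F i \<subseteq> (F j :: 'a set)"
  by (rule lift_Suc_mono_le[of F])

text \<open>Hilbert's basis theorem for an extension \<open>A[v]\<close> inside a fixed ambient ring.\<close>

lemma acc_on_adjoin:
  fixes A B :: "'a::comm_ring_1 set"
  assumes A: "is_subring A" "acc_on A" and B: "is_subring B" "A \<subseteq> B" "v \<in> B"
    and gen: "\<And>p. p \<in> B \<Longrightarrow> \<exists>k coef. (\<forall>i. coef i \<in> A) \<and> p = (\<Sum>i<k. coef i * v ^ i)"
  shows "acc_on B"
  unfolding acc_on_def
proof (intro allI impI)
  fix F assume F: "\<forall>i. ideal_on B (F i)" "\<forall>i. F i \<subseteq> F (Suc i)"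
  have Fadd: "p + q \<in> F n" if "p \<in> F n" "q \<in> F n" for p q n
    using F(1) that unfolding ideal_on_def by blast
  have Fmul: "r * p \<in> F n" if "r \<in> B" "p \<in> F n" for r p n
    using F(1) that unfolding ideal_on_def by blast
  have Fz: "0 \<in> F n" for n using F(1) unfolding ideal_on_def by blast
  have Fneg: "- p \<in> F n" if "p \<in> F n" for p n
    using Fmul[of "- 1" p n] that B(1) unfolding is_subring_def by simp
  \<comment> \<open>The coefficients at v^k of the elements of F n that have a representation of
    degree at most k in v.\<close>
  define L where "L n k = {a \<in> A. \<exists>coef. (\<forall>i. coef i \<in> A) \<and> a * v ^ k + (\<Sum>i<k. coef i * v ^ i) \<in> F n}" for n k
  have Lideal: "ideal_on A (L n k)" for n k
    unfolding ideal_on_def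
  proof (intro conjI ballI)
    show "L n k \<subseteq> A" by (auto simp: L_def)
    show "0 \<in> L n k"
      using A(1) Fz by (auto simp: L_def is_subring_def intro!: exI[of _ "\<lambda>_. 0"])
  next
    fix p q assume "p \<in> L n k" "q \<in> L n k"
    then obtain f g where fg: "p \<in> A" "q \<in> A" "\<forall>i. f i \<in> A" "\<forall>i. g i \<in> A"
      "p * v ^ k + (\<Sum>i<k. f i * v ^ i) \<in> F n" "q * v ^ k + (\<Sum>i<k. g i * v ^ i) \<in> F n"
      by (auto simp: L_def)
    from Fadd[OF fg(5,6)] have "(p + q) * v ^ k + (\<Sum>i<k. (f i + g i) * v ^ i) \<in> F n"
      by (simp add: algebra_simps sum.distrib)
    then show "p + q \<in> L n k"
      using fg A(1) by (auto simp: L_def is_subring_def intro!: exI[of _ "\<lambda>i. f i + g i"])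
  next
    fix r p assume r: "r \<in> A" and "p \<in> L n k"
    then obtain f where f: "p \<in> A" "\<forall>i. f i \<in> A" "p * v ^ k + (\<Sum>i<k. f i * v ^ i) \<in> F n"
      by (auto simp: L_def)
    from Fmul[OF _ f(3), of r] r B(2) have "(r * p) * v ^ k + (\<Sum>i<k. (r * f i) * v ^ i) \<in> F n"
      by (auto simp: algebra_simps sum_distrib_left)
    then show "r * p \<in> L n k"
      using f r A(1) by (auto simp: L_def is_subring_def intro!: exI[of _ "\<lambda>i. r * f i"])
  qed
  have LF: "L n k \<subseteq> L (Suc n) k" for n k unfolding L_def using F(2) by blast
  have Lk: "L n k \<subseteq> L n (Suc k)" for n k
  proof
    fix a assume "a \<in> L n k"
    then obtain f where f: "a \<in> A" "\<forall>i. f i \<in> A" "a * v ^ k + (\<Sum>i<k. f i * v ^ i) \<in> F n"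
      by (auto simp: L_def)
    define g where "g i = (case i of 0 \<Rightarrow> 0 | Suc j \<Rightarrow> f j)" for i
    have "(\<Sum>i<Suc k. g i * v ^ i) = (\<Sum>i<k. f i * v ^ Suc i)"
      by (subst sum.lessThan_Suc_shift) (simp add: g_def)
    then have "v * (a * v ^ k + (\<Sum>i<k. f i * v ^ i)) = a * v ^ Suc k + (\<Sum>i<Suc k. g i * v ^ i)"
      by (simp add: algebra_simps sum_distrib_left)
    with Fmul[OF B(3) f(3)] have "a * v ^ Suc k + (\<Sum>i<Suc k. g i * v ^ i) \<in> F n" by simp
    moreover have "\<forall>i. g i \<in> A"
      using f A(1) by (auto simp: g_def is_subring_def split: nat.split)
    ultimately show "a \<in> L n (Suc k)" using f(1) unfolding L_def by blast
  qed
  have LFm: "L n k \<subseteq> L n' k" if "n \<le> n'" for n n' k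
    using chain_mono[of "\<lambda>n. L n k", OF LF that] .
  have Lkm: "L n k \<subseteq> L n k'" if "k \<le> k'" for n k k'
    using chain_mono[of "\<lambda>k. L n k", OF Lk that] .
  \<comment> \<open>L is monotone in both indices. Stability of its diagonal settles all k >= N1 at
    once, and the finitely many smaller k are stabilised one by one.\<close>
  have "L i i \<subseteq> L (Suc i) (Suc i)" for i using LF[of i i] Lk[of "Suc i" i] by blast
  then obtain N1 where N1: "\<And>n. n \<ge> N1 \<Longrightarrow> L n n = L N1 N1"
    using A(2) Lideal unfolding acc_on_def by (elim allE[of _ "\<lambda>i. L i i"]) auto
  have "\<exists>N. \<forall>n\<ge>N. L n k = L N k" for k
    using A(2) Lideal LF unfolding acc_on_def by (elim allE[of _ "\<lambda>n. L n k"]) auto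
  then obtain N2 where N2: "\<And>k n. n \<ge> N2 k \<Longrightarrow> L n k = L (N2 k) k" by metis
  define N where "N = Max (insert N1 (N2 ` {..<N1}))"
  have "N1 \<le> N" unfolding N_def by (intro Max_ge) auto
  have "N2 k \<le> N" if "k < N1" for k unfolding N_def using that by (intro Max_ge) auto
  have stable: "L n k \<subseteq> L N k" if "n \<ge> N" for n k
  proof (cases "k < N1")
    case True
    then show ?thesis using N2[of k n] N2[of k N] that \<open>\<And>k. k < N1 \<Longrightarrow> N2 k \<le> N\<close>[OF True] by simp
  next
    case False
    have "L n k \<subseteq> L (max n k) (max n k)"
      using LFm[of n "max n k" k] Lkm[of k "max n k" "max n k"] by auto
    also have "\<dots> = L N1 N1" using False by (intro N1) simp
    also have "\<dots> \<subseteq> L N k" using LFm[of N1 N N1] Lkm[of N1 k N] \<open>N1 \<le> N\<close> False by auto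
    finally show ?thesis .
  qed
  have "F n = F N" if n: "n \<ge> N" for n
  proof
    show "F N \<subseteq> F n" using chain_mono[of F N n] F(2) n by simp
    \<comment> \<open>Induction on the length of the representation: an element of F N with the same
      coefficient at v^k is subtracted.\<close>
    have "p \<in> F N" if "p \<in> F n" "\<forall>i. f i \<in> A" "p = (\<Sum>i<k. f i * v ^ i)" for p f k
      using that
    proof (induction k arbitrary: p f)
      case (Suc k)
      then have "f k \<in> L n k" unfolding L_def by (auto simp: add.commute intro!: exI[of _ f])
      then have "f k \<in> L N k" using stable[OF n] by auto
      then obtain g where g: "\<forall>i. g i \<in> A" "f k * v ^ k + (\<Sum>i<k. g i * v ^ i) \<in> F N"
        by (auto simp: L_def)
      let ?q = "f k * v ^ k + (\<Sum>i<k. g i * v ^ i)"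
      have "?q \<in> F n" using g(2) \<open>F N \<subseteq> F n\<close> by auto
      then have "p + (- ?q) \<in> F n" by (rule Fadd[OF Suc.prems(1) Fneg])
      moreover have "p + (- ?q) = (\<Sum>i<k. (f i + (- g i)) * v ^ i)"
        by (simp add: Suc.prems(3) algebra_simps sum_subtractf)
      moreover have "\<forall>i. f i + (- g i) \<in> A"
        using Suc.prems g A(1) unfolding is_subring_def by blast
      ultimately have "p + (- ?q) \<in> F N" using Suc.IH[of "p + (- ?q)" "\<lambda>i. f i + (- g i)"] by simp
      from Fadd[OF this g(2)] show ?case by simp
    qed (simp add: Fz)
    moreover have "\<exists>k f. (\<forall>i. f i \<in> A) \<and> p = (\<Sum>i<k. f i * v ^ i)" if "p \<in> F n" for p
      using gen[of p] F(1) that unfolding ideal_on_def by blast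
    ultimately show "F n \<subseteq> F N" by blast
  qed
  then show "\<exists>N. \<forall>n\<ge>N. F n = F N" by blast
qed

lemma is_subring_poly_ring: "is_subring (carrier (poly_ring V))"
  by (auto simp: is_subring_def poly_ring_closed)

text \<open>The base of the induction: polynomials without variables form a copy of the field, whose
  only ideals are zero and the whole ring.\<close>

lemma acc_on_consts: "acc_on (carrier (poly_ring {} :: ('v, 'k::field) mpoly ring))"
  unfolding acc_on_def
proof (intro allI impI)
  let ?S = "carrier (poly_ring {}) :: ('v, 'k) mpoly set"
  fix F :: "nat \<Rightarrow> ('v, 'k) mpoly set"
  assume F: "\<forall>i. ideal_on ?S (F i)" "\<forall>i. F i \<subseteq> F (Suc i)"
  have const: "\<exists>c. p = const c" if "p \<in> ?S" for p
  proof -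
    have "keys p \<subseteq> {0}" using that by (auto simp: in_carrier_poly_ring)
    then have "p = const (lookup p 0)"
      by (intro poly_mapping_eqI) (auto simp: lookup_single when_def in_keys_iff)
    then show ?thesis ..
  qed
  have dichotomy: "F n = {0} \<or> F n = ?S" for n
  proof (cases "F n = {0}")
    case False
    then obtain p where p: "p \<in> F n" "p \<noteq> 0" using F(1) unfolding ideal_on_def by blast
    then obtain c where c: "p = const c" using const F(1) unfolding ideal_on_def by blast
    have "q \<in> F n" if "q \<in> ?S" for q
    proof -
      have "q * const (inverse c) \<in> ?S" using that by (intro poly_ring_closed)
      then have "q * const (inverse c) * p \<in> F n" using p F(1) unfolding ideal_on_def by blast
      moreover have "c \<noteq> 0" using c p by auto
      then have "const (inverse c) * const c = (1 :: ('v, 'k) mpoly)"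
        by (simp flip: const_mult)
      ultimately show ?thesis using c by (simp only: mult.assoc mult_1_right)
    qed
    then show ?thesis using F(1) unfolding ideal_on_def by blast
  qed simp
  show "\<exists>N. \<forall>n\<ge>N. F n = F N"
  proof (cases "\<exists>N. F N = ?S")
    case True
    then obtain N where "F N = ?S" by blast
    then have "F n = F N" if "n \<ge> N" for n
      using chain_mono[of F N n] F that unfolding ideal_on_def by blast
    then show ?thesis by blast
  qed (use dichotomy in blast)
qed

lemma poly_ring_adjoin:
  fixes p :: "('v, 'k::field) mpoly"
  assumes "p \<in> carrier (poly_ring (insert v V))"
  shows "\<exists>k coef. (\<forall>i. coef i \<in> carrier (poly_ring V)) \<and> p = (\<Sum>i<k. coef i * pvar v ^ i)"
proof -
  define R where "R = (\<lambda>(p :: ('v, 'k) mpoly) k. \<exists>coef. (\<forall>i. coef i \<in> carrier (poly_ring V)) \<and> p = (\<Sum>i<(k::nat). coef i * pvar v ^ i))"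
  have pad: "R p l" if "R p k" "k \<le> l" for p k l
  proof -
    from that(1) obtain f where f: "\<forall>i. f i \<in> carrier (poly_ring V)" "p = (\<Sum>i<k. f i * pvar v ^ i)"
      by (auto simp: R_def)
    have "(\<Sum>i<l. (if i < k then f i else 0) * pvar v ^ i) = (\<Sum>i<k. (if i < k then f i else 0) * pvar v ^ i)"
      by (rule sum.mono_neutral_right) (use that in auto)
    then show ?thesis unfolding R_def
      using f by (intro exI[of _ "\<lambda>i. if i < k then f i else 0"]) (auto simp: zero_in_poly_ring)
  qed
  have add: "\<exists>k. R (p + q) k" if pq: "R p k" "R q l" for p q k l
  proof -
    from pad[OF pq(1), of "max k l"] pad[OF pq(2), of "max k l"] obtain f g where
      "\<forall>i. f i \<in> carrier (poly_ring V)" "p = (\<Sum>i<max k l. f i * pvar v ^ i)"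
      "\<forall>i. g i \<in> carrier (poly_ring V)" "q = (\<Sum>i<max k l. g i * pvar v ^ i)"
      by (auto simp: R_def)
    then have "R (p + q) (max k l)"
      unfolding R_def by (intro exI[of _ "\<lambda>i. f i + g i"]) (auto simp: add_in_poly_ring algebra_simps sum.distrib)
    then show ?thesis ..
  qed
  have single: "\<exists>k. R (single m c) k" if "keys m \<subseteq> insert v V" for m c
  proof -
    define j where "j = lookup m v"
    define m' where "m' = Poly_Mapping.update v 0 m"
    have m: "m = m' + single v j"
      by (rule poly_mapping_eqI) (auto simp: m'_def j_def lookup_add lookup_update lookup_single when_def)
    have "keys m' \<subseteq> V" using that by (auto simp: m'_def keys_update)
    then have c': "single m' c \<in> carrier (poly_ring V)" by (auto simp: in_carrier_poly_ring)
    have "single m c = single m' c * pvar v ^ j"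
      by (simp add: m pvar_power mult_single)
    also have "\<dots> = (\<Sum>i<Suc j. (if i = j then single m' c else 0) * pvar v ^ i)"
      by (simp add: if_distrib[of "\<lambda>x. x * _"] cong: if_cong)
    finally have "R (single m c) (Suc j)"
      unfolding R_def using c' by (intro exI[of _ "\<lambda>i. if i = j then single m' c else 0"])
        (auto simp: zero_in_poly_ring)
    then show ?thesis ..
  qed
  have "\<exists>k. R (\<Sum>m\<in>M. single m (lookup p m)) k"
    if "finite M" "M \<subseteq> keys p" for M
    using that
  proof (induction M rule: finite_induct)
    case empty
    have "R 0 0" unfolding R_def by (intro exI[of _ "\<lambda>_. 0"]) (simp add: zero_in_poly_ring)
    then show ?case by auto
  next
    case (insert m M)
    then have "\<exists>k. R (single m (lookup p m)) k"
      using assms by (intro single) (auto simp: in_carrier_poly_ring)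
    then show ?case using insert add by auto
  qed
  from this[of "keys p"] have "\<exists>k. R p k"
    by (simp flip: poly_mapping_sum_single)
  then show ?thesis unfolding R_def by blast
qed

theorem acc_on_poly_ring:
  "finite V \<Longrightarrow> acc_on (carrier (poly_ring V :: ('v, 'k::field) mpoly ring))"
proof (induction V rule: finite_induct)
  case (insert v V)
  show ?case
  proof (rule acc_on_adjoin[OF is_subring_poly_ring insert.IH is_subring_poly_ring])
    show "carrier (poly_ring V) \<subseteq> (carrier (poly_ring (insert v V)) :: ('v, 'k) mpoly set)"
      unfolding subset_iff in_carrier_poly_ring by blast
    show "pvar v \<in> (carrier (poly_ring (insert v V)) :: ('v, 'k) mpoly set)" by simp
  qed (rule poly_ring_adjoin)
qed (rule acc_on_consts)

section \<open>The depth of the quotient\<close>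

abbreviation at_zero :: "('v, 'k::comm_ring_1) mpoly \<Rightarrow> ('v, 'k) mpoly" where
  "at_zero \<equiv> psub (\<lambda>_. 0)"

lemma const_eq_0_iff [simp]: "const a = 0 \<longleftrightarrow> a = 0"
  by (metis lookup_single_eq lookup_zero single_zero)

text \<open>
  Polynomials with nonzero constant term act as units: \<open>I\<close> is assumed saturated with respect to
  them. The ascending chain condition then plays the role of Krull's intersection theorem.
\<close>

lemma divide_by_nonunit:
  fixes I I' :: "('k::field) bpoly set" and n :: nat
  defines "S \<equiv> carrier (bring n) :: 'k bpoly set"
  assumes I: "ideal I (bring n)" and z: "z \<in> S" "at_zero z = 0"
    and sat: "\<And>s u. s \<in> S \<Longrightarrow> at_zero s \<noteq> 0 \<Longrightarrow> u \<in> S \<Longrightarrow> s * u \<in> I \<Longrightarrow> u \<in> I"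
    and I': "\<And>u. u \<in> I' \<Longrightarrow> \<exists>s\<in>S. \<exists>w\<in>S. at_zero s \<noteq> 0 \<and> s * u - z * w \<in> I"
    and u: "u \<in> S" "u \<notin> I"
  shows "\<exists>k. \<exists>s\<in>S. \<exists>u'\<in>S - I'. s * u - z ^ k * u' \<in> I"
proof (rule ccontr)
  have Iadd: "p + q \<in> I" if "p \<in> I" "q \<in> I" for p q
    using I that unfolding poly_ring_ideal_iff by blast
  have Imul: "r * p \<in> I" if "r \<in> S" "p \<in> I" for r p
    using I that unfolding poly_ring_ideal_iff S_def by blast
  have Iz: "0 \<in> I" using I unfolding poly_ring_ideal_iff by blast
  have Ineg: "- p \<in> I" if "p \<in> I" for p
    using Imul[of "- 1" p] that by (simp add: S_def poly_ring_closed)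
  assume contr: "\<not> ?thesis"
  define P where "P k w \<longleftrightarrow> w \<in> S \<and> w \<notin> I \<and> (\<exists>s\<in>S. s * u - z ^ k * w \<in> I)" for k w
  define Q where "Q w w' \<longleftrightarrow> (\<exists>s\<in>S. at_zero s \<noteq> 0 \<and> s * w - z * w' \<in> I)" for w w'
  \<comment> \<open>Were the claim false, every w left after removing a power of z would lie in I'
    and hence, modulo I and up to a unit, be divisible by z again, without end.\<close>
  have "\<exists>w. \<forall>k. P k (w k) \<and> Q (w k) (w (Suc k))"
  proof (rule dependent_nat_choice)
    show "\<exists>x. P 0 x"
      using u Iz by (intro exI[of _ u]) (auto simp: P_def S_def one_in_poly_ring intro!: bexI[of _ 1])
  next
    fix w k assume w: "P k w"
    then obtain s where s: "s \<in> S" "s * u - z ^ k * w \<in> I" by (auto simp: P_def)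
    have "w \<in> I'" using contr s w unfolding P_def by blast
    from I'[OF this] obtain r w' where r: "r \<in> S" "w' \<in> S" "at_zero r \<noteq> 0" "r * w - z * w' \<in> I" by blast
    have "r * (s * u - z ^ k * w) + z ^ k * (r * w - z * w') \<in> I"
      using r s z by (intro Iadd Imul) (auto simp: S_def poly_ring_closed)
    then have "(r * s) * u - z ^ Suc k * w' \<in> I" by (simp add: algebra_simps)
    moreover have "r * s \<in> S" using r s by (simp add: S_def poly_ring_closed)
    moreover have "w' \<notin> I"
    proof
      assume "w' \<in> I"
      then have "(r * w - z * w') + z * w' \<in> I" using r z by (intro Iadd Imul) auto
      then show False using sat[of r w] r w by (simp add: P_def)
    qed
    ultimately show "\<exists>w'. P (Suc k) w' \<and> Q w w'"
      using r by (auto simp: P_def Q_def)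
  qed
  then obtain w where w: "\<And>k. P k (w k)" "\<And>k. Q (w k) (w (Suc k))" by blast
  have wS: "w k \<in> S" "w k \<notin> I" for k using w(1) by (auto simp: P_def)
  \<comment> \<open>The saturation of I + (w k). It grows with k, since w k is a multiple of w (k +
    1) up to a unit.\<close>
  define F where "F k = {p \<in> S. \<exists>s\<in>S. \<exists>r\<in>S. at_zero s \<noteq> 0 \<and> s * p - r * w k \<in> I}" for k
  have "ideal_on S (F k)" for k
    unfolding ideal_on_def
  proof (intro conjI ballI)
    show "F k \<subseteq> S" by (auto simp: F_def)
    have "1 * 0 - 0 * w k \<in> I" "1 \<in> S" "0 \<in> S" "at_zero (1 :: 'k bpoly) \<noteq> 0"
      using Iz by (simp_all add: S_def poly_ring_closed)
    then show "0 \<in> F k" unfolding F_def by blast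
  next
    fix p q assume "p \<in> F k" "q \<in> F k"
    then obtain s r s' r' where *: "p \<in> S" "q \<in> S" "s \<in> S" "r \<in> S" "s' \<in> S" "r' \<in> S"
      "at_zero s \<noteq> 0" "at_zero s' \<noteq> 0" "s * p - r * w k \<in> I" "s' * q - r' * w k \<in> I"
      unfolding F_def by blast
    then have "s' * (s * p - r * w k) + s * (s' * q - r' * w k) \<in> I" by (intro Iadd Imul)
    then have "(s * s') * (p + q) - (s' * r + s * r') * w k \<in> I" by (simp add: algebra_simps)
    moreover have "s * s' \<in> S" "s' * r + s * r' \<in> S" "p + q \<in> S" "at_zero (s * s') \<noteq> 0"
      using * by (simp_all add: S_def poly_ring_closed)
    ultimately show "p + q \<in> F k" unfolding F_def by blast
  next
    fix t p assume t: "t \<in> S" and "p \<in> F k"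
    then obtain s r where *: "p \<in> S" "s \<in> S" "r \<in> S" "at_zero s \<noteq> 0" "s * p - r * w k \<in> I"
      unfolding F_def by blast
    then have "t * (s * p - r * w k) \<in> I" using t by (intro Imul)
    then have "s * (t * p) - (t * r) * w k \<in> I" by (simp add: algebra_simps)
    moreover have "t * p \<in> S" "t * r \<in> S" using * t by (simp_all add: S_def poly_ring_closed)
    ultimately show "t * p \<in> F k" unfolding F_def using * by blast
  qed
  moreover have "F k \<subseteq> F (Suc k)" for k
  proof
    fix p assume "p \<in> F k"
    then obtain s r where *: "p \<in> S" "s \<in> S" "r \<in> S" "at_zero s \<noteq> 0" "s * p - r * w k \<in> I"
      unfolding F_def by blast
    obtain t where t: "t \<in> S" "at_zero t \<noteq> 0" "t * w k - z * w (Suc k) \<in> I"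
      using w(2)[of k] by (auto simp: Q_def)
    have "t * (s * p - r * w k) + r * (t * w k - z * w (Suc k)) \<in> I"
      using * t by (intro Iadd Imul)
    then have "(t * s) * p - (r * z) * w (Suc k) \<in> I" by (simp add: algebra_simps)
    moreover have "t * s \<in> S" "r * z \<in> S" "at_zero (t * s) \<noteq> 0"
      using * t z by (simp_all add: S_def poly_ring_closed)
    ultimately show "p \<in> F (Suc k)" unfolding F_def using * by blast
  qed
  moreover have "acc_on S"
    unfolding S_def by (rule acc_on_poly_ring) (simp add: bvars_def)
  ultimately obtain N where N: "F (Suc N) = F N"
    unfolding acc_on_def by (metis le_Suc_eq order_refl)
  have "w (Suc N) \<in> F (Suc N)"
  proof -
    have "1 * w (Suc N) - 1 * w (Suc N) \<in> I" "1 \<in> S" "at_zero (1 :: 'k bpoly) \<noteq> 0"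
      using Iz by (simp_all add: S_def poly_ring_closed)
    then show ?thesis unfolding F_def using wS[of "Suc N"] by blast
  qed
  then obtain s r where *: "s \<in> S" "r \<in> S" "at_zero s \<noteq> 0" "s * w (Suc N) - r * w N \<in> I"
    using N unfolding F_def by blast
  obtain t where t: "t \<in> S" "at_zero t \<noteq> 0" "t * w N - z * w (Suc N) \<in> I"
    using w(2)[of N] by (auto simp: Q_def)
  \<comment> \<open>The argument of Nakayama's lemma: t * s - r * z multiplies w (N + 1) into I, and
    its constant term is that of t * s, as z vanishes at the origin.\<close>
  have "t * (s * w (Suc N) - r * w N) + r * (t * w N - z * w (Suc N)) \<in> I"
    using * t by (intro Iadd Imul)
  then have "(t * s - r * z) * w (Suc N) \<in> I" by (simp add: algebra_simps)
  moreover have "t * s - r * z \<in> S" "at_zero (t * s - r * z) \<noteq> 0"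
    using * t z by (simp_all add: S_def poly_ring_closed)
  ultimately have "w (Suc N) \<in> I" using sat wS(1) by blast
  then show False using wS(2) by blast
qed

section \<open>The binomial edge ideal of the graph and the two bounds for its depth\<close>

lemma edge_minors_in_carrier:
  assumes "2 \<le> n" "2 \<le> e"
  shows "edge_minors n e \<subseteq> (carrier (bring n) :: ('k::field) bpoly set)"
proof -
  have "minors {1..n} \<subseteq> (carrier (bring n) :: 'k bpoly set)"
    by (rule minors_in_carrier) (simp add: bvars_def)
  then show ?thesis using edge_minors_subset_minors[OF assms] by blast
qed

lemma binomial_edge_ideal_join_edges:
  assumes "2 \<le> n" "2 \<le> e"
  shows "binomial_edge_ideal n (join_edges n e) =
    (rng.span (edge_minors n e) \<inter> carrier (bring n) :: ('k::field) bpoly set)"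
proof -
  have "{i, j} \<in> join_edges n e \<longleftrightarrow>
      (i \<in> {1, 2} \<and> j \<in> {3..n} \<or> i \<in> {Suc e..n} \<and> j \<in> {Suc e..n})" if "i < j" for i j
    using that unfolding join_edges_def by (auto simp: doubleton_eq_iff)
  then have "{pvar (X i) * pvar (Y j) - pvar (X j) * pvar (Y i) | i j. i < j \<and> {i, j} \<in> join_edges n e}
    = (edge_minors n e :: 'k bpoly set)"
    unfolding edge_minors_def det2_def by (intro Collect_cong) metis
  then show ?thesis
    unfolding binomial_edge_ideal_def
    using genideal_poly_ring[OF edge_minors_in_carrier[OF assms]] by simp
qed

lemma graded_max_ideal_eq:
  "graded_max_ideal n = (rng.span (pvar ` bvars n) \<inter> carrier (bring n) :: ('k::field) bpoly set)"
  unfolding graded_max_ideal_def by (rule genideal_poly_ring) auto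

lemma at_zero_span:
  assumes "\<And>a. a \<in> A \<Longrightarrow> at_zero a = 0" "p \<in> rng.span A"
  shows "at_zero (p :: ('k::field) bpoly) = 0"
  using assms(2) by (induction p rule: rng.span_induct_alt) (simp_all add: assms(1))

lemma at_zero_edge_minors: "g \<in> edge_minors n e \<Longrightarrow> at_zero g = 0"
  by (auto simp: edge_minors_def det2_def)

lemma regular_seq_exists:
  assumes e: "4 \<le> e" "e < n"
  shows "regular_seq (quot_module (bring n) (binomial_edge_ideal n (join_edges n e)))
      [rs1, rs2, rs3 n, rs4 :: ('k::field) bpoly]"
    and "set [rs1, rs2, rs3 n, rs4 :: 'k bpoly] \<subseteq> graded_max_ideal n"
proof -
  let ?fs = "[rs1, rs2, rs3 n, rs4] :: 'k bpoly list"
  have G: "edge_minors n e \<subseteq> (carrier (bring n) :: 'k bpoly set)"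
    using e by (intro edge_minors_in_carrier) auto
  have fs: "set ?fs \<subseteq> carrier (bring n)"
    using e by (auto simp: bvars_def)
  \<comment> \<open>Properness, which \<open>wreg\<close> leaves out: all generators vanish at the
    origin.\<close>
  have "1 \<notin> rng.span (set ?fs \<union> edge_minors n e)"
  proof
    assume "1 \<in> rng.span (set ?fs \<union> edge_minors n e)"
    then have "at_zero (1 :: 'k bpoly) = 0"
      by (rule at_zero_span[rotated]) (auto simp: at_zero_edge_minors rs_defs)
    then show False by simp
  qed
  moreover have "nzd (rng.span (set (take i ?fs) \<union> edge_minors n e)) (?fs ! i)" if "i < length ?fs" for i
    using wreg_nth[OF wreg_edge_minors[OF e] that] .
  ultimately show "regular_seq (quot_module (bring n) (binomial_edge_ideal n (join_edges n e))) ?fs"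
    using e unfolding regular_seq_quot_module[OF G binomial_edge_ideal_join_edges fs]
    by (subst regular_seq_quot_module[OF G binomial_edge_ideal_join_edges fs]) (auto intro: nzdD)
  have "{X 1, X 2, X 3, X 4, X n, Y 1, Y 2, Y 3, Y 4, Y n} \<subseteq> bvars n"
    using e by (auto simp: bvars_def)
  then have "pvar v \<in> rng.span (pvar ` bvars n :: 'k bpoly set)"
    if "v \<in> {X 1, X 2, X 3, X 4, X n, Y 1, Y 2, Y 3, Y 4, Y n}" for v
    using that by (intro rng.span_base) auto
  then have "set ?fs \<subseteq> rng.span (pvar ` bvars n)"
    unfolding rs_defs by (auto intro!: rng.span_add)
  then show "set ?fs \<subseteq> graded_max_ideal n"
    using fs unfolding graded_max_ideal_eq by blast
qed

lemma power_prod_hom: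
  assumes "\<And>p q. h (p * q) = h p * h q" "h 1 = 1"
  shows "h (power_prod zs as) = power_prod (map h zs) as"
proof -
  have "h (z ^ k) = h z ^ k" for z k by (induction k) (simp_all add: assms)
  then show ?thesis by (induction zs arbitrary: as) (simp_all add: assms)
qed

text \<open>
  The minor of columns \<open>1\<close> and \<open>2\<close> is a nonzero element of the quotient annihilated by the prime
  \<open>(x\<^sub>h, y\<^sub>h : h \<ge> 3)\<close>, modulo which only four variables are left.
\<close>

lemma regular_seq_length_le:
  fixes fs :: "('k::field) bpoly list"
  assumes e: "4 \<le> e" "e < n"
    and reg: "regular_seq (quot_module (bring n) (binomial_edge_ideal n (join_edges n e))) fs"
    and fs: "set fs \<subseteq> graded_max_ideal n"
  shows "length fs \<le> 4"
proof (rule ccontr)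
  assume "\<not> length fs \<le> 4"
  define zs where "zs = take 5 fs"
  have len: "length zs = 5" using \<open>\<not> length fs \<le> 4\<close> by (simp add: zs_def)
  let ?S = "carrier (bring n) :: 'k bpoly set"
  let ?G = "edge_minors n e :: 'k bpoly set"
  let ?H = "cols {3..n} :: 'k bpoly set"
  have G: "?G \<subseteq> ?S" using e by (intro edge_minors_in_carrier) auto
  have fsS: "set fs \<subseteq> ?S" using fs unfolding graded_max_ideal_eq by blast
  have zsS: "set zs \<subseteq> ?S" using fsS set_take_subset[of 5 fs] by (auto simp: zs_def)
  have zs0: "at_zero z = 0" if "z \<in> set zs" for z
  proof -
    have "z \<in> rng.span (pvar ` bvars n)"
      using fs that set_take_subset[of 5 fs] unfolding graded_max_ideal_eq zs_def by blast
    then show ?thesis by (rule at_zero_span[rotated]) auto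
  qed
  define Sp where "Sp i = (rng.span (set (take i zs) \<union> ?G))" for i
  have SpS: "set (take i zs) \<union> ?G \<subseteq> ?S" for i using zsS G set_take_subset[of i zs] by blast
  have nz: "u \<in> Sp i" if "i < 5" "u \<in> ?S" "zs ! i * u \<in> Sp i" for i u
  proof -
    have "take i zs = take i fs" "zs ! i = fs ! i" "i < length fs"
      using that(1) \<open>\<not> length fs \<le> 4\<close> by (simp_all add: zs_def)
    then show ?thesis
      using reg that(2,3) e
      unfolding Sp_def by (subst (asm) regular_seq_quot_module[OF G binomial_edge_ideal_join_edges fsS]) auto
  qed
  have Sp_Suc: "Sp (Suc i) = rng.span (insert (zs ! i) (set (take i zs) \<union> ?G))" if "i < 5" for i
    unfolding Sp_def using that len by (simp add: take_Suc_conv_app_nth)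
  \<comment> \<open>The ideals of the sequence with polynomials of nonzero constant term cancelled,
    as localisation at the origin would do; \<open>divide_by_nonunit\<close> asks for this
    saturation.\<close>
  define I where "I i = {u \<in> ?S. \<exists>s\<in>?S. at_zero s \<noteq> 0 \<and> s * u \<in> Sp i}" for i
  have ideal: "ideal (I i) (bring n)" for i
    unfolding poly_ring_ideal_iff
  proof (intro conjI ballI)
    show "I i \<subseteq> ?S" by (auto simp: I_def)
    show "0 \<in> I i"
      by (auto simp: I_def Sp_def poly_ring_closed rng.span_zero intro!: bexI[of _ 1])
  next
    fix p q assume "p \<in> I i" "q \<in> I i"
    then obtain s t where *: "p \<in> ?S" "q \<in> ?S" "s \<in> ?S" "t \<in> ?S" "at_zero s \<noteq> 0" "at_zero t \<noteq> 0"
      "s * p \<in> Sp i" "t * q \<in> Sp i" unfolding I_def by blast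
    then have "t * (s * p) + s * (t * q) \<in> Sp i" by (metis Sp_def rng.span_add span_multL)
    then have "(s * t) * (p + q) \<in> Sp i" by (simp add: algebra_simps)
    moreover have "s * t \<in> ?S" "p + q \<in> ?S" "at_zero (s * t) \<noteq> 0" using * by (simp_all add: poly_ring_closed)
    ultimately show "p + q \<in> I i" unfolding I_def by blast
  next
    fix r p assume r: "r \<in> ?S" and "p \<in> I i"
    then obtain s where *: "p \<in> ?S" "s \<in> ?S" "at_zero s \<noteq> 0" "s * p \<in> Sp i" unfolding I_def by blast
    then have "r * (s * p) \<in> Sp i" by (simp add: Sp_def span_multL)
    then have "s * (r * p) \<in> Sp i" by (simp add: algebra_simps)
    moreover have "r * p \<in> ?S" using * r by (simp add: poly_ring_closed)
    ultimately show "r * p \<in> I i" unfolding I_def using * by blast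
  qed
  have sat: "u \<in> I i" if su: "s \<in> ?S" "at_zero s \<noteq> 0" "u \<in> ?S" "s * u \<in> I i" for s u i
  proof -
    obtain t where "t \<in> ?S" "at_zero t \<noteq> 0" "t * (s * u) \<in> Sp i" using su(4) unfolding I_def by blast
    then have "t * s \<in> ?S" "at_zero (t * s) \<noteq> 0" "(t * s) * u \<in> Sp i"
      using su by (simp_all add: poly_ring_closed mult.assoc)
    then show ?thesis using su(3) unfolding I_def by blast
  qed
  have SpI: "p \<in> I i" if "p \<in> Sp i" "p \<in> ?S" for p i
    using that unfolding I_def by (auto simp: poly_ring_closed intro!: bexI[of _ 1])
  let ?W = "{X 1, Y 1, X 2, Y 2}"
  \<comment> \<open>The complement of ?U is exactly the set of variables of Q2, so that killing it
    means reduction modulo Q2; ?W is the finite set of four variables for the dependence. Both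
    restrictions agree on S.\<close>
  let ?U = "- (X ` {3..n} \<union> Y ` {3..n})"
  have rU: "restrict_vars ?U p = restrict_vars ?W p" if "p \<in> ?S" for p :: "'k bpoly"
    unfolding restrict_vars_def
  proof (rule psub_cong_carrier[OF that])
    fix v assume "v \<in> bvars n"
    then have "v \<in> ?U \<longleftrightarrow> v \<in> ?W"
      by (cases v) (auto simp: bvars_def image_iff)
    then show "(if v \<in> ?U then pvar v else 0) = (if v \<in> ?W then pvar v else 0 :: 'k bpoly)" by argo
  qed
  let ?zs' = "map (restrict_vars ?W) zs"
  have card: "card ?W < length ?zs'" by (simp add: len)
  have "set ?zs' \<subseteq> carrier (poly_ring ?W)"
    by (auto intro: restrict_vars_in)
  from algebraic_dependence[OF _ card this] obtain A c where A: "finite A" "A \<noteq> {}"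
    "\<forall>as\<in>A. length as = length ?zs' \<and> c as \<noteq> 0"
    "(\<Sum>as\<in>A. const (c as) * power_prod ?zs' as) = 0" by blast
  define P where "P = (\<Sum>as\<in>A. const (c as) * power_prod zs as)"
  have PS: "P \<in> ?S"
    unfolding P_def using zsS by (intro sum_in_poly_ring poly_ring_closed power_prod_in_poly_ring)
  have "restrict_vars ?W P = (\<Sum>as\<in>A. const (c as) * power_prod ?zs' as)"
    unfolding P_def restrict_vars_def psub_sum psub_mult psub_const
    by (subst power_prod_hom) (simp_all add: restrict_vars_def)
  then have "restrict_vars ?U P = 0" using A(4) rU[OF PS] by simp
  then have "P \<in> rng.span (pvar ` (- ?U))" using diff_restrict_vars_in_span[of P ?U] by simp
  moreover have "pvar ` (- ?U) = ?H" by (auto simp: cols_def)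
  ultimately have PH: "P \<in> rng.span ?H" by simp
  \<comment> \<open>P is in Q2 and [1 2] in J', so the product is in their intersection, the ideal
    of the graph.\<close>
  have "P * det2 1 2 \<in> rng.span ?H \<inter> rng.span (insert (det2 1 2) ?G)"
    using PH by (auto intro: span_multL span_multR rng.span_base)
  then have PG: "P * det2 1 2 \<in> rng.span ?G" using e by (subst span_edge_minors_split) auto
  have d12: "det2 1 2 \<in> ?S" using e by (intro det2_in_carrier) (auto simp: bvars_def)
  have "P * det2 1 2 \<notin> I 0"
    unfolding P_def
  proof (rule chain_independent[where V = "bvars n" and U = "\<lambda>i. ?S - I i" and I = I])
    show "u \<in> I i" if i: "i < length zs" "u \<in> ?S" "zs ! i * u \<in> I i" for i u
    proof -
      obtain s where s: "s \<in> ?S" "at_zero s \<noteq> 0" "s * (zs ! i * u) \<in> Sp i" using i(3) unfolding I_def by blast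
      then have "zs ! i * (s * u) \<in> Sp i" by (simp add: algebra_simps)
      then have "s * u \<in> Sp i" using nz[of i "s * u"] i s len by (simp add: poly_ring_closed)
      then show ?thesis using s i unfolding I_def by blast
    qed
    show "I i \<subseteq> I (Suc i) \<and> zs ! i \<in> I (Suc i)" if i: "i < length zs" for i
    proof
      have "Sp i \<subseteq> Sp (Suc i)" unfolding Sp_def by (rule rng.span_mono) (use set_take_subset_set_take[of i "Suc i" zs] in auto)
      then show "I i \<subseteq> I (Suc i)" unfolding I_def by blast
      have "zs ! i \<in> Sp (Suc i)" using i len by (simp add: Sp_Suc rng.span_base)
      then show "zs ! i \<in> I (Suc i)" using zsS i by (intro SpI) auto
    qed
    show "\<exists>k. \<exists>s\<in>?S. \<exists>u'\<in>?S - I (Suc i). s * u - zs ! i ^ k * u' \<in> I i"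
      if i: "i < length zs" "u \<in> ?S - I i" for i u
    proof (rule divide_by_nonunit[OF ideal])
      have zi: "zs ! i \<in> ?S" using zsS i by auto
      show "zs ! i \<in> ?S" "at_zero (zs ! i) = 0" using zsS zs0 i by auto
      show "\<exists>s\<in>?S. \<exists>w\<in>?S. at_zero s \<noteq> 0 \<and> s * v - zs ! i * w \<in> I i" if v: "v \<in> I (Suc i)" for v
      proof -
        obtain s where s: "v \<in> ?S" "s \<in> ?S" "at_zero s \<noteq> 0" "s * v \<in> Sp (Suc i)" using v unfolding I_def by blast
        then have "s * v \<in> rng.span (insert (zs ! i) (set (take i zs) \<union> ?G)) \<inter> ?S"
          using i len by (simp add: Sp_Suc poly_ring_closed)
        then obtain w q where "w \<in> ?S" "q \<in> Sp i" "q \<in> ?S" "s * v = zs ! i * w + q"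
          unfolding Sp_def span_insert_Int[OF SpS zi] by blast
        then show ?thesis using s SpI[of q i] by (intro bexI[of _ s] bexI[of _ w]) auto
      qed
    qed (use i sat in auto)
    show "const a * u \<notin> I (length zs)" if "u \<in> ?S - I (length zs)" "a \<noteq> 0" for u a
    proof
      assume "const a * u \<in> I (length zs)"
      then have "u \<in> I (length zs)"
        using that by (intro sat[of "const a" u]) (auto simp: poly_ring_closed)
      then show False using that by simp
    qed
    \<comment> \<open>A multiplier s taking [1 2] into the ideal of the graph takes it into Q2; as
      [1 2] is regular modulo Q2, s itself is in Q2 and has no constant term.\<close>
    have "det2 1 2 \<notin> I 0"
    proof
      assume "det2 1 2 \<in> I 0"
      then obtain s where s: "s \<in> ?S" "at_zero s \<noteq> 0" "s * det2 1 2 \<in> rng.span ?G"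
        unfolding I_def Sp_def by auto
      then have "det2 1 2 * s \<in> rng.span ?H"
        using span_edge_minors_split[of e n] e by (auto simp: mult.commute)
      then have "s \<in> rng.span ?H" by (rule nzdD[OF nzd_det2])
      then have "at_zero s = 0" by (rule at_zero_span[rotated]) (auto simp: cols_def)
      then show False using s by simp
    qed
    then show "det2 1 2 \<in> ?S - I 0" using d12 by simp
  qed (use A zsS ideal in auto)
  moreover have "P * det2 1 2 \<in> I 0"
    using PG PS d12 by (intro SpI) (auto simp: Sp_def poly_ring_closed)
  ultimately show False by blast
qed

lemma depth_join_edges:
  assumes e: "4 \<le> e" "e < n"
  shows "depth (graded_max_ideal n) (quot_module (bring n :: ('k::field) bpoly ring)
    (binomial_edge_ideal n (join_edges n e))) = 4"
proof -
  let ?M = "quot_module (bring n :: 'k bpoly ring) (binomial_edge_ideal n (join_edges n e))"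
  let ?L = "{enat (length fs) | fs. set fs \<subseteq> graded_max_ideal n \<and> regular_seq ?M fs}"
  have "enat 4 \<in> ?L"
    using regular_seq_exists[OF e, where 'k = 'k] by (intro CollectI exI[of _ "[rs1, rs2, rs3 n, rs4]"]) simp
  then have "enat 4 \<le> Sup ?L" by (rule Sup_upper)
  moreover have "Sup ?L \<le> enat 4"
    by (rule Sup_least) (use regular_seq_length_le[OF e] in auto)
  ultimately show ?thesis unfolding depth_def by (simp add: numeral_eq_enat)
qed

section \<open>The dimension of the quotient\<close>

definition prime_chain :: "('a, 'b) ring_scheme \<Rightarrow> (nat \<Rightarrow> 'a set) \<Rightarrow> nat \<Rightarrow> bool" where
  "prime_chain R P k \<longleftrightarrow> (\<forall>i\<le>k. primeideal (P i) R) \<and> (\<forall>i<k. P i \<subset> P (Suc i))"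

lemma prime_chain_vimage:
  fixes J :: "('v, 'k::field) mpoly set"
  assumes J: "ideal J (poly_ring V)" and Q: "prime_chain (poly_ring V Quot J) Q k"
  shows "\<exists>P. prime_chain (poly_ring V) P k \<and> J \<subseteq> P 0"
proof -
  interpret cring "poly_ring V :: ('v, 'k) mpoly ring" by (rule cring_poly_ring)
  interpret J: ideal J "poly_ring V" by fact
  interpret h: ring_hom_ring "poly_ring V" "poly_ring V Quot J" "(+>\<^bsub>poly_ring V\<^esub>) J"
    by (rule J.rcos_ring_hom_ring)
  let ?q = "(+>\<^bsub>poly_ring V\<^esub>) J"
  define P where "P i = {r \<in> carrier (poly_ring V). ?q r \<in> Q i}" for i
  have car: "carrier (poly_ring V Quot J) = ?q ` carrier (poly_ring V)"
    by (auto simp: FactRing_def A_RCOSETS_def')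
  have "primeideal (P i) (poly_ring V)" if "i \<le> k" for i
    unfolding P_def using Q that by (intro h.primeideal_vimage cring_poly_ring) (simp add: prime_chain_def)
  moreover have "P i \<subset> P (Suc i)" if "i < k" for i
  proof -
    have Qi: "Q i \<subset> Q (Suc i)" using Q that by (simp add: prime_chain_def)
    then obtain x where x: "x \<in> Q (Suc i)" "x \<notin> Q i" by blast
    have "ideal (Q (Suc i)) (poly_ring V Quot J)"
      using Q that by (simp add: prime_chain_def primeideal_def)
    then have "x \<in> carrier (poly_ring V Quot J)" using x(1) by (rule ideal.Icarr)
    then obtain r where "r \<in> carrier (poly_ring V)" "x = ?q r" unfolding car by blast
    then have "r \<in> P (Suc i)" "r \<notin> P i" using x by (auto simp: P_def)
    moreover have "P i \<subseteq> P (Suc i)" using Qi by (auto simp: P_def)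
    ultimately show ?thesis by blast
  qed
  moreover have "J \<subseteq> P 0"
  proof
    fix r assume r: "r \<in> J"
    have "ideal (Q 0) (poly_ring V Quot J)" using Q by (simp add: prime_chain_def primeideal_def)
    then have "\<zero>\<^bsub>poly_ring V Quot J\<^esub> \<in> Q 0"
      by (simp add: ideal_def additive_subgroup.zero_closed)
    moreover have "?q r = ?q 0"
      using r J.Icarr[OF r] quot_eq_iff[OF J, of r 0] by (simp add: zero_in_poly_ring)
    ultimately show "r \<in> P 0" using h.hom_zero J.Icarr[OF r] by (simp add: P_def)
  qed
  ultimately show ?thesis unfolding prime_chain_def by blast
qed

lemma primeideal_image_quot:
  fixes J P :: "('v, 'k::field) mpoly set"
  assumes J: "ideal J (poly_ring V)" and P: "primeideal P (poly_ring V)" "J \<subseteq> P"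
  shows "primeideal ((+>\<^bsub>poly_ring V\<^esub>) J ` P) (poly_ring V Quot J)"
    and "\<And>r. r \<in> carrier (poly_ring V) \<Longrightarrow> J +>\<^bsub>poly_ring V\<^esub> r \<in> (+>\<^bsub>poly_ring V\<^esub>) J ` P \<longleftrightarrow> r \<in> P"
proof -
  interpret cring "poly_ring V :: ('v, 'k) mpoly ring" by (rule cring_poly_ring)
  interpret J: ideal J "poly_ring V" by fact
  interpret h: ring_hom_ring "poly_ring V" "poly_ring V Quot J" "(+>\<^bsub>poly_ring V\<^esub>) J"
    by (rule J.rcos_ring_hom_ring)
  let ?q = "(+>\<^bsub>poly_ring V\<^esub>) J"
  have Pid: "ideal P (poly_ring V)" and P1: "1 \<notin> P"
    and Pprime: "\<And>p q. p \<in> carrier (poly_ring V) \<Longrightarrow> q \<in> carrier (poly_ring V) \<Longrightarrow> p * q \<in> P \<Longrightarrow> p \<in> P \<or> q \<in> P"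
    using P(1) unfolding poly_ring_primeideal_iff by blast+
  have PS: "P \<subseteq> carrier (poly_ring V)" and Padd: "\<And>p q. p \<in> P \<Longrightarrow> q \<in> P \<Longrightarrow> p + q \<in> P"
    using Pid unfolding poly_ring_ideal_iff by blast+
  have car: "carrier (poly_ring V Quot J) = ?q ` carrier (poly_ring V)"
    by (auto simp: FactRing_def A_RCOSETS_def')
  have mem: "?q r \<in> ?q ` P \<longleftrightarrow> r \<in> P" if r: "r \<in> carrier (poly_ring V)" for r
  proof
    assume "?q r \<in> ?q ` P"
    then obtain s where s: "s \<in> P" "?q r = ?q s" by blast
    then have "r - s \<in> P" using quot_eq_iff[OF J r, of s] PS P(2) by blast
    from Padd[OF this s(1)] show "r \<in> P" by simp
  qed blast
  show "\<And>r. r \<in> carrier (poly_ring V) \<Longrightarrow> ?q r \<in> ?q ` P \<longleftrightarrow> r \<in> P" by (rule mem)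
  show "primeideal (?q ` P) (poly_ring V Quot J)"
  proof (rule primeidealI)
    show "ideal (?q ` P) (poly_ring V Quot J)" by (rule ring_ideal_imp_quot_ideal[OF J Pid])
    show "cring (poly_ring V Quot J)" by (rule J.quotient_is_cring[OF cring_poly_ring])
    have "?q 1 \<notin> ?q ` P" using mem[OF one_in_poly_ring] P1 by simp
    then show "carrier (poly_ring V Quot J) \<noteq> ?q ` P" using one_in_poly_ring car by blast
    fix a b assume "a \<in> carrier (poly_ring V Quot J)" "b \<in> carrier (poly_ring V Quot J)"
      and ab: "a \<otimes>\<^bsub>poly_ring V Quot J\<^esub> b \<in> ?q ` P"
    then obtain p q where pq: "p \<in> carrier (poly_ring V)" "q \<in> carrier (poly_ring V)" "a = ?q p" "b = ?q q"
      unfolding car by blast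
    then have "?q (p * q) \<in> ?q ` P" using ab h.hom_mult[of p q] by simp
    then have "p * q \<in> P" using mem[OF mult_in_poly_ring[OF pq(1,2)]] by simp
    then show "a \<in> ?q ` P \<or> b \<in> ?q ` P" using Pprime[OF pq(1,2)] pq(3,4) by blast
  qed
qed

lemma krull_dim_quot_eqI:
  fixes J :: "('v, 'k::field) mpoly set"
  assumes J: "ideal J (poly_ring V)"
    and chain: "prime_chain (poly_ring V) P d" "J \<subseteq> P 0"
    and bound: "\<And>P k. prime_chain (poly_ring V) P k \<Longrightarrow> J \<subseteq> P 0 \<Longrightarrow> k \<le> d"
  shows "krull_dim (poly_ring V Quot J) = enat d"
proof -
  let ?L = "{enat k | k. \<exists>P. prime_chain (poly_ring V Quot J) P k}"
  have JP: "J \<subseteq> P i" if "i \<le> d" for i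
    using that
  proof (induction i)
    case (Suc i)
    then show ?case using chain(1) unfolding prime_chain_def by (metis Suc_leD Suc_le_lessD order.trans psubset_imp_subset)
  qed (use chain in simp)
  have "prime_chain (poly_ring V Quot J) (\<lambda>i. (+>\<^bsub>poly_ring V\<^esub>) J ` P i) d"
    unfolding prime_chain_def
  proof (intro conjI allI impI)
    fix i assume "i \<le> d"
    then show "primeideal ((+>\<^bsub>poly_ring V\<^esub>) J ` P i) (poly_ring V Quot J)"
      using chain(1) JP by (intro primeideal_image_quot J) (auto simp: prime_chain_def)
  next
    fix i assume i: "i < d"
    then have sub: "P i \<subset> P (Suc i)" and p: "primeideal (P i) (poly_ring V)" "primeideal (P (Suc i)) (poly_ring V)"
      using chain(1) by (auto simp: prime_chain_def)
    then obtain r where r: "r \<in> P (Suc i)" "r \<notin> P i" by blast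
    have "r \<in> carrier (poly_ring V)"
      using r(1) p(2) by (meson ideal.Icarr primeideal_def)
    then have "J +>\<^bsub>poly_ring V\<^esub> r \<notin> (+>\<^bsub>poly_ring V\<^esub>) J ` P i"
      using primeideal_image_quot(2)[OF J p(1) JP] r(2) i by simp
    then show "(+>\<^bsub>poly_ring V\<^esub>) J ` P i \<subset> (+>\<^bsub>poly_ring V\<^esub>) J ` P (Suc i)"
      using sub r(1) by blast
  qed
  then have "enat d \<le> Sup ?L" by (intro Sup_upper) blast
  moreover have "Sup ?L \<le> enat d"
    by (rule Sup_least) (use prime_chain_vimage[OF J] bound in fastforce)
  ultimately show ?thesis unfolding krull_dim_def prime_chain_def by (rule antisym[rotated])
qed

text \<open>Elements chosen in P (i + 1) outside P i are algebraically independent modulo P 0. On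
  the other hand \<phi> embeds the quotient by the minors of C and the columns K into a polynomial
  ring in the X i with i outside K, the parameter Y 0 (the summand 1) and the Y (i + 1) with i
  outside K and C, so too many elements are dependent.\<close>

lemma prime_chain_length_le:
  fixes P :: "nat \<Rightarrow> ('k::field) bpoly set"
  assumes chain: "prime_chain (bring n) P k" and CK: "C \<union> K \<subseteq> {1..n}"
    and sub: "minors C \<union> cols K \<subseteq> P 0"
  shows "k \<le> card ({1..n} - K) + 1 + card ({1..n} - K - C)"
proof (rule ccontr)
  let ?S = "carrier (bring n) :: 'k bpoly set"
  let ?d = "card ({1..n} - K) + 1 + card ({1..n} - K - C)"
  assume "\<not> k \<le> ?d"
  then have k: "?d < k" by simp
  have prime: "primeideal (P i) (bring n)" if "i \<le> k" for i using chain that by (simp add: prime_chain_def)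
  have idl: "ideal (P i) (bring n)" if "i \<le> k" for i using prime[OF that] by (simp add: poly_ring_primeideal_iff)
  have "\<forall>i. \<exists>z. i < k \<longrightarrow> z \<in> P (Suc i) - P i" using chain unfolding prime_chain_def by blast
  then obtain z where z: "\<And>i. i < k \<Longrightarrow> z i \<in> P (Suc i) - P i" by metis
  define zs where "zs = map z [0..<Suc ?d]"
  have zsS: "set zs \<subseteq> ?S"
  proof
    fix p assume "p \<in> set zs"
    then have "p \<in> z ` {0..<Suc ?d}" by (simp add: zs_def del: upt_Suc)
    then obtain i where "i \<in> {0..<Suc ?d}" "p = z i" by (rule imageE)
    then have "i < k" using k by simp
    then show "p \<in> ?S"
      using z[of i] idl[of "Suc i"] \<open>p = z i\<close> unfolding poly_ring_ideal_iff by auto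
  qed
  let ?\<epsilon> = "\<lambda>i. if i \<in> K then 0 else 1 :: 'k"
  let ?\<phi> = "\<lambda>p. psub (segre C) (psub (colsub (\<lambda>i. i) ?\<epsilon>) p)"
  let ?W = "X ` ({1..n} - K) \<union> {Y 0} \<union> (\<lambda>i. Y (Suc i)) ` ({1..n} - K - C)"
  have "finite C" using CK finite_subset by blast
  have ker: "p \<in> P 0" if "p \<in> ?S" "?\<phi> p = 0" for p
  proof -
    have "psub (colsub (\<lambda>i. i) ?\<epsilon>) p \<in> rng.span (minors C)"
      using that(2) by (simp add: span_minors_kernel[OF \<open>finite C\<close>])
    then have "p \<in> rng.span (minors C \<union> colrel (\<lambda>i. i) ?\<epsilon>)"
      by (subst span_colrel) auto
    moreover have "colrel (\<lambda>i. i) ?\<epsilon> \<subseteq> rng.span (minors C \<union> cols K)"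
    proof
      fix q assume "q \<in> colrel (\<lambda>i. i) ?\<epsilon>"
      then obtain v where "q = pvar v - colsub (\<lambda>i. i) ?\<epsilon> v" by (auto simp: colrel_def)
      then show "q \<in> rng.span (minors C \<union> cols K)"
        by (cases v) (auto simp: cols_def rng.span_zero intro: rng.span_base)
    qed
    ultimately have "p \<in> rng.span (minors C \<union> cols K)"
      using rng.span_minimal[of "minors C \<union> colrel (\<lambda>i. i) ?\<epsilon>" "rng.span (minors C \<union> cols K)"]
      by (auto intro: rng.span_base)
    then have "p \<in> rng.span (P 0)" using rng.span_mono[OF sub] by blast
    then show ?thesis using ideal_span_closed[OF idl[of 0]] that(1) by blast
  qed
  have \<phi>W: "?\<phi> p \<in> carrier (poly_ring ?W)" if "p \<in> ?S" for p
  proof -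
    have eq: "?\<phi> p = psub (\<lambda>v. psub (segre C) (colsub (\<lambda>i. i) ?\<epsilon> v)) p" by (rule psub_psub)
    have "psub (segre C) (colsub (\<lambda>i. i) ?\<epsilon> v) \<in> carrier (poly_ring ?W)" if "v \<in> bvars n" for v
      using that by (auto simp: bvars_def zero_in_poly_ring intro!: mult_in_poly_ring)
    then show ?thesis unfolding eq by (intro psub_in_poly_ring[OF _ that])
  qed
  let ?ws = "map ?\<phi> zs"
  have "card ?W \<le> card (X ` ({1..n} - K) \<union> {Y 0}) + card ((\<lambda>i. Y (Suc i)) ` ({1..n} - K - C))"
    by (rule card_Un_le)
  also have "\<dots> \<le> ?d"
    using card_Un_le[of "X ` ({1..n} - K)" "{Y 0}"] card_image_le[of "{1..n} - K" X]
      card_image_le[of "{1..n} - K - C" "\<lambda>i. Y (Suc i)"] by simp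
  finally have card: "card ?W < length ?ws" by (simp add: zs_def)
  have "set ?ws \<subseteq> carrier (poly_ring ?W)" using \<phi>W zsS by auto
  from algebraic_dependence[OF _ card this] obtain A c where A: "finite A" "A \<noteq> {}"
    "\<forall>as\<in>A. length as = length ?ws \<and> c as \<noteq> 0"
    "(\<Sum>as\<in>A. const (c as) * power_prod ?ws as) = 0" by auto
  define p where "p = (\<Sum>as\<in>A. const (c as) * power_prod zs as)"
  have "p \<in> ?S"
    unfolding p_def using zsS by (intro sum_in_poly_ring poly_ring_closed power_prod_in_poly_ring)
  moreover have "?\<phi> p = (\<Sum>as\<in>A. const (c as) * power_prod ?ws as)"
    unfolding p_def by (simp add: psub_sum power_prod_hom[of ?\<phi>])
  ultimately have "p * 1 \<in> P 0" using ker A(4) by simp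
  moreover have "p * 1 \<notin> P 0"
    unfolding p_def
  proof (rule chain_independent[where V = "bvars n" and U = "\<lambda>_. {1}" and I = P])
    have len: "length zs = Suc ?d" by (simp add: zs_def)
    show "ideal (P i) (bring n)" if "i \<le> length zs" for i
      using that len k by (intro idl) simp
    show "{1} \<subseteq> ?S" by (simp add: one_in_poly_ring)
    have zs_nth: "zs ! i = z i" if "i < length zs" for i
      using that unfolding zs_def by (subst nth_map) (simp_all del: upt_Suc)
    show "u \<in> P i" if "i < length zs" "u \<in> ?S" "zs ! i * u \<in> P i" for i u
    proof -
      have i: "i < k" using that len k by simp
      have "zs ! i \<in> ?S" using that(1) zsS by auto
      moreover have "zs ! i \<notin> P i" using z[OF i] zs_nth[OF that(1)] by simp
      ultimately show ?thesis
        using that prime[of i] i unfolding poly_ring_primeideal_iff by auto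
    qed
    show "P i \<subseteq> P (Suc i) \<and> zs ! i \<in> P (Suc i)" if "i < length zs" for i
    proof -
      have "i < k" using that len k by simp
      then show ?thesis using z[of i] zs_nth[OF that] chain unfolding prime_chain_def by auto
    qed
    show "\<exists>k. \<exists>s\<in>?S. \<exists>u'\<in>{1}. s * u - zs ! i ^ k * u' \<in> P i" if "i < length zs" "u \<in> {1}" for i u
    proof -
      have "0 \<in> P i" using that len k idl[of i] unfolding poly_ring_ideal_iff by auto
      then show ?thesis using that
        by (intro exI[of _ 0] bexI[of _ 1]) (auto simp: one_in_poly_ring)
    qed
    show "const a * u \<notin> P (length zs)" if "u \<in> {1}" "a \<noteq> 0" for u a
    proof
      assume "const a * u \<in> P (length zs)"
      then have "const (inverse a) * (const a * u) \<in> P (length zs)"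
        using idl[of "length zs"] len k unfolding poly_ring_ideal_iff
        by (auto simp: const_in_poly_ring simp del: mult_single)
      then have "1 \<in> P (length zs)"
        using that by (simp add: mult_single)
      then show False using prime[of "length zs"] len k unfolding poly_ring_primeideal_iff by auto
    qed
  qed (use A zsS in auto)
  ultimately show False by blast
qed

text \<open>From x_j * [i k] = x_i * [j k] + x_k * [i j] and its y-version, proportionality passes
  through any column j not contained in P. If a column a in {1, 2} and a column h >= 3 survive, two
  columns of {1, 2} are compared through h and two columns of {3, ..., n} through a, so P contains
  all minors.\<close>

lemma prime_over_edge_minors:
  fixes P :: "('k::field) bpoly set"
  assumes e: "2 \<le> e" "e \<le> n" and P: "primeideal P (bring n)" and J: "edge_minors n e \<subseteq> P"
  shows "minors {Suc e..n} \<union> cols {1, 2} \<subseteq> P \<or> cols {3..n} \<subseteq> P \<or> minors {1..n} \<subseteq> P"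
proof (cases "cols {1, 2} \<subseteq> P \<or> cols {3..n} \<subseteq> P")
  case True
  have idl: "ideal P (bring n)" using P by (simp add: poly_ring_primeideal_iff)
  have "minors {Suc e..n} \<subseteq> P"
  proof
    fix p :: "'k bpoly" assume "p \<in> minors {Suc e..n}"
    then obtain i j where p: "p = det2 i j" "i \<in> {Suc e..n}" "j \<in> {Suc e..n}" by (auto simp: minors_def)
    then have "p \<in> rng.span (edge_minors n e)" by (auto intro: det2_edge_minors)
    then have "p \<in> rng.span P" using rng.span_mono[OF J] by blast
    moreover have "p \<in> carrier (bring n)"
      using p e by (auto intro!: det2_in_carrier simp: bvars_def)
    ultimately show "p \<in> P" using ideal_span_closed[OF idl] by blast
  qed
  then show ?thesis using True by blast
next
  case False
  let ?S = "carrier (bring n) :: 'k bpoly set"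
  have idl: "ideal P (bring n)" using P by (simp add: poly_ring_primeideal_iff)
  have vS: "xv i \<in> ?S" "yv i \<in> ?S" if "i \<in> {1..n}" for i using that by (auto simp: bvars_def)
  have dS: "det2 i j \<in> ?S" if "i \<in> {1..n}" "j \<in> {1..n}" for i j
    using that by (auto intro!: det2_in_carrier simp: bvars_def)
  have edge: "det2 i j \<in> P"
    if "i \<in> {1, 2} \<and> j \<in> {3..n} \<or> j \<in> {1, 2} \<and> i \<in> {3..n}" for i j
  proof -
    have "det2 i j \<in> rng.span (edge_minors n e)" using that by (intro det2_edge_minors) auto
    then have "det2 i j \<in> rng.span P" using rng.span_mono[OF J] by blast
    moreover have "det2 i j \<in> ?S" using that e by (intro dS) auto
    ultimately show ?thesis using ideal_span_closed[OF idl] by blast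
  qed
  have trans: "det2 i k \<in> P"
    if "xv j \<notin> P \<or> yv j \<notin> P" "det2 i j \<in> P" "det2 j k \<in> P" "i \<in> {1..n}" "j \<in> {1..n}" "k \<in> {1..n}" for i j k
  proof -
    have add: "p + q \<in> P" if "p \<in> P" "q \<in> P" for p q using idl that unfolding poly_ring_ideal_iff by blast
    have mul: "r * p \<in> P" if "r \<in> ?S" "p \<in> P" for r p using idl that unfolding poly_ring_ideal_iff by blast
    have "xv i * det2 j k + xv k * det2 i j \<in> P" "yv k * det2 i j + yv i * det2 j k \<in> P"
      using that vS by (auto intro!: add mul)
    moreover have "xv i * det2 j k + xv k * det2 i j = xv j * (det2 i k :: 'k bpoly)"
      "yv k * det2 i j + yv i * det2 j k = yv j * (det2 i k :: 'k bpoly)"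
      by (simp_all add: det2_def algebra_simps)
    ultimately have "xv j * det2 i k \<in> P" "yv j * det2 i k \<in> P" by simp_all
    then show ?thesis
      using that vS[of j] dS[of i k] P unfolding poly_ring_primeideal_iff by metis
  qed
  have "cols A \<subseteq> P \<longleftrightarrow> (\<forall>i\<in>A. xv i \<in> P \<and> yv i \<in> P)" for A by (auto simp: cols_def)
  then obtain a h where a: "a \<in> {1, 2}" "xv a \<notin> P \<or> yv a \<notin> P"
    and h: "h \<in> {3..n}" "xv h \<notin> P \<or> yv h \<notin> P" using False by metis
  have "det2 i k \<in> P" if ik: "i \<in> {1..n}" "k \<in> {1..n}" for i k
  proof -
    consider "i \<in> {1, 2} \<and> k \<in> {1, 2}" | "i \<in> {3..n} \<and> k \<in> {3..n}"
      | "i \<in> {1, 2} \<and> k \<in> {3..n} \<or> k \<in> {1, 2} \<and> i \<in> {3..n}" using ik by force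
    then show ?thesis
    proof cases
      case 1
      show ?thesis
        by (rule trans[OF h(2)]; (rule edge)?; use 1 h(1) ik in auto)
    next
      case 2
      show ?thesis
        by (rule trans[OF a(2)]; (rule edge)?; use 2 a(1) ik in auto)
    qed (rule edge)
  qed
  then show ?thesis unfolding minors_def by blast
qed

lemma pvar_neq_0 [simp]: "pvar v \<noteq> (0 :: ('v, 'k::field) mpoly)"
  by (metis lookup_single_eq lookup_zero pvar_def zero_neq_one)

lemma restrict_vars_mono_zero:
  assumes "restrict_vars U p = 0" "U' \<subseteq> U"
  shows "restrict_vars U' p = 0"
proof -
  have "restrict_vars U' (restrict_vars U q) = restrict_vars U' q" for q :: "('a, 'b) mpoly"
    by (induction q rule: mpoly_induct) (use assms(2) in auto)
  from this[of p] show ?thesis using assms(1) by simp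
qed

text \<open>
  Above the minimal prime given by columns \<open>1\<close>, \<open>2\<close> and the minors of the clique, the chain kills
  the variables of the parametrisation one at a time; \<open>Y 0\<close> is killed while \<open>X n\<close> is still alive,
  so that \<open>y\<^sub>n\<close> witnesses this step.
\<close>

lemma prime_chain_exists:
  assumes e: "4 \<le> e" "e < n"
  shows "\<exists>P :: nat \<Rightarrow> ('k::field) bpoly set.
    prime_chain (bring n) P (n + e - 3) \<and> edge_minors n e \<subseteq> P 0"
proof -
  let ?S = "carrier (bring n) :: 'k bpoly set"
  let ?C = "{Suc e..n}"
  let ?\<epsilon> = "\<lambda>i. if i \<in> {1, 2} then 0 else 1 :: 'k"
  define \<sigma> where "\<sigma> v = psub (segre ?C) (colsub (\<lambda>i. i) ?\<epsilon> v)" for v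
  \<comment> \<open>These are the variables in the image of \<sigma>; their number is (n - e - 1) +
    2 + (e - 2) + (e - 2) = n + e - 3.\<close>
  define ws where "ws = map X [Suc e..<n] @ [Y 0, X n] @ map X [3..<Suc e] @ map (\<lambda>i. Y (Suc i)) [3..<Suc e]"
  define d where "d = length ws"
  have d: "d = n + e - 3" using e by (simp add: d_def ws_def)
  have dist: "distinct ws" using e by (auto simp: ws_def distinct_map inj_on_def)
  define R where "R k = (restrict_vars (- set (take k ws)) :: 'k bpoly \<Rightarrow> 'k bpoly)" for k
  \<comment> \<open>Kernels of homomorphisms into a domain, hence prime: parametrise by \<sigma>,
    then set the first k variables of \<open>ws\<close> to zero.\<close>
  define P where "P k = {p \<in> ?S. R k (psub \<sigma> p) = 0}" for k
  have "primeideal (P k) (bring n)" for k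
    unfolding poly_ring_primeideal_iff poly_ring_ideal_iff
    by (auto simp: P_def R_def poly_ring_closed)
  moreover have "P k \<subset> P (Suc k)" if k: "k < d" for k
  proof
    have "- set (take (Suc k) ws) \<subseteq> - set (take k ws)"
      using set_take_subset_set_take[of k "Suc k" ws] by auto
    then show "P k \<subseteq> P (Suc k)" unfolding P_def R_def using restrict_vars_mono_zero by blast
    let ?w = "ws ! k"
    have w: "?w \<in> set ws" "?w \<notin> set (take k ws)" "?w \<in> set (take (Suc k) ws)"
      using k dist by (auto simp: d_def take_Suc_conv_app_nth in_set_conv_nth nth_eq_iff_index_eq)
    have "\<exists>v\<in>bvars n. R k (\<sigma> v) \<noteq> 0 \<and> R (Suc k) (\<sigma> v) = 0"
    proof (cases "?w = Y 0")
      case True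
      have "k = n - Suc e"
      proof -
        have "ws ! (n - Suc e) = Y 0" "n - Suc e < length ws" using e by (simp_all add: ws_def nth_append)
        then show ?thesis using True dist k by (metis d_def nth_eq_iff_index_eq)
      qed
      then have "set (take k ws) = X ` {Suc e..<n}" using e by (simp add: ws_def)
      then have "R k (\<sigma> (Y n)) = xv n * yv 0"
        using e by (auto simp: R_def \<sigma>_def)
      moreover have "xv n * yv 0 \<noteq> (0 :: 'k bpoly)" by simp
      moreover have "R (Suc k) (\<sigma> (Y n)) = 0" using e w(3) True by (auto simp: R_def \<sigma>_def)
      moreover have "Y n \<in> bvars n" using e by (simp add: bvars_def)
      ultimately show ?thesis by metis
    next
      case False
      have "\<exists>v\<in>bvars n. \<sigma> v = pvar ?w"
      proof -
        from w(1) False consider i where "?w = X i" "i \<in> {3..n}" | i where "?w = Y (Suc i)" "i \<in> {3..e}"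
          using e by (subst (asm) (2) ws_def) fastforce
        then show ?thesis
        proof cases
          case (1 i)
          then show ?thesis by (intro bexI[of _ "X i"]) (auto simp: bvars_def \<sigma>_def)
        next
          case (2 i)
          then show ?thesis using e by (intro bexI[of _ "Y i"]) (auto simp: bvars_def \<sigma>_def)
        qed
      qed
      moreover have "R k (pvar ?w) = pvar ?w" "R (Suc k) (pvar ?w) = (0 :: 'k bpoly)"
        using w by (simp_all add: R_def)
      moreover have "pvar ?w \<noteq> (0 :: 'k bpoly)" by simp
      ultimately show ?thesis by metis
    qed
    then obtain v where "v \<in> bvars n" "R k (\<sigma> v) \<noteq> 0" "R (Suc k) (\<sigma> v) = 0" by blast
    then have "pvar v \<in> P (Suc k)" "pvar v \<notin> P k" by (auto simp: P_def)
    then show "P k \<noteq> P (Suc k)" by blast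
  qed
  moreover have "edge_minors n e \<subseteq> P 0"
  proof
    fix g :: "'k bpoly" assume g: "g \<in> edge_minors n e"
    then obtain i j where "g = det2 i j" "i \<in> {1, 2} \<or> i \<in> ?C \<and> j \<in> ?C \<and> i \<notin> {1, 2} \<and> j \<notin> {1, 2}"
      using e by (auto simp: edge_minors_def)
    then have "psub \<sigma> g = 0" by (auto simp: det2_def \<sigma>_def)
    then show "g \<in> P 0"
      using g edge_minors_in_carrier[of n e] e by (auto simp: P_def R_def)
  qed
  ultimately have "prime_chain (bring n) P d \<and> edge_minors n e \<subseteq> P 0"
    unfolding prime_chain_def by blast
  then show ?thesis unfolding d by blast
qed

lemma krull_dim_join_edges:
  assumes e: "4 \<le> e" "e < n"
  shows "krull_dim ((bring n :: ('k::field) bpoly ring) Quot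
    binomial_edge_ideal n (join_edges n e)) = enat (n + e - 3)"
proof -
  let ?G = "edge_minors n e :: 'k bpoly set"
  have G: "?G \<subseteq> carrier (bring n)" using e by (intro edge_minors_in_carrier) auto
  have J: "binomial_edge_ideal n (join_edges n e) = rng.span ?G \<inter> carrier (bring n)"
    using e by (intro binomial_edge_ideal_join_edges) auto
  have le: "binomial_edge_ideal n (join_edges n e) \<subseteq> P \<longleftrightarrow> ?G \<subseteq> P" if "primeideal P (bring n)" for P
  proof
    assume "?G \<subseteq> P"
    then have "rng.span ?G \<inter> carrier (bring n) \<subseteq> rng.span P \<inter> carrier (bring n)"
      using rng.span_mono by blast
    also have "\<dots> = P" using that by (intro ideal_span_closed) (simp add: poly_ring_primeideal_iff)
    finally show "binomial_edge_ideal n (join_edges n e) \<subseteq> P" unfolding J .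
  next
    assume "binomial_edge_ideal n (join_edges n e) \<subseteq> P"
    then show "?G \<subseteq> P" using G unfolding J by (auto intro: rng.span_base)
  qed
  obtain P where P: "prime_chain (bring n) P (n + e - 3)" "?G \<subseteq> P 0"
    using prime_chain_exists[OF e, where 'k = 'k] by blast
  show ?thesis
  proof (rule krull_dim_quot_eqI)
    show "ideal (binomial_edge_ideal n (join_edges n e)) (bring n :: 'k bpoly ring)"
      unfolding J by (rule ideal_span_Int)
    show "prime_chain (bring n) P (n + e - 3)" by fact
    show "binomial_edge_ideal n (join_edges n e) \<subseteq> P 0"
      using P le by (simp add: prime_chain_def)
  next
    fix Q :: "nat \<Rightarrow> 'k bpoly set" and k
    assume Q: "prime_chain (bring n) Q k" "binomial_edge_ideal n (join_edges n e) \<subseteq> Q 0"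
    then have Q0: "primeideal (Q 0) (bring n)" by (simp add: prime_chain_def)
    then have "?G \<subseteq> Q 0" using Q(2) le by blast
    \<comment> \<open>Empty index sets bring all three cases into the form that
      \<open>prime_chain_length_le\<close> expects.\<close>
    have none: "minors {} = ({} :: 'k bpoly set)" "cols {} = ({} :: 'k bpoly set)"
      by (auto simp: minors_def cols_def)
    with \<open>?G \<subseteq> Q 0\<close> consider "minors {Suc e..n} \<union> cols {1, 2} \<subseteq> Q 0" | "minors {} \<union> cols {3..n} \<subseteq> Q 0"
      | "minors {1..n} \<union> cols {} \<subseteq> Q 0"
      using prime_over_edge_minors[of e n "Q 0"] Q0 e none by fastforce
    then show "k \<le> n + e - 3"
    proof cases
      case 1
      have "{1..n} - {1, 2} = {3..n}" "{3..n} - {Suc e..n} = {3..e}" using e by auto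
      then show ?thesis using prime_chain_length_le[OF Q(1) _ 1] e by simp
    next
      case 2
      \<comment> \<open>The bound obtained is 5, one above the dimension 4 of S/Q2, because Y 0 is
        counted although C is empty; n + e - 3 >= 6 leaves room.\<close>
      have "{1..n} - {3..n} = {1, 2}" using e by auto
      then show ?thesis using prime_chain_length_le[OF Q(1) _ 2] e by simp
    next
      case 3
      \<comment> \<open>Here the bound is n + 1, at most n + e - 3 because e >= 4.\<close>
      then show ?thesis using prime_chain_length_le[OF Q(1) _ 3] e by simp
    qed
  qed
qed

section \<open>Connectedness of the graph and the choice of e\<close>

lemma connected_join_edges:
  assumes e: "4 \<le> e" "e < n"
  shows "connected_graph {1..n} (join_edges n e)"
proof -
  let ?R = "{(a, b). {a, b} \<in> join_edges n e}"
  have simple: "simple_graph {1..n} (join_edges n e)"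
    using e by (auto simp: simple_graph_def join_edges_def)
  have edge: "(a, h) \<in> ?R" if "a \<in> {1, 2}" "h \<in> {3..n}" for a h
    unfolding join_edges_def using that by fastforce
  have sym: "sym (?R\<^sup>*)" by (rule sym_rtrancl) (simp add: sym_def insert_commute)
  have to_1: "(u, 1) \<in> ?R\<^sup>*" if u: "u \<in> {1..n}" for u
  proof -
    have base: "(h, 1) \<in> ?R\<^sup>*" "(2, h) \<in> ?R\<^sup>*" if "h \<in> {3..n}" for h
      using edge[of 1 h] edge[of 2 h] that symD[OF sym] by blast+
    consider "u = 1" | "u = 2" | "u \<in> {3..n}" using u by force
    then show ?thesis
    proof cases
      case 2
      have "3 \<in> {3..n}" using e by simp
      from rtrancl_trans[OF base(2)[OF this] base(1)[OF this]] show ?thesis using 2 by simp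
    qed (use base in auto)
  qed
  have "(u, v) \<in> ?R\<^sup>*" if "u \<in> {1..n}" "v \<in> {1..n}" for u v
    by (rule rtrancl_trans[OF to_1[OF that(1)] symD[OF sym to_1[OF that(2)]]])
  then show ?thesis
    using e simple unfolding connected_graph_def by simp
qed

theorem theorem2p3:
  fixes n d :: nat
  assumes "n \<ge> 5" and "n + 1 \<le> d" and "d \<le> 2 * n - 4"
  shows "\<exists>E. connected_graph {1..n} E \<and>
    depth (graded_max_ideal n)
      (quot_module (bring n :: (bvar, 'k::field) mpoly ring) (binomial_edge_ideal n E)) = 4 \<and>
    krull_dim ((bring n :: (bvar, 'k) mpoly ring) Quot binomial_edge_ideal n E) = enat d"
proof -
  \<comment> \<open>e solves n + e - 3 = d; the lower bound on d gives e >= 4 and the upper bound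
    gives e < n, so that the clique has at least one vertex.\<close>
  have e: "4 \<le> d + 3 - n" "d + 3 - n < n" and d: "n + (d + 3 - n) - 3 = d" using assms by auto
  from connected_join_edges[OF e] depth_join_edges[OF e, where 'k = 'k] krull_dim_join_edges[OF e, where 'k = 'k]
  show ?thesis unfolding d by blast
qed

end
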